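(* Let $H\in(\frac12,1)$. Let $(Z^{H,i}_t)_{t\ge0}$, $i\ge1$, be independent Rosenblatt processes with the same parameter $H$. For $n,d\ge1$ let $\mathcal{X}_{n,d}=(X_{ij})_{1\le i\le n,\,1\le j\le d}$ with $X_{ij}=Z^{H,i}_j-Z^{H,i}_{j-1}$, let $\mathcal{W}_{n,d}=\frac1d\mathcal{X}_{n,d}\mathcal{X}_{n,d}^T-\mathcal{I}_n$ with $\mathcal{I}_n$ the $n\times n$ identity matrix, and let $\widetilde{\mathcal{W}}_{n,d}=c_{1,H}^{-1}d^{1-H}\mathcal{W}_{n,d}$, where $c_{1,H}=4d(H)$ and $d(H)=\frac{1}{H+1}\sqrt{\frac{2(2H-1)}{H}}$. Let $\mathcal{R}^H_n$ be the $n\times n$ diagonal random matrix with diagonal entries $R^H_{ii}=Z^{H,i}_1$, $1\le i\le n$. Then for every $n\ge1$, the random matrix $\widetilde{\mathcal{W}}_{n,d}$ converges componentwise in distribution, as $d\to\infty$, to the matrix $\mathcal{R}^H_n$. Moreover, there exists a positive constant $C$ such that for all $n,d\ge1$, $$d_W(\widetilde{\mathcal{W}}_{n,d},\mathcal{R}^H_n)\le C\begin{cases} n\,d^{\frac12-H} & \text{if } H\in(\frac12,\frac34),\\ n\sqrt{\log(d)}\,d^{-\frac14} & \text{if } H=\frac34,\\ n\,d^{H-1} & \text{if } H\in(\frac34,1).\end{cases}$$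
   Context: The Rosenblatt process with parameter $H\in(\frac12,1)$ is $Z^H_t=I_2(L_t)$, $t\ge0$, where $I_2$ is the multiple Wiener integral of order two with respect to a standard Brownian motion $(B_t)_{t\ge0}$ (normalized by $\mathbb{E}(I_2(f)^2)=2\|f\|^2_{L^2(\mathbb{R}_+^2)}$ for symmetric $f$) and $$L_t(y_1,y_2)=d(H)\,\mathbf{1}_{[0,t]^2}(y_1,y_2)\int_{y_1\vee y_2}^t\partial_1K^{\frac{H+1}{2}}(u,y_1)\,\partial_1K^{\frac{H+1}{2}}(u,y_2)\,du,$$ with $d(H)=\frac{1}{H+1}\sqrt{\frac{2(2H-1)}{H}}$, $\partial_1$ the partial derivative in the first variable, and, for $H'\in(\frac12,1)$ and $t>s$, $$K^{H'}(t,s)=c(H')\,s^{\frac12-H'}\int_s^t(u-s)^{H'-\frac32}u^{H'-\frac12}\,du,\qquad c(H')=\sqrt{\frac{H'(2H'-1)}{\beta(2-2H',H'-\frac12)}},$$ $\beta$ being the beta function. The independent processes $Z^{H,i}$ are obtained by using independent Brownian motions $B^i$ in place of $B$, i.e. $Z^{H,i}_t=I^i_2(L_t)$ with $I_2^i$ the double Wiener integral with respect to $B^i$. For random matrices $\mathcal{X},\mathcal{Y}$ with values in the space $\mathcal{M}_n(\mathbb{R})$ of real $n\times n$ matrices, the Wasserstein distance is $$d_W(\mathcal{X},\mathcal{Y})=\sup_{\|g\|_{\mathrm{Lip}}\le1}|\mathbb{E}(g(\mathcal{X}))-\mathbb{E}(g(\mathcal{Y}))|,$$ the supremum being over $g:\mathcal{M}_n(\mathbb{R})\to\mathbb{R}$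 with $\|g\|_{\mathrm{Lip}}=\sup_{A\ne B}\frac{|g(A)-g(B)|}{\|A-B\|_{\mathrm{HS}}}$, where $\|\cdot\|_{\mathrm{HS}}$ is the Hilbert–Schmidt norm.
   Formalization: For H = 3/4 the Wasserstein bound is stated only for d ≥ 2, because at d = 1 the printed right-hand side is 0 (log 1 = 0) while the distance is positive, e.g. for n = 2, where the off-diagonal entry has positive variance. *)

theory Defs
  imports "HOL-Probability.Probability" "Jordan_Normal_Form.Matrix"
begin

definition standard_brownian_motion :: "'a measure \<Rightarrow> (real \<Rightarrow> 'a \<Rightarrow> real) \<Rightarrow> bool" where
  "standard_brownian_motion M B \<longleftrightarrow>
     prob_space M \<and>
     (\<forall>t\<ge>0. B t \<in> borel_measurable M) \<and>
     (AE \<omega> in M. B 0 \<omega> = 0) \<and>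
     (\<forall>s t. 0 \<le> s \<longrightarrow> s < t \<longrightarrow>
        distributed M lborel (\<lambda>\<omega>. B t \<omega> - B s \<omega>) (normal_density 0 (sqrt (t - s)))) \<and>
     (\<forall>(m::nat) (s :: nat \<Rightarrow> real). 0 \<le> s 0 \<longrightarrow> (\<forall>k<m. s k < s (Suc k)) \<longrightarrow>
        prob_space.indep_vars M (\<lambda>_. borel) (\<lambda>k \<omega>. B (s (Suc k)) \<omega> - B (s k) \<omega>) {..<m}) \<and>
     (AE \<omega> in M. continuous_on {0..} (\<lambda>t. B t \<omega>))"

text \<open>
  Independence of whole processes: the path maps into the product space over the time set
  are independent, i.e. the sigma-algebras generated by the processes are independent.
\<close>

definition indep_processes :: "'a measure \<Rightarrow> nat set \<Rightarrow> (nat \<Rightarrow> real \<Rightarrow> 'a \<Rightarrow> real) \<Rightarrow> bool" where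
  "indep_processes M I B \<longleftrightarrow>
     prob_space.indep_vars M (\<lambda>_. Pi\<^sub>M {0..} (\<lambda>_. borel)) (\<lambda>i \<omega>. \<lambda>t\<in>{0..}. B i t \<omega>) I"

text \<open>
  The double Wiener integral is built as usual: it is given explicitly on step functions on a
  grid of half-open intervals that vanish on the diagonal blocks, and extended to
  square-integrable functions on the quadrant by \<open>L\<^sup>2\<close>-continuity. Being an element of
  \<open>L\<^sup>2(M)\<close>, it is determined only up to almost sure equality, so it is rendered as a relation
  between the integrand \<open>f\<close> and the random variables \<open>Y\<close> representing the integral. On the step
  functions one has \<open>E(I(f)\<^sup>2) = 2 \<parallel>f\<parallel>\<^sup>2\<close> for symmetric \<open>f\<close>. The \<open>L\<^sup>2\<close>-distances are nonnegative
  integrals because Bochner integrals of non-integrable functions are 0.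
\<close>

definition off_diagonal_step :: "nat \<Rightarrow> (nat \<Rightarrow> real) \<Rightarrow> (nat \<Rightarrow> nat \<Rightarrow> real) \<Rightarrow> bool" where
  "off_diagonal_step m s a \<longleftrightarrow> 0 \<le> s 0 \<and> (\<forall>k<m. s k < s (Suc k)) \<and> (\<forall>k<m. a k k = 0)"

definition step_function ::
    "nat \<Rightarrow> (nat \<Rightarrow> real) \<Rightarrow> (nat \<Rightarrow> nat \<Rightarrow> real) \<Rightarrow> real \<times> real \<Rightarrow> real" where
  "step_function m s a y =
     (\<Sum>k<m. \<Sum>l<m. a k l * indicator ({s k<..s (Suc k)} \<times> {s l<..s (Suc l)}) y)"

definition step_integral ::
    "(real \<Rightarrow> 'a \<Rightarrow> real) \<Rightarrow> nat \<Rightarrow> (nat \<Rightarrow> real) \<Rightarrow> (nat \<Rightarrow> nat \<Rightarrow> real) \<Rightarrow> 'a \<Rightarrow> real" where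
  "step_integral B m s a \<omega> =
     (\<Sum>k<m. \<Sum>l<m. a k l * (B (s (Suc k)) \<omega> - B (s k) \<omega>) * (B (s (Suc l)) \<omega> - B (s l) \<omega>))"

definition has_double_wiener_integral ::
    "'a measure \<Rightarrow> (real \<Rightarrow> 'a \<Rightarrow> real) \<Rightarrow> (real \<times> real \<Rightarrow> real) \<Rightarrow> ('a \<Rightarrow> real) \<Rightarrow> bool" where
  "has_double_wiener_integral M B f Y \<longleftrightarrow>
     f \<in> borel_measurable lborel \<and>
     Y \<in> borel_measurable M \<and>
     (\<exists>(m :: nat \<Rightarrow> nat) (s :: nat \<Rightarrow> nat \<Rightarrow> real) (a :: nat \<Rightarrow> nat \<Rightarrow> nat \<Rightarrow> real).
        (\<forall>r. off_diagonal_step (m r) (s r) (a r)) \<and>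
        (\<lambda>r. \<integral>\<^sup>+y\<in>{0..} \<times> {0..}. ennreal ((step_function (m r) (s r) (a r) y - f y)\<^sup>2) \<partial>lborel)
          \<longlonglongrightarrow> 0 \<and>
        (\<lambda>r. \<integral>\<^sup>+\<omega>. ennreal ((step_integral B (m r) (s r) (a r) \<omega> - Y \<omega>)\<^sup>2) \<partial>M)
          \<longlonglongrightarrow> 0)"

definition fbm_const :: "real \<Rightarrow> real" where
  "fbm_const h = sqrt (h * (2 * h - 1) / Beta (2 - 2 * h) (h - 1/2))"

text \<open>Only the values for \<open>t > s > 0\<close> matter.\<close>

definition fbm_kernel :: "real \<Rightarrow> real \<Rightarrow> real \<Rightarrow> real" where
  "fbm_kernel h t s = fbm_const h * s powr (1/2 - h) *
     (LBINT u:{s..t}. (u - s) powr (h - 3/2) * u powr (h - 1/2))"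

definition fbm_kernel_deriv :: "real \<Rightarrow> real \<Rightarrow> real \<Rightarrow> real" where
  "fbm_kernel_deriv h u s = deriv (\<lambda>x. fbm_kernel h x s) u"

definition rosenblatt_const :: "real \<Rightarrow> real" where
  "rosenblatt_const H = 1 / (H + 1) * sqrt (2 * (2 * H - 1) / H)"

definition rosenblatt_kernel :: "real \<Rightarrow> real \<Rightarrow> real \<times> real \<Rightarrow> real" where
  "rosenblatt_kernel H t = (\<lambda>(y1, y2). rosenblatt_const H * indicator ({0..t} \<times> {0..t}) (y1, y2) *
     (LBINT u:{max y1 y2..t}. fbm_kernel_deriv ((H + 1) / 2) u y1 * fbm_kernel_deriv ((H + 1) / 2) u y2))"

definition rosenblatt_process ::
    "'a measure \<Rightarrow> (real \<Rightarrow> 'a \<Rightarrow> real) \<Rightarrow> real \<Rightarrow> (real \<Rightarrow> 'a \<Rightarrow> real) \<Rightarrow> bool" where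
  "rosenblatt_process M B H Z \<longleftrightarrow>
     (\<forall>t\<ge>0. has_double_wiener_integral M B (rosenblatt_kernel H t) (Z t))"

text \<open>
  Matrix rows and columns are indexed from 0, the processes from 1: the entry at position
  \<open>(i, j)\<close> below is the increment of \<open>Z\<^sup>i\<^sup>+\<^sup>1\<close> over \<open>[j, j + 1]\<close>.
\<close>

definition increment_matrix ::
    "(nat \<Rightarrow> real \<Rightarrow> 'a \<Rightarrow> real) \<Rightarrow> nat \<Rightarrow> nat \<Rightarrow> 'a \<Rightarrow> real mat" where
  "increment_matrix Z n d \<omega> =
     Matrix.mat n d (\<lambda>(i, j). Z (Suc i) (real (Suc j)) \<omega> - Z (Suc i) (real j) \<omega>)"

definition wishart_matrix ::
    "(nat \<Rightarrow> real \<Rightarrow> 'a \<Rightarrow> real) \<Rightarrow> nat \<Rightarrow> nat \<Rightarrow> 'a \<Rightarrow> real mat" where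
  "wishart_matrix Z n d \<omega> =
     (1 / real d) \<cdot>\<^sub>m (increment_matrix Z n d \<omega> * transpose_mat (increment_matrix Z n d \<omega>)) - 1\<^sub>m n"

definition renorm_const :: "real \<Rightarrow> real" where
  "renorm_const H = 4 * rosenblatt_const H"

definition renorm_wishart_matrix ::
    "real \<Rightarrow> (nat \<Rightarrow> real \<Rightarrow> 'a \<Rightarrow> real) \<Rightarrow> nat \<Rightarrow> nat \<Rightarrow> 'a \<Rightarrow> real mat" where
  "renorm_wishart_matrix H Z n d \<omega> =
     (inverse (renorm_const H) * real d powr (1 - H)) \<cdot>\<^sub>m wishart_matrix Z n d \<omega>"

definition rosenblatt_matrix ::
    "(nat \<Rightarrow> real \<Rightarrow> 'a \<Rightarrow> real) \<Rightarrow> nat \<Rightarrow> 'a \<Rightarrow> real mat" where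
  "rosenblatt_matrix Z n \<omega> = mat_diag n (\<lambda>i. Z (Suc i) 1 \<omega>)"

definition hs_norm :: "real mat \<Rightarrow> real" where
  "hs_norm A = sqrt (\<Sum>i<dim_row A. \<Sum>j<dim_col A. (A $$ (i, j))\<^sup>2)"

text \<open>Suprema are taken in \<^typ>\<open>ennreal\<close>, so that unbounded families are not mishandled.\<close>

definition lip_norm :: "nat \<Rightarrow> (real mat \<Rightarrow> real) \<Rightarrow> ennreal" where
  "lip_norm n g =
     (SUP (A, B)\<in>{(A, B). A \<in> carrier_mat n n \<and> B \<in> carrier_mat n n \<and> A \<noteq> B}.
        ennreal (\<bar>g A - g B\<bar> / hs_norm (A - B)))"

definition wasserstein_dist ::
    "nat \<Rightarrow> 'a measure \<Rightarrow> ('a \<Rightarrow> real mat) \<Rightarrow> 'b measure \<Rightarrow> ('b \<Rightarrow> real mat) \<Rightarrow> ennreal" where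
  "wasserstein_dist n M X N Y =
     (SUP g\<in>{g. lip_norm n g \<le> 1}. ennreal \<bar>(LINT \<omega>|M. g (X \<omega>)) - (LINT \<omega>|N. g (Y \<omega>))\<bar>)"

definition wasserstein_rate :: "real \<Rightarrow> nat \<Rightarrow> nat \<Rightarrow> real" where
  "wasserstein_rate H n d =
     (if H < 3/4 then real n * real d powr (1/2 - H)
      else if H = 3/4 then real n * sqrt (ln (real d)) * real d powr (- 1/4)
      else real n * real d powr (H - 1))"

end

theory Submission
  imports Defs "HOL-Real_Asymp.Real_Asymp"
begin

text \<open>
  An increment of the Rosenblatt process is the double Wiener integral \<open>X j = I\<^sub>2 (f j)\<close> of
  \<open>f j = c * (LBINT u:{j..j + 1}. k u \<otimes> k u)\<close>, where \<open>\<langle>k u, k v\<rangle>\<close> is a constant times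
  \<open>\<bar>u - v\<bar> powr (H - 1)\<close>. An off-diagonal entry is a multiple of \<open>\<Sum>j<d. X j * X' j\<close> with independent factors,
  and its variance is governed by the squared covariances, which decay like \<open>r powr (4 * H - 4)\<close> in the
  distance \<open>r\<close>. A diagonal entry is compared in \<open>L\<^sup>2\<close> with \<open>d powr (- H) * Z d\<close>, which by
  self-similarity has the law of \<open>Z 1\<close>, jointly over the independent rows. The error is a multiple
  of the sum of the terms \<open>((X j)\<^sup>2 - 1) / (4 * c) - X j\<close>. Their covariances follow from the moments
  \<open>E (X Y)\<close>, \<open>E (X\<^sup>2 Y)\<close> and \<open>E (X\<^sup>2 Y\<^sup>2)\<close> of double Wiener integrals; the contributions of order
  \<open>r powr (2 * H - 2)\<close> cancel up to differences that telescope, and what remains is again of order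
  \<open>r powr (4 * H - 4)\<close>.

  The moment formulas hold for quadratic forms in independent Gaussian variables by integration by
  parts. They pass to the limit because a form \<open>Q\<close> with vanishing diagonal satisfies
  \<open>E (Q\<^sup>4) \<le> 15 * (E (Q\<^sup>2))\<^sup>2\<close>, so that \<open>L\<^sup>2\<close>-convergence implies \<open>L\<^sup>4\<close>-convergence.
\<close>

subsection \<open>Square-integrable functions\<close>

text \<open>The divisor \<open>4 * c\<close> comes from the second chaos component of the centred
  square of \<open>X j\<close>: it is four times the double integral of the contraction of
  \<open>f j\<close> with itself. That contraction averages the tensor products of
  \<open>k u\<close> and \<open>k v\<close>, for u and v in the same unit cell, with weight the
  inner product of \<open>k u\<close> and \<open>k v\<close>. Against a distant kernel u and v can
  hardly be told apart, so it acts like a multiple of \<open>f j\<close>, the factor being the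
  integral of the weight over the cell, which is \<open>c\<close>. The obstacle is that a single
  \<open>k u\<close> is not square-integrable: the inner product is infinite on the diagonal. Traces
  are therefore computed with values in [0, \<infinity>] by Tonelli's theorem, which nonnegativity
  of the kernels permits. Nonnegativity also makes crude estimates sufficient: extreme values of the
  inner product between two distant cells bound every moment in the direction in which it enters the
  covariance. Independence and Gaussian laws are given for Brownian paths, while \<open>Z\<close>
  consists of mean-square limits; both are therefore exploited on step approximations and carried
  over.\<close>

definition L2 :: "'b measure \<Rightarrow> ('b \<Rightarrow> real) \<Rightarrow> bool" where
  "L2 M f \<longleftrightarrow> f \<in> borel_measurable M \<and> integrable M (\<lambda>x. (f x)\<^sup>2)"

text \<open>Membership of all terms and of the limit is part of the notion: the Bochner integral of
  a non-integrable function is 0, so the limit statement alone would carry no information.\<close>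

definition L2_tendsto :: "'b measure \<Rightarrow> (nat \<Rightarrow> 'b \<Rightarrow> real) \<Rightarrow> ('b \<Rightarrow> real) \<Rightarrow> bool" where
  "L2_tendsto M F f \<longleftrightarrow> (\<forall>r. L2 M (F r)) \<and> L2 M f \<and> (\<lambda>r. \<integral>x. (F r x - f x)\<^sup>2 \<partial>M) \<longlonglongrightarrow> 0"

lemma L2_measurable[measurable_dest]: "L2 M f \<Longrightarrow> f \<in> borel_measurable M"
  by (simp add: L2_def)

lemma L2_integrable_square: "L2 M f \<Longrightarrow> integrable M (\<lambda>x. (f x)\<^sup>2)"
  by (simp add: L2_def)

lemma L2_iff_nn_integral:
  "L2 M f \<longleftrightarrow> f \<in> borel_measurable M \<and> (\<integral>\<^sup>+x. ennreal ((f x)\<^sup>2) \<partial>M) < \<infinity>"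
  unfolding L2_def by (auto simp: integrable_iff_bounded)

lemma L2_integrable_mult:
  assumes "L2 M f" "L2 M g"
  shows "integrable M (\<lambda>x. f x * g x)"
proof (rule Bochner_Integration.integrable_bound)
  show "integrable M (\<lambda>x. (f x)\<^sup>2 + (g x)\<^sup>2)"
    using assms by (auto simp: L2_def)
  show "(\<lambda>x. f x * g x) \<in> borel_measurable M"
    using assms by (auto simp: L2_def)
  have "\<bar>a * b\<bar> \<le> a\<^sup>2 + b\<^sup>2" for a b :: real
  proof -
    have "2 * \<bar>a * b\<bar> \<le> a\<^sup>2 + b\<^sup>2"
      using sum_squares_bound[of "\<bar>a\<bar>" "\<bar>b\<bar>"] by (simp add: abs_mult)
    then show ?thesis by linarith
  qed
  then show "AE x in M. norm (f x * g x) \<le> norm ((f x)\<^sup>2 + (g x)\<^sup>2)"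
    by auto
qed

lemma L2_cmult: "L2 M f \<Longrightarrow> L2 M (\<lambda>x. c * f x)"
  by (auto simp: L2_def power_mult_distrib)

lemma L2_add:
  assumes "L2 M f" "L2 M g"
  shows "L2 M (\<lambda>x. f x + g x)"
  using assms L2_integrable_mult[OF assms]
  by (auto simp: L2_def power2_sum mult.assoc)

lemma L2_diff:
  assumes "L2 M f" "L2 M g"
  shows "L2 M (\<lambda>x. f x - g x)"
  using L2_add[OF assms(1) L2_cmult[OF assms(2), of "-1"]] by simp

lemma L2_sum: "(\<And>i. i \<in> I \<Longrightarrow> L2 M (f i)) \<Longrightarrow> L2 M (\<lambda>x. \<Sum>i\<in>I. f i x)"
proof (induction I rule: infinite_finite_induct)
  case (insert i I)
  then show ?case using L2_add[of M "f i" "\<lambda>x. \<Sum>i\<in>I. f i x"] by simp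
qed (auto simp: L2_def)

lemma L2_cong_AE:
  assumes "L2 M f" "g \<in> borel_measurable M" "AE x in M. f x = g x"
  shows "L2 M g"
proof -
  have "integrable M (\<lambda>x. (g x)\<^sup>2)"
    using assms by (subst integrable_cong_AE[where g = "\<lambda>x. (f x)\<^sup>2"]) (auto simp: L2_def)
  with assms show ?thesis by (simp add: L2_def)
qed

lemma Cauchy_Schwarz_L2:
  assumes "L2 M f" "L2 M g"
  shows "(\<integral>x. f x * g x \<partial>M)\<^sup>2 \<le> (\<integral>x. (f x)\<^sup>2 \<partial>M) * (\<integral>x. (g x)\<^sup>2 \<partial>M)"
proof -
  have m: "f \<in> borel_measurable M" "g \<in> borel_measurable M"
    using assms by (auto simp: L2_def)
  have i: "integrable M (\<lambda>x. \<bar>f x * g x\<bar>)"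
    using L2_integrable_mult[OF assms] by auto
  have "\<bar>\<integral>x. f x * g x \<partial>M\<bar> \<le> (\<integral>x. \<bar>f x * g x\<bar> \<partial>M)"
    by (rule integral_abs_bound)
  then have "(\<integral>x. f x * g x \<partial>M)\<^sup>2 \<le> (\<integral>x. \<bar>f x * g x\<bar> \<partial>M)\<^sup>2"
    by (metis abs_ge_zero power2_abs power_mono)
  moreover have "ennreal ((\<integral>x. \<bar>f x * g x\<bar> \<partial>M)\<^sup>2) \<le> ennreal ((\<integral>x. (f x)\<^sup>2 \<partial>M) * (\<integral>x. (g x)\<^sup>2 \<partial>M))"
  proof -
    have "ennreal ((\<integral>x. \<bar>f x * g x\<bar> \<partial>M)\<^sup>2) = (\<integral>\<^sup>+x. ennreal \<bar>f x\<bar> * ennreal \<bar>g x\<bar> \<partial>M)\<^sup>2"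
    proof -
      have "ennreal (\<integral>x. \<bar>f x * g x\<bar> \<partial>M) = (\<integral>\<^sup>+x. ennreal \<bar>f x * g x\<bar> \<partial>M)"
        using i by (intro nn_integral_eq_integral[symmetric]) auto
      also have "\<dots> = (\<integral>\<^sup>+x. ennreal \<bar>f x\<bar> * ennreal \<bar>g x\<bar> \<partial>M)"
        by (simp add: abs_mult ennreal_mult)
      finally show ?thesis by (simp add: ennreal_power[symmetric])
    qed
    also have "\<dots> \<le> (\<integral>\<^sup>+x. (ennreal \<bar>f x\<bar>)\<^sup>2 \<partial>M) * (\<integral>\<^sup>+x. (ennreal \<bar>g x\<bar>)\<^sup>2 \<partial>M)"
      using m by (intro Cauchy_Schwarz_nn_integral) auto
    also have "\<dots> = ennreal (\<integral>x. (f x)\<^sup>2 \<partial>M) * ennreal (\<integral>x. (g x)\<^sup>2 \<partial>M)"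
      using assms by (simp add: ennreal_power nn_integral_eq_integral L2_def)
    also have "\<dots> = ennreal ((\<integral>x. (f x)\<^sup>2 \<partial>M) * (\<integral>x. (g x)\<^sup>2 \<partial>M))"
      by (simp add: ennreal_mult)
    finally show ?thesis .
  qed
  ultimately show ?thesis
    by (smt (verit, best) ennreal_le_iff integral_nonneg_AE mult_nonneg_nonneg zero_le_power2 AE_I2)
qed

lemma abs_integral_mult_L2_le:
  assumes "L2 M f" "L2 M g"
  shows "\<bar>\<integral>x. f x * g x \<partial>M\<bar> \<le> sqrt (\<integral>x. (f x)\<^sup>2 \<partial>M) * sqrt (\<integral>x. (g x)\<^sup>2 \<partial>M)"
  using real_sqrt_le_mono[OF Cauchy_Schwarz_L2[OF assms]] by (simp add: real_sqrt_mult)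

lemma L2_tendsto_integral_mult:
  assumes F: "L2_tendsto M F f" and G: "L2_tendsto M G g"
  shows "(\<lambda>r. \<integral>x. F r x * G r x \<partial>M) \<longlonglongrightarrow> (\<integral>x. f x * g x \<partial>M)"
proof -
  note [simp] = F[unfolded L2_tendsto_def, THEN conjunct1, rule_format]
    G[unfolded L2_tendsto_def, THEN conjunct1, rule_format]
  have [simp]: "L2 M f" "L2 M g" using F G by (auto simp: L2_tendsto_def)
  define dF where "dF r x = F r x - f x" for r x
  define dG where "dG r x = G r x - g x" for r x
  have [simp]: "L2 M (dF r)" "L2 M (dG r)" for r
    unfolding dF_def dG_def by (auto intro: L2_diff)
  have lF: "(\<lambda>r. sqrt (\<integral>x. (dF r x)\<^sup>2 \<partial>M)) \<longlonglongrightarrow> 0" and lG: "(\<lambda>r. sqrt (\<integral>x. (dG r x)\<^sup>2 \<partial>M)) \<longlonglongrightarrow> 0"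
    using F G tendsto_real_sqrt[of _ 0] by (auto simp: L2_tendsto_def dF_def dG_def)
  have eq: "(\<integral>x. F r x * G r x \<partial>M) - (\<integral>x. f x * g x \<partial>M) =
      (\<integral>x. dF r x * dG r x \<partial>M) + (\<integral>x. f x * dG r x \<partial>M) + (\<integral>x. dF r x * g x \<partial>M)" for r
  proof -
    have "(\<integral>x. F r x * G r x \<partial>M) = (\<integral>x. (dF r x * dG r x + f x * dG r x + dF r x * g x) + f x * g x \<partial>M)"
      by (simp add: dF_def dG_def algebra_simps)
    also have "\<dots> = (\<integral>x. dF r x * dG r x \<partial>M) + (\<integral>x. f x * dG r x \<partial>M) + (\<integral>x. dF r x * g x \<partial>M) + (\<integral>x. f x * g x \<partial>M)"
      by (subst Bochner_Integration.integral_add | simp add: L2_integrable_mult)+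
    finally show ?thesis by simp
  qed
  have "(\<lambda>r. \<integral>x. dF r x * dG r x \<partial>M) \<longlonglongrightarrow> 0"
    by (rule Lim_null_comparison[OF _ tendsto_mult_zero[OF lF lG]])
       (auto intro!: always_eventually abs_integral_mult_L2_le)
  moreover have "(\<lambda>r. \<integral>x. f x * dG r x \<partial>M) \<longlonglongrightarrow> 0"
    by (rule Lim_null_comparison[OF _ tendsto_mult_right_zero[OF lG, of "sqrt (\<integral>x. (f x)\<^sup>2 \<partial>M)"]])
       (auto intro!: always_eventually abs_integral_mult_L2_le)
  moreover have "(\<lambda>r. \<integral>x. dF r x * g x \<partial>M) \<longlonglongrightarrow> 0"
    by (rule Lim_null_comparison[OF _ tendsto_mult_left_zero[OF lF, of "sqrt (\<integral>x. (g x)\<^sup>2 \<partial>M)"]])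
       (auto intro!: always_eventually abs_integral_mult_L2_le)
  ultimately have "(\<lambda>r. (\<integral>x. F r x * G r x \<partial>M) - (\<integral>x. f x * g x \<partial>M)) \<longlonglongrightarrow> 0"
    unfolding eq by (auto intro!: tendsto_add_zero)
  then show ?thesis by (simp add: LIM_zero_iff)
qed

lemma integral_square_add_le:
  assumes "L2 M f" "L2 M g"
  shows "(\<integral>x. (f x + g x)\<^sup>2 \<partial>M) \<le> 2 * (\<integral>x. (f x)\<^sup>2 \<partial>M) + 2 * (\<integral>x. (g x)\<^sup>2 \<partial>M)"
proof -
  have "(\<integral>x. (f x + g x)\<^sup>2 \<partial>M) \<le> (\<integral>x. 2 * (f x)\<^sup>2 + 2 * (g x)\<^sup>2 \<partial>M)"
  proof (rule integral_mono)
    show "integrable M (\<lambda>x. (f x + g x)\<^sup>2)"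
      using L2_add[OF assms] by (simp add: L2_def)
    show "(f x + g x)\<^sup>2 \<le> 2 * (f x)\<^sup>2 + 2 * (g x)\<^sup>2" for x
      using sum_squares_bound[of "f x" "g x"] by (simp add: power2_sum)
  qed (use assms in \<open>auto simp: L2_def\<close>)
  also have "\<dots> = 2 * (\<integral>x. (f x)\<^sup>2 \<partial>M) + 2 * (\<integral>x. (g x)\<^sup>2 \<partial>M)"
    using assms by (simp add: L2_def)
  finally show ?thesis .
qed

lemma L2_tendsto_cmult:
  assumes "L2_tendsto M F f"
  shows "L2_tendsto M (\<lambda>r x. c * F r x) (\<lambda>x. c * f x)"
proof -
  have "(\<lambda>r. c\<^sup>2 * (\<integral>x. (F r x - f x)\<^sup>2 \<partial>M)) \<longlonglongrightarrow> 0"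
    using assms by (intro tendsto_mult_right_zero) (simp add: L2_tendsto_def)
  also have "(\<lambda>r. c\<^sup>2 * (\<integral>x. (F r x - f x)\<^sup>2 \<partial>M)) = (\<lambda>r. \<integral>x. (c * F r x - c * f x)\<^sup>2 \<partial>M)"
    by (simp flip: right_diff_distrib add: power_mult_distrib)
  finally show ?thesis using assms by (auto simp: L2_tendsto_def intro: L2_cmult)
qed

lemma L2_tendsto_add:
  assumes "L2_tendsto M F f" "L2_tendsto M G g"
  shows "L2_tendsto M (\<lambda>r x. F r x + G r x) (\<lambda>x. f x + g x)"
proof -
  have L: "L2 M f" "L2 M g" "L2 M (F r)" "L2 M (G r)" for r
    using assms by (auto simp: L2_tendsto_def)
  have "(\<lambda>r. 2 * (\<integral>x. (F r x - f x)\<^sup>2 \<partial>M) + 2 * (\<integral>x. (G r x - g x)\<^sup>2 \<partial>M)) \<longlonglongrightarrow> 0"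
    using assms by (intro tendsto_add_zero tendsto_mult_right_zero) (auto simp: L2_tendsto_def)
  moreover have "(\<integral>x. (F r x + G r x - (f x + g x))\<^sup>2 \<partial>M) \<le>
      2 * (\<integral>x. (F r x - f x)\<^sup>2 \<partial>M) + 2 * (\<integral>x. (G r x - g x)\<^sup>2 \<partial>M)" for r
    using integral_square_add_le[OF L2_diff[OF L(3)[of r] L(1)] L2_diff[OF L(4)[of r] L(2)]]
    by (simp add: algebra_simps)
  ultimately have "(\<lambda>r. \<integral>x. (F r x + G r x - (f x + g x))\<^sup>2 \<partial>M) \<longlonglongrightarrow> 0"
    by (elim Lim_null_comparison[rotated]) auto
  with L show ?thesis by (auto simp: L2_tendsto_def intro: L2_add)
qed

lemma L2_tendsto_const: "L2 M f \<Longrightarrow> L2_tendsto M (\<lambda>r. f) f"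
  by (simp add: L2_tendsto_def)

text \<open>Bridges the nonnegative integrals in the definition of the double Wiener integral to
  \<open>L2_tendsto\<close>. Square-integrability of \<open>f\<close> is a conclusion: a single
  index at finite distance writes \<open>f\<close> as a difference of two square-integrable
  functions.\<close>

lemma L2_tendstoI_nn:
  assumes L: "\<And>r. L2 M (F r)" and f[measurable]: "f \<in> borel_measurable M"
    and lim: "(\<lambda>r. \<integral>\<^sup>+x. ennreal ((F r x - f x)\<^sup>2) \<partial>M) \<longlonglongrightarrow> 0"
  shows "L2_tendsto M F f"
proof -
  have [measurable]: "F r \<in> borel_measurable M" for r using L by (simp add: L2_def)
  have "eventually (\<lambda>r. (\<integral>\<^sup>+x. ennreal ((F r x - f x)\<^sup>2) \<partial>M) < 1) sequentially"
    using lim by (rule order_tendstoD) simp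
  then obtain r where "(\<integral>\<^sup>+x. ennreal ((F r x - f x)\<^sup>2) \<partial>M) < 1"
    by (meson eventually_sequentially order_refl)
  then have "L2 M (\<lambda>x. F r x - f x)"
    by (auto simp: L2_iff_nn_integral intro: less_trans)
  from L2_diff[OF L[of r] this] have Lf: "L2 M f" by simp
  have "ennreal (\<integral>x. (F r x - f x)\<^sup>2 \<partial>M) = (\<integral>\<^sup>+x. ennreal ((F r x - f x)\<^sup>2) \<partial>M)" for r
    using L2_diff[OF L[of r] Lf] by (simp add: nn_integral_eq_integral L2_def)
  with lim have "(\<lambda>r. ennreal (\<integral>x. (F r x - f x)\<^sup>2 \<partial>M)) \<longlonglongrightarrow> ennreal 0" by simp
  then have "(\<lambda>r. \<integral>x. (F r x - f x)\<^sup>2 \<partial>M) \<longlonglongrightarrow> 0"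
    by (subst (asm) tendsto_ennreal_iff) auto
  with L Lf show ?thesis by (simp add: L2_tendsto_def)
qed

lemma L2_tendsto_subseq_AE:
  assumes "L2_tendsto M F f"
  shows "\<exists>\<phi>. strict_mono \<phi> \<and> (AE x in M. (\<lambda>r. F (\<phi> r) x) \<longlonglongrightarrow> f x)"
proof -
  have L: "L2 M (\<lambda>x. F r x - f x)" for r
    using assms by (auto simp: L2_tendsto_def intro: L2_diff)
  have "(\<lambda>r. \<integral>x. norm ((F r x - f x)\<^sup>2) \<partial>M) \<longlonglongrightarrow> 0"
    using assms by (simp add: L2_tendsto_def)
  from tendsto_L1_AE_subseq[OF L2_integrable_square[OF L] this]
  obtain \<phi> where "strict_mono \<phi>" "AE x in M. (\<lambda>r. (F (\<phi> r) x - f x)\<^sup>2) \<longlonglongrightarrow> 0" by blast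
  moreover have "(\<lambda>r. F (\<phi> r) x) \<longlonglongrightarrow> f x" if "(\<lambda>r. (F (\<phi> r) x - f x)\<^sup>2) \<longlonglongrightarrow> 0" for x
    using tendsto_real_sqrt[OF that] by (simp add: tendsto_rabs_zero_iff LIM_zero_iff)
  ultimately show ?thesis by (metis (mono_tags, lifting) AE_mp AE_I2)
qed

lemma (in prob_space) abs_integral_le_L2:
  assumes "L2 M f"
  shows "(\<integral>x. \<bar>f x\<bar> \<partial>M) \<le> sqrt (\<integral>x. (f x)\<^sup>2 \<partial>M)" "integrable M f"
proof -
  have L: "L2 M (\<lambda>x. \<bar>f x\<bar>)" "L2 M (\<lambda>x. 1)" using assms by (auto simp: L2_def)
  show "(\<integral>x. \<bar>f x\<bar> \<partial>M) \<le> sqrt (\<integral>x. (f x)\<^sup>2 \<partial>M)"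
    using abs_integral_mult_L2_le[OF L] by (simp add: prob_space)
  show "integrable M f" using L2_integrable_mult[OF assms L(2)] by simp
qed

subsection \<open>Moments of Gaussian quadratic forms\<close>

text \<open>The transpose of \<open>A\<close> times \<open>B\<close>. It is the discrete counterpart
  of the contraction of two kernels over their first variables.\<close>

definition gram :: "nat \<Rightarrow> (nat \<Rightarrow> nat \<Rightarrow> real) \<Rightarrow> (nat \<Rightarrow> nat \<Rightarrow> real) \<Rightarrow> nat \<Rightarrow> nat \<Rightarrow> real" where
  "gram m A B p q = (\<Sum>k<m. A k p * B k q)"

definition frob :: "nat \<Rightarrow> (nat \<Rightarrow> nat \<Rightarrow> real) \<Rightarrow> (nat \<Rightarrow> nat \<Rightarrow> real) \<Rightarrow> real" where
  "frob m A B = (\<Sum>k<m. \<Sum>l<m. A k l * B k l)"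

definition symmetric_mat :: "nat \<Rightarrow> (nat \<Rightarrow> nat \<Rightarrow> real) \<Rightarrow> bool" where
  "symmetric_mat m A \<longleftrightarrow> (\<forall>k<m. \<forall>l<m. A k l = A l k)"

lemma symmetric_matD: "symmetric_mat m A \<Longrightarrow> k < m \<Longrightarrow> l < m \<Longrightarrow> A k l = A l k"
  by (auto simp: symmetric_mat_def)

lemma trace_gram: "(\<Sum>k<m. gram m A B k k) = frob m A B"
  unfolding gram_def frob_def by (rule sum.swap)

text \<open>Cyclicity of the trace: once symmetry of \<open>B\<close> and \<open>C\<close> removes
  their transposes, both sides are the trace of the product B A C.\<close>

lemma frob_gram:
  assumes "symmetric_mat m B" "symmetric_mat m C"
  shows "frob m (gram m A B) C = frob m A (gram m B C)"
proof -
  have "frob m (gram m A B) C = (\<Sum>p<m. \<Sum>q<m. \<Sum>k<m. A k p * B k q * C p q)"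
    by (simp add: frob_def gram_def sum_distrib_right)
  also have "\<dots> = (\<Sum>p<m. \<Sum>k<m. \<Sum>q<m. A k p * B k q * C p q)"
    by (rule sum.cong[OF refl], rule sum.swap)
  also have "\<dots> = (\<Sum>k<m. \<Sum>p<m. \<Sum>q<m. A k p * B k q * C p q)"
    by (rule sum.swap)
  also have "\<dots> = (\<Sum>k<m. \<Sum>p<m. \<Sum>q<m. A k p * (B q k * C q p))"
    using assms by (intro sum.cong refl) (simp add: symmetric_matD[of m B] symmetric_matD[of m C] mult.assoc)
  also have "\<dots> = frob m A (gram m B C)"
    by (simp add: frob_def gram_def sum_distrib_left)
  finally show ?thesis .
qed

text \<open>Cauchy-Schwarz for each pair of columns; for symmetric \<open>A\<close> it bounds the
  trace of the fourth power by the squared trace of the square. This is the only inequality behind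
  the fourth moment estimate.\<close>

lemma frob_gram_le: "frob m (gram m A A) (gram m A A) \<le> (frob m A A)\<^sup>2"
proof -
  have "frob m (gram m A A) (gram m A A) = (\<Sum>p<m. \<Sum>q<m. (\<Sum>k<m. A k p * A k q)\<^sup>2)"
    by (simp add: frob_def gram_def power2_eq_square)
  also have "\<dots> \<le> (\<Sum>p<m. \<Sum>q<m. (\<Sum>k<m. (A k p)\<^sup>2) * (\<Sum>k<m. (A k q)\<^sup>2))"
    by (intro sum_mono Cauchy_Schwarz_ineq_sum)
  also have "\<dots> = (\<Sum>p<m. \<Sum>k<m. (A k p)\<^sup>2) * (\<Sum>p<m. \<Sum>k<m. (A k p)\<^sup>2)"
    by (rule sum_product[symmetric])
  also have "(\<Sum>p<m. \<Sum>k<m. (A k p)\<^sup>2) = frob m A A"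
    unfolding frob_def power2_eq_square by (rule sum.swap)
  finally show ?thesis by (simp add: power2_eq_square)
qed

section \<open>Integration by parts for independent standard Gaussian variables\<close>

locale gaussian_vector = prob_space M for M :: "'a measure" +
  fixes m :: nat and \<xi> :: "nat \<Rightarrow> 'a \<Rightarrow> real"
  assumes indep: "indep_vars (\<lambda>_. borel) \<xi> {..<m}"
    and std_normal: "\<And>k. k < m \<Longrightarrow> distributed M lborel (\<xi> k) std_normal_density"
begin

lemma rv[measurable]: "k < m \<Longrightarrow> \<xi> k \<in> borel_measurable M"
  using std_normal by (auto simp: distributed_def)

lemma integrable_power: "k < m \<Longrightarrow> integrable M (\<lambda>\<omega>. \<xi> k \<omega> ^ n)"
  using distributed_integrable[OF std_normal, of k "\<lambda>x. x ^ n"] integrable_std_normal_moment[of n]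
  by simp

lemma expectation_power_even: "k < m \<Longrightarrow> (\<integral>\<omega>. \<xi> k \<omega> ^ (2 * n) \<partial>M) = fact (2 * n) / (2 ^ n * fact n)"
  using distributed_integral[OF std_normal, of k "\<lambda>x. x ^ (2 * n)"] integral_std_normal_moment_even[of n]
  by simp

lemma expectation_power_odd: "k < m \<Longrightarrow> (\<integral>\<omega>. \<xi> k \<omega> ^ (2 * n + 1) \<partial>M) = 0"
  using distributed_integral[OF std_normal, of k "\<lambda>x. x ^ (2 * n + 1)"] integral_std_normal_moment_odd[of n]
  by simp

text \<open>Gaussian integration by parts for a one-dimensional monomial, read off the explicit
  moments by parity. For \<open>n = 0\<close> the truncated exponent \<open>n - 1\<close> is
  harmless because of the factor \<open>real n\<close>.\<close>

lemma expectation_power_Suc: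
  assumes "k < m"
  shows "(\<integral>\<omega>. \<xi> k \<omega> ^ Suc n \<partial>M) = real n * (\<integral>\<omega>. \<xi> k \<omega> ^ (n - 1) \<partial>M)"
proof (cases "even n")
  case True
  then obtain j where j: "n = 2 * j" by (elim evenE)
  have "(\<integral>\<omega>. \<xi> k \<omega> ^ (n - 1) \<partial>M) = 0" if "n \<noteq> 0"
  proof -
    have "n - 1 = 2 * (j - 1) + 1" using that j by simp
    then show ?thesis using expectation_power_odd[OF assms, of "j - 1"] by simp
  qed
  then show ?thesis using expectation_power_odd[OF assms, of j] j by (cases "n = 0") auto
next
  case False
  then obtain j where j: "n = 2 * j + 1" by (elim oddE)
  have "Suc n = 2 * Suc j" using j by simp
  then have "(\<integral>\<omega>. \<xi> k \<omega> ^ Suc n \<partial>M) = fact (2 * Suc j) / (2 ^ Suc j * fact (Suc j))"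
    using expectation_power_even[OF assms, of "Suc j"] by simp
  also have "\<dots> = real n * (fact (2 * j) / (2 ^ j * fact j))"
  proof -
    have "fact (2 * Suc j) = (2 * real j + 2) * ((2 * real j + 1) * fact (2 * j))"
      by (simp add: algebra_simps)
    moreover have "2 ^ Suc j * fact (Suc j) = (2 * real j + 2) * (2 ^ j * fact j)"
      by (simp add: algebra_simps)
    moreover have "2 * real j + 2 \<noteq> 0" by linarith
    ultimately show ?thesis
      by (simp only: mult_divide_mult_cancel_left) (simp add: j)
  qed
  also have "fact (2 * j) / (2 ^ j * fact j) = (\<integral>\<omega>. \<xi> k \<omega> ^ (n - 1) \<partial>M)"
    using expectation_power_even[OF assms, of j] j by simp
  finally show ?thesis .
qed

definition monom_rv :: "(nat \<Rightarrow> nat) \<Rightarrow> 'a \<Rightarrow> real" where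
  "monom_rv e \<omega> = (\<Prod>k<m. \<xi> k \<omega> ^ e k)"

text \<open>The partial derivative in coordinate \<open>k\<close>. If \<open>e k = 0\<close>,
  truncated subtraction leaves the monomial unchanged and the coefficient 0 gives the right
  value.\<close>

definition monom_deriv :: "nat \<Rightarrow> (nat \<Rightarrow> nat) \<Rightarrow> 'a \<Rightarrow> real" where
  "monom_deriv k e \<omega> = real (e k) * monom_rv (e(k := e k - 1)) \<omega>"

lemma indep_powers: "indep_vars (\<lambda>_. borel) (\<lambda>k \<omega>. \<xi> k \<omega> ^ e k) {..<m}"
  using indep_vars_compose2[OF indep, of "\<lambda>k x. x ^ e k" "\<lambda>_. borel"] by simp

lemma integrable_monom: "integrable M (monom_rv e)"
  unfolding monom_rv_def by (intro indep_vars_integrable indep_powers integrable_power) auto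

lemma expectation_monom: "(\<integral>\<omega>. monom_rv e \<omega> \<partial>M) = (\<Prod>k<m. \<integral>\<omega>. \<xi> k \<omega> ^ e k \<partial>M)"
  unfolding monom_rv_def by (intro indep_vars_lebesgue_integral indep_powers integrable_power) auto

lemma monom_Suc:
  assumes "k < m"
  shows "monom_rv (e(k := Suc (e k))) \<omega> = \<xi> k \<omega> * monom_rv e \<omega>"
proof -
  have "monom_rv (e(k := Suc (e k))) \<omega> = \<xi> k \<omega> ^ Suc (e k) * (\<Prod>l\<in>{..<m} - {k}. \<xi> l \<omega> ^ e l)"
    unfolding monom_rv_def using assms by (subst prod.remove[of _ k]) auto
  moreover have "monom_rv e \<omega> = \<xi> k \<omega> ^ e k * (\<Prod>l\<in>{..<m} - {k}. \<xi> l \<omega> ^ e l)"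
    unfolding monom_rv_def using assms by (subst prod.remove[of _ k]) auto
  ultimately show ?thesis by simp
qed

text \<open>The Leibniz rule for multiplying a monomial by the coordinate \<open>j\<close>.\<close>

lemma monom_deriv_Suc:
  assumes "j < m"
  shows "monom_deriv k (e(j := Suc (e j))) \<omega> =
    (if j = k then monom_rv e \<omega> else 0) + \<xi> j \<omega> * monom_deriv k e \<omega>"
proof (cases "j = k")
  case True
  show ?thesis
  proof (cases "e k")
    case 0
    then show ?thesis using True by (simp add: monom_deriv_def fun_upd_idem)
  next
    case (Suc n)
    have "monom_rv e \<omega> = \<xi> k \<omega> * monom_rv (e(k := n)) \<omega>"
      using monom_Suc[of k "e(k := n)" \<omega>] assms True Suc by (simp add: fun_upd_idem)
    then show ?thesis using True Suc by (simp add: monom_deriv_def fun_upd_idem algebra_simps)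
  qed
next
  case False
  then show ?thesis using monom_Suc[OF assms, of "e(k := e k - 1)" \<omega>]
    by (simp add: monom_deriv_def fun_upd_twist)
qed

lemma monom_by_parts:
  assumes "k < m"
  shows "(\<integral>\<omega>. \<xi> k \<omega> * monom_rv e \<omega> \<partial>M) = (\<integral>\<omega>. monom_deriv k e \<omega> \<partial>M)"
proof -
  have "(\<integral>\<omega>. \<xi> k \<omega> * monom_rv e \<omega> \<partial>M) = (\<Prod>l<m. \<integral>\<omega>. \<xi> l \<omega> ^ (e(k := Suc (e k))) l \<partial>M)"
    using expectation_monom[of "e(k := Suc (e k))"] monom_Suc[OF assms] by simp
  also have "\<dots> = (\<integral>\<omega>. \<xi> k \<omega> ^ Suc (e k) \<partial>M) * (\<Prod>l\<in>{..<m} - {k}. \<integral>\<omega>. \<xi> l \<omega> ^ e l \<partial>M)"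
    using assms by (subst prod.remove[of _ k]) auto
  also have "\<dots> = real (e k) * ((\<integral>\<omega>. \<xi> k \<omega> ^ (e k - 1) \<partial>M) * (\<Prod>l\<in>{..<m} - {k}. \<integral>\<omega>. \<xi> l \<omega> ^ e l \<partial>M))"
    using expectation_power_Suc[OF assms] by simp
  also have "(\<integral>\<omega>. \<xi> k \<omega> ^ (e k - 1) \<partial>M) * (\<Prod>l\<in>{..<m} - {k}. \<integral>\<omega>. \<xi> l \<omega> ^ e l \<partial>M)
      = (\<Prod>l<m. \<integral>\<omega>. \<xi> l \<omega> ^ (e(k := e k - 1)) l \<partial>M)"
    using assms by (subst (2) prod.remove[of _ k]) auto
  also have "\<dots> = (\<integral>\<omega>. monom_rv (e(k := e k - 1)) \<omega> \<partial>M)"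
    by (simp add: expectation_monom)
  finally show ?thesis by (simp add: monom_deriv_def)
qed

text \<open>\<open>D\<close> is the gradient of the polynomial \<open>\<phi>\<close>. Testing against all monomials makes the property
  stable under multiplication of \<open>\<phi>\<close> by a coordinate.\<close>

definition by_parts :: "('a \<Rightarrow> real) \<Rightarrow> (nat \<Rightarrow> 'a \<Rightarrow> real) \<Rightarrow> bool" where
  "by_parts \<phi> D \<longleftrightarrow> (\<forall>e. integrable M (\<lambda>\<omega>. \<phi> \<omega> * monom_rv e \<omega>) \<and>
     (\<forall>k<m. integrable M (\<lambda>\<omega>. D k \<omega> * monom_rv e \<omega>) \<and>
       (\<integral>\<omega>. \<xi> k \<omega> * (\<phi> \<omega> * monom_rv e \<omega>) \<partial>M) =
       (\<integral>\<omega>. D k \<omega> * monom_rv e \<omega> \<partial>M) + (\<integral>\<omega>. \<phi> \<omega> * monom_deriv k e \<omega> \<partial>M)))"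

text \<open>The test monomial with exponent 0 is the constant 1, whose derivative vanishes.\<close>

lemma by_partsD:
  assumes "by_parts \<phi> D"
  shows "integrable M \<phi>"
    and "k < m \<Longrightarrow> integrable M (D k)"
    and "k < m \<Longrightarrow> (\<integral>\<omega>. \<xi> k \<omega> * \<phi> \<omega> \<partial>M) = (\<integral>\<omega>. D k \<omega> \<partial>M)"
  using assms[unfolded by_parts_def, rule_format, of "\<lambda>_. 0"]
  by (auto simp: monom_rv_def monom_deriv_def)

lemma by_parts_integrable_deriv:
  assumes "by_parts \<phi> D"
  shows "integrable M (\<lambda>\<omega>. \<phi> \<omega> * monom_deriv k e \<omega>)"
  using assms[unfolded by_parts_def, rule_format, of "e(k := e k - 1)", THEN conjunct1, THEN integrable_mult_right, of "real (e k)"]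
  by (simp add: monom_deriv_def mult_ac)

lemma by_parts_const: "by_parts (\<lambda>_. c) (\<lambda>_ _. 0)"
  unfolding by_parts_def
proof (intro allI conjI impI)
  fix e show "integrable M (\<lambda>\<omega>. c * monom_rv e \<omega>)" by (intro integrable_mult_right integrable_monom)
  fix k assume k: "k < m"
  show "(\<integral>\<omega>. \<xi> k \<omega> * (c * monom_rv e \<omega>) \<partial>M) = (\<integral>\<omega>. 0 * monom_rv e \<omega> \<partial>M) + (\<integral>\<omega>. c * monom_deriv k e \<omega> \<partial>M)"
    using monom_by_parts[OF k, of e] by (simp add: mult.left_commute)
qed simp

lemma by_parts_cmult:
  assumes "by_parts \<phi> D"
  shows "by_parts (\<lambda>\<omega>. c * \<phi> \<omega>) (\<lambda>k \<omega>. c * D k \<omega>)"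
  unfolding by_parts_def
proof (intro allI conjI impI)
  note A = assms[unfolded by_parts_def, rule_format]
  fix e
  show "integrable M (\<lambda>\<omega>. c * \<phi> \<omega> * monom_rv e \<omega>)" using A[of e] by (simp add: mult.assoc)
  fix k assume k: "k < m"
  show "integrable M (\<lambda>\<omega>. c * D k \<omega> * monom_rv e \<omega>)" using A[of e] k by (simp add: mult.assoc)
  have "(\<integral>\<omega>. c * (\<xi> k \<omega> * (\<phi> \<omega> * monom_rv e \<omega>)) \<partial>M) =
     (\<integral>\<omega>. c * (D k \<omega> * monom_rv e \<omega>) \<partial>M) + (\<integral>\<omega>. c * (\<phi> \<omega> * monom_deriv k e \<omega>) \<partial>M)"
    using A[of e, THEN conjunct2, rule_format, OF k] by (simp add: algebra_simps)
  then show "(\<integral>\<omega>. \<xi> k \<omega> * (c * \<phi> \<omega> * monom_rv e \<omega>) \<partial>M) =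
     (\<integral>\<omega>. c * D k \<omega> * monom_rv e \<omega> \<partial>M) + (\<integral>\<omega>. c * \<phi> \<omega> * monom_deriv k e \<omega> \<partial>M)"
    by (simp add: mult_ac)
qed

text \<open>A factor \<open>\<xi> j\<close> in front of \<open>\<phi>\<close> can be absorbed into
  the test monomial by raising its exponent. The Leibniz rule for \<open>monom_deriv\<close> then
  yields the extra summand, which is the derivative of \<open>\<xi> j\<close> itself.\<close>

lemma by_parts_xi:
  assumes "by_parts \<phi> D" and j: "j < m"
  shows "by_parts (\<lambda>\<omega>. \<xi> j \<omega> * \<phi> \<omega>) (\<lambda>k \<omega>. (if j = k then \<phi> \<omega> else 0) + \<xi> j \<omega> * D k \<omega>)"
  unfolding by_parts_def
proof (intro allI conjI impI)
  note A = assms(1)[unfolded by_parts_def, rule_format]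
  fix e
  have i1: "integrable M (\<lambda>\<omega>. \<phi> \<omega> * (\<xi> j \<omega> * monom_rv e \<omega>))"
    using A[of "e(j := Suc (e j))"] monom_Suc[OF j] by simp
  show "integrable M (\<lambda>\<omega>. \<xi> j \<omega> * \<phi> \<omega> * monom_rv e \<omega>)" using i1 by (simp add: mult_ac)
  fix k assume k: "k < m"
  have i2: "integrable M (\<lambda>\<omega>. D k \<omega> * (\<xi> j \<omega> * monom_rv e \<omega>))"
    using A[of "e(j := Suc (e j))", THEN conjunct2, rule_format, OF k] monom_Suc[OF j] by simp
  have i3: "integrable M (\<lambda>\<omega>. (if j = k then \<phi> \<omega> else 0) * monom_rv e \<omega>)"
    using A[of e] by (cases "j = k") auto
  have i4: "integrable M (\<lambda>\<omega>. \<phi> \<omega> * (\<xi> j \<omega> * monom_deriv k e \<omega>))"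
    using A[of "(e(k := e k - 1))(j := Suc ((e(k := e k - 1)) j))", THEN conjunct1, THEN integrable_mult_right, of "real (e k)"]
      monom_Suc[OF j, of "e(k := e k - 1)"]
    unfolding monom_deriv_def by (simp add: mult_ac)
  show "integrable M (\<lambda>\<omega>. ((if j = k then \<phi> \<omega> else 0) + \<xi> j \<omega> * D k \<omega>) * monom_rv e \<omega>)"
    using Bochner_Integration.integrable_add[OF i3 i2] by (simp add: algebra_simps)
  have "(\<integral>\<omega>. \<xi> k \<omega> * (\<phi> \<omega> * monom_rv (e(j := Suc (e j))) \<omega>) \<partial>M) =
     (\<integral>\<omega>. D k \<omega> * monom_rv (e(j := Suc (e j))) \<omega> \<partial>M) + (\<integral>\<omega>. \<phi> \<omega> * monom_deriv k (e(j := Suc (e j))) \<omega> \<partial>M)"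
    using A k by blast
  also have "(\<integral>\<omega>. \<phi> \<omega> * monom_deriv k (e(j := Suc (e j))) \<omega> \<partial>M) =
     (\<integral>\<omega>. (if j = k then \<phi> \<omega> else 0) * monom_rv e \<omega> + \<phi> \<omega> * (\<xi> j \<omega> * monom_deriv k e \<omega>) \<partial>M)"
    by (intro Bochner_Integration.integral_cong) (auto simp: monom_deriv_Suc[OF j] algebra_simps)
  also have "\<dots> = (\<integral>\<omega>. (if j = k then \<phi> \<omega> else 0) * monom_rv e \<omega> \<partial>M) + (\<integral>\<omega>. \<phi> \<omega> * (\<xi> j \<omega> * monom_deriv k e \<omega>) \<partial>M)"
    using i3 i4 by simp
  also have "(\<integral>\<omega>. D k \<omega> * monom_rv (e(j := Suc (e j))) \<omega> \<partial>M) + \<dots> =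
      (\<integral>\<omega>. (if j = k then \<phi> \<omega> else 0) * monom_rv e \<omega> + D k \<omega> * (\<xi> j \<omega> * monom_rv e \<omega>) \<partial>M)
      + (\<integral>\<omega>. \<phi> \<omega> * (\<xi> j \<omega> * monom_deriv k e \<omega>) \<partial>M)"
    using i3 i2 by (simp add: monom_Suc[OF j])
  finally show "(\<integral>\<omega>. \<xi> k \<omega> * (\<xi> j \<omega> * \<phi> \<omega> * monom_rv e \<omega>) \<partial>M) =
     (\<integral>\<omega>. ((if j = k then \<phi> \<omega> else 0) + \<xi> j \<omega> * D k \<omega>) * monom_rv e \<omega> \<partial>M) + (\<integral>\<omega>. \<xi> j \<omega> * \<phi> \<omega> * monom_deriv k e \<omega> \<partial>M)"
    unfolding monom_Suc[OF j] by (simp add: algebra_simps)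
qed

lemma by_parts_add:
  assumes "by_parts \<phi> D" "by_parts \<psi> E"
  shows "by_parts (\<lambda>\<omega>. \<phi> \<omega> + \<psi> \<omega>) (\<lambda>k \<omega>. D k \<omega> + E k \<omega>)"
  unfolding by_parts_def
proof (intro allI conjI impI)
  note A = assms(1)[unfolded by_parts_def, rule_format] and B = assms(2)[unfolded by_parts_def, rule_format]
  fix e
  show "integrable M (\<lambda>\<omega>. (\<phi> \<omega> + \<psi> \<omega>) * monom_rv e \<omega>)"
    using A[of e] B[of e] by (simp add: distrib_right)
  fix k assume k: "k < m"
  show "integrable M (\<lambda>\<omega>. (D k \<omega> + E k \<omega>) * monom_rv e \<omega>)"
    using A[of e] B[of e] k by (simp add: distrib_right)
  have i: "integrable M (\<lambda>\<omega>. \<xi> k \<omega> * (\<theta> \<omega> * monom_rv e \<omega>))" if "\<And>e. integrable M (\<lambda>\<omega>. \<theta> \<omega> * monom_rv e \<omega>)" for \<theta>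
    using that[of "e(k := Suc (e k))"] by (simp add: monom_Suc[OF k] mult_ac)
  have "(\<integral>\<omega>. \<xi> k \<omega> * ((\<phi> \<omega> + \<psi> \<omega>) * monom_rv e \<omega>) \<partial>M)
     = (\<integral>\<omega>. \<xi> k \<omega> * (\<phi> \<omega> * monom_rv e \<omega>) + \<xi> k \<omega> * (\<psi> \<omega> * monom_rv e \<omega>) \<partial>M)"
    by (simp add: algebra_simps)
  also have "\<dots> = (\<integral>\<omega>. \<xi> k \<omega> * (\<phi> \<omega> * monom_rv e \<omega>) \<partial>M) + (\<integral>\<omega>. \<xi> k \<omega> * (\<psi> \<omega> * monom_rv e \<omega>) \<partial>M)"
    using A B by (intro Bochner_Integration.integral_add i) auto
  also have "\<dots> = ((\<integral>\<omega>. D k \<omega> * monom_rv e \<omega> \<partial>M) + (\<integral>\<omega>. E k \<omega> * monom_rv e \<omega> \<partial>M))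
      + ((\<integral>\<omega>. \<phi> \<omega> * monom_deriv k e \<omega> \<partial>M) + (\<integral>\<omega>. \<psi> \<omega> * monom_deriv k e \<omega> \<partial>M))"
    using A[of e] B[of e] k by simp
  also have "\<dots> = (\<integral>\<omega>. (D k \<omega> + E k \<omega>) * monom_rv e \<omega> \<partial>M) + (\<integral>\<omega>. (\<phi> \<omega> + \<psi> \<omega>) * monom_deriv k e \<omega> \<partial>M)"
    unfolding distrib_right
    using A[of e] B[of e] k by_parts_integrable_deriv[OF assms(1), of k e]
      by_parts_integrable_deriv[OF assms(2), of k e] by simp
  finally show "(\<integral>\<omega>. \<xi> k \<omega> * ((\<phi> \<omega> + \<psi> \<omega>) * monom_rv e \<omega>) \<partial>M) =
      (\<integral>\<omega>. (D k \<omega> + E k \<omega>) * monom_rv e \<omega> \<partial>M) + (\<integral>\<omega>. (\<phi> \<omega> + \<psi> \<omega>) * monom_deriv k e \<omega> \<partial>M)" .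
qed

lemma by_parts_sum:
  assumes "finite I" "\<And>i. i \<in> I \<Longrightarrow> by_parts (\<phi> i) (D i)"
  shows "by_parts (\<lambda>\<omega>. \<Sum>i\<in>I. \<phi> i \<omega>) (\<lambda>k \<omega>. \<Sum>i\<in>I. D i k \<omega>)"
  using assms
proof (induction I rule: finite_induct)
  case empty
  then show ?case using by_parts_const[of 0] by simp
next
  case (insert i I)
  then show ?case using by_parts_add[of "\<phi> i" "D i" "\<lambda>\<omega>. \<Sum>i\<in>I. \<phi> i \<omega>" "\<lambda>k \<omega>. \<Sum>i\<in>I. D i k \<omega>"] by simp
qed

lemma by_parts_cong:
  assumes "by_parts \<phi> D" "\<And>k \<omega>. k < m \<Longrightarrow> D k \<omega> = E k \<omega>"
  shows "by_parts \<phi> E"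
  using assms by (simp add: by_parts_def)

section \<open>Products of quadratic forms and their expectations\<close>

definition lin :: "(nat \<Rightarrow> real) \<Rightarrow> 'a \<Rightarrow> real" where
  "lin a \<omega> = (\<Sum>k<m. a k * \<xi> k \<omega>)"

definition quad :: "(nat \<Rightarrow> nat \<Rightarrow> real) \<Rightarrow> 'a \<Rightarrow> real" where
  "quad A \<omega> = (\<Sum>k<m. \<Sum>l<m. A k l * \<xi> k \<omega> * \<xi> l \<omega>)"

lemma quad_eq_lin: "quad A \<omega> = (\<Sum>k<m. \<xi> k \<omega> * lin (A k) \<omega>)"
  by (simp add: quad_def lin_def sum_distrib_left mult_ac)

text \<open>Up to constants \<open>lin (C k)\<close> and \<open>lin (A k)\<close> are the gradients
  of two quadratic forms with symmetric matrices. Their scalar product is again a quadratic form,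
  which is how \<open>gram\<close> enters the moments.\<close>

lemma sum_lin_mult_lin: "(\<Sum>k<m. lin (C k) \<omega> * lin (A k) \<omega>) = quad (gram m C A) \<omega>"
proof -
  have "(\<Sum>k<m. lin (C k) \<omega> * lin (A k) \<omega>) = (\<Sum>k<m. \<Sum>p<m. \<Sum>q<m. C k p * A k q * \<xi> p \<omega> * \<xi> q \<omega>)"
    unfolding lin_def sum_product by (intro sum.cong refl) (simp add: mult_ac)
  also have "\<dots> = (\<Sum>p<m. \<Sum>k<m. \<Sum>q<m. C k p * A k q * \<xi> p \<omega> * \<xi> q \<omega>)"
    by (rule sum.swap)
  also have "\<dots> = (\<Sum>p<m. \<Sum>q<m. \<Sum>k<m. C k p * A k q * \<xi> p \<omega> * \<xi> q \<omega>)"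
    by (rule sum.cong[OF refl], rule sum.swap)
  finally show ?thesis by (simp add: quad_def gram_def sum_distrib_right)
qed

lemma by_parts_lin:
  assumes "by_parts \<phi> D"
  shows "by_parts (\<lambda>\<omega>. lin a \<omega> * \<phi> \<omega>) (\<lambda>k \<omega>. a k * \<phi> \<omega> + lin a \<omega> * D k \<omega>)"
proof -
  have "by_parts (\<lambda>\<omega>. \<Sum>j<m. a j * (\<xi> j \<omega> * \<phi> \<omega>))
     (\<lambda>k \<omega>. \<Sum>j<m. a j * ((if j = k then \<phi> \<omega> else 0) + \<xi> j \<omega> * D k \<omega>))"
    by (intro by_parts_sum by_parts_cmult by_parts_xi assms) auto
  then have "by_parts (\<lambda>\<omega>. \<Sum>j<m. a j * (\<xi> j \<omega> * \<phi> \<omega>)) (\<lambda>k \<omega>. a k * \<phi> \<omega> + lin a \<omega> * D k \<omega>)"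
    by (rule by_parts_cong)
       (simp add: lin_def distrib_left sum.distrib sum_distrib_right mult.assoc if_distrib[of "\<lambda>x. _ * x"] sum.delta cong: if_cong)
  then show ?thesis by (simp add: lin_def sum_distrib_right mult.assoc)
qed

text \<open>Differentiating a quadratic form produces a row sum and a column sum; symmetry of
  \<open>A\<close> identifies them and gives the factor 2.\<close>

lemma by_parts_quad:
  assumes A: "symmetric_mat m A" and \<phi>: "by_parts \<phi> D"
  shows "by_parts (\<lambda>\<omega>. quad A \<omega> * \<phi> \<omega>) (\<lambda>k \<omega>. 2 * (lin (A k) \<omega> * \<phi> \<omega>) + quad A \<omega> * D k \<omega>)"
proof -
  have "by_parts (\<lambda>\<omega>. \<Sum>j<m. \<xi> j \<omega> * (lin (A j) \<omega> * \<phi> \<omega>))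
     (\<lambda>k \<omega>. \<Sum>j<m. (if j = k then lin (A j) \<omega> * \<phi> \<omega> else 0) + \<xi> j \<omega> * (A j k * \<phi> \<omega> + lin (A j) \<omega> * D k \<omega>))"
    by (intro by_parts_sum by_parts_xi by_parts_lin \<phi>) auto
  then have "by_parts (\<lambda>\<omega>. \<Sum>j<m. \<xi> j \<omega> * (lin (A j) \<omega> * \<phi> \<omega>))
     (\<lambda>k \<omega>. 2 * (lin (A k) \<omega> * \<phi> \<omega>) + quad A \<omega> * D k \<omega>)"
  proof (rule by_parts_cong)
    fix k \<omega> assume k: "k < m"
    have "(\<Sum>j<m. \<xi> j \<omega> * A j k) = lin (A k) \<omega>"
      unfolding lin_def using k by (intro sum.cong) (auto simp: symmetric_matD[OF A, of k])
    then have "(\<Sum>j<m. \<xi> j \<omega> * (A j k * \<phi> \<omega>)) = lin (A k) \<omega> * \<phi> \<omega>"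
      by (simp add: sum_distrib_right[symmetric] mult.assoc[symmetric])
    then show "(\<Sum>j<m. (if j = k then lin (A j) \<omega> * \<phi> \<omega> else 0) + \<xi> j \<omega> * (A j k * \<phi> \<omega> + lin (A j) \<omega> * D k \<omega>))
       = 2 * (lin (A k) \<omega> * \<phi> \<omega>) + quad A \<omega> * D k \<omega>"
      using k by (simp add: quad_eq_lin distrib_left sum.distrib sum_distrib_right mult.assoc sum.delta cong: if_cong)
  qed
  then show ?thesis by (simp add: quad_eq_lin sum_distrib_right mult.assoc)
qed

text \<open>One coordinate of \<open>quad C\<close> is split off and integrated by parts. It hits
  either the remaining linear factor, which produces the trace of \<open>C\<close>, or
  \<open>\<phi>\<close>. The matrix \<open>C\<close> is arbitrary, so the rule applies again to
  matrices such as \<open>gram m C A\<close>, which are not symmetric in general.\<close>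

lemma quad_by_parts:
  assumes \<phi>: "by_parts \<phi> D"
  shows "integrable M (\<lambda>\<omega>. quad C \<omega> * \<phi> \<omega>)"
    and "(\<integral>\<omega>. quad C \<omega> * \<phi> \<omega> \<partial>M) = (\<Sum>k<m. C k k) * (\<integral>\<omega>. \<phi> \<omega> \<partial>M)
      + (\<integral>\<omega>. (\<Sum>k<m. lin (C k) \<omega> * D k \<omega>) \<partial>M)"
proof -
  note L = by_parts_lin[OF \<phi>]
  have eq: "quad C \<omega> * \<phi> \<omega> = (\<Sum>k<m. \<xi> k \<omega> * (lin (C k) \<omega> * \<phi> \<omega>))" for \<omega>
    by (simp add: quad_eq_lin sum_distrib_right mult.assoc)
  have i: "integrable M (\<lambda>\<omega>. \<xi> k \<omega> * (lin (C k) \<omega> * \<phi> \<omega>))" if "k < m" for k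
    by (rule by_partsD(1)[OF by_parts_xi[OF L that]])
  show "integrable M (\<lambda>\<omega>. quad C \<omega> * \<phi> \<omega>)"
    unfolding eq using i by (intro Bochner_Integration.integrable_sum) auto
  have i2: "integrable M (\<lambda>\<omega>. lin (C k) \<omega> * D k \<omega>)" if "k < m" for k
    using Bochner_Integration.integrable_diff[OF by_partsD(2)[OF L that, of "C k"]
      integrable_mult_right[OF by_partsD(1)[OF \<phi>], of "C k k"]] by simp
  have "(\<integral>\<omega>. quad C \<omega> * \<phi> \<omega> \<partial>M) = (\<Sum>k<m. \<integral>\<omega>. \<xi> k \<omega> * (lin (C k) \<omega> * \<phi> \<omega>) \<partial>M)"
    unfolding eq using i by (intro Bochner_Integration.integral_sum) auto
  also have "\<dots> = (\<Sum>k<m. \<integral>\<omega>. C k k * \<phi> \<omega> + lin (C k) \<omega> * D k \<omega> \<partial>M)"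
    by (intro sum.cong by_partsD(3)[OF L]) auto
  also have "\<dots> = (\<Sum>k<m. C k k * (\<integral>\<omega>. \<phi> \<omega> \<partial>M) + (\<integral>\<omega>. lin (C k) \<omega> * D k \<omega> \<partial>M))"
    using i2 by_partsD(1)[OF \<phi>] by (intro sum.cong) auto
  finally show "(\<integral>\<omega>. quad C \<omega> * \<phi> \<omega> \<partial>M) = (\<Sum>k<m. C k k) * (\<integral>\<omega>. \<phi> \<omega> \<partial>M)
      + (\<integral>\<omega>. (\<Sum>k<m. lin (C k) \<omega> * D k \<omega>) \<partial>M)"
    using i2 by (simp add: sum.distrib sum_distrib_right Bochner_Integration.integral_sum)
qed

lemma by_parts_one: "by_parts (\<lambda>_. 1) (\<lambda>_ _. 0)"
  by (rule by_parts_const)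

lemma by_parts_quad1:
  assumes "symmetric_mat m A"
  shows "by_parts (quad A) (\<lambda>k \<omega>. 2 * lin (A k) \<omega>)"
  using by_parts_quad[OF assms by_parts_one] by simp

lemma quad_expectation: "integrable M (quad C)" "(\<integral>\<omega>. quad C \<omega> \<partial>M) = (\<Sum>k<m. C k k)"
  using quad_by_parts[OF by_parts_one, of C] by (simp_all add: prob_space)

lemma quad_expectation2:
  assumes A: "symmetric_mat m A"
  shows "integrable M (\<lambda>\<omega>. quad C \<omega> * quad A \<omega>)"
    "(\<integral>\<omega>. quad C \<omega> * quad A \<omega> \<partial>M) = (\<Sum>k<m. C k k) * (\<Sum>k<m. A k k) + 2 * frob m C A"
proof -
  note Q = quad_by_parts[OF by_parts_quad1[OF A], of C]
  show "integrable M (\<lambda>\<omega>. quad C \<omega> * quad A \<omega>)" by (rule Q(1))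
  have "(\<Sum>k<m. lin (C k) \<omega> * (2 * lin (A k) \<omega>)) = 2 * quad (gram m C A) \<omega>" for \<omega>
    by (simp add: sum_lin_mult_lin[symmetric] sum_distrib_left mult_ac)
  then show "(\<integral>\<omega>. quad C \<omega> * quad A \<omega> \<partial>M) = (\<Sum>k<m. C k k) * (\<Sum>k<m. A k k) + 2 * frob m C A"
    using Q(2) by (simp add: quad_expectation trace_gram)
qed

text \<open>Each factor other than \<open>quad C\<close> is contracted with \<open>C\<close> in
  turn. The right side has one quadratic form less, so moments of any degree come down to
  traces.\<close>

lemma quad_expectation3:
  assumes A: "symmetric_mat m A" and B: "symmetric_mat m B"
  shows "integrable M (\<lambda>\<omega>. quad C \<omega> * (quad A \<omega> * quad B \<omega>))"
    "(\<integral>\<omega>. quad C \<omega> * (quad A \<omega> * quad B \<omega>) \<partial>M) = (\<Sum>k<m. C k k) * (\<integral>\<omega>. quad A \<omega> * quad B \<omega> \<partial>M)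
      + 2 * (\<integral>\<omega>. quad (gram m C A) \<omega> * quad B \<omega> \<partial>M) + 2 * (\<integral>\<omega>. quad (gram m C B) \<omega> * quad A \<omega> \<partial>M)"
proof -
  note Q = quad_by_parts[OF by_parts_quad[OF A by_parts_quad1[OF B]], of C]
  show "integrable M (\<lambda>\<omega>. quad C \<omega> * (quad A \<omega> * quad B \<omega>))" by (rule Q(1))
  have "(\<Sum>k<m. lin (C k) \<omega> * (2 * (lin (A k) \<omega> * quad B \<omega>) + quad A \<omega> * (2 * lin (B k) \<omega>)))
    = 2 * (quad (gram m C A) \<omega> * quad B \<omega>) + 2 * (quad (gram m C B) \<omega> * quad A \<omega>)" for \<omega>
    unfolding sum_lin_mult_lin[symmetric] sum_distrib_left sum_distrib_right sum.distrib[symmetric]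
    by (intro sum.cong refl) (simp add: algebra_simps)
  then show "(\<integral>\<omega>. quad C \<omega> * (quad A \<omega> * quad B \<omega>) \<partial>M) = (\<Sum>k<m. C k k) * (\<integral>\<omega>. quad A \<omega> * quad B \<omega> \<partial>M)
      + 2 * (\<integral>\<omega>. quad (gram m C A) \<omega> * quad B \<omega> \<partial>M) + 2 * (\<integral>\<omega>. quad (gram m C B) \<omega> * quad A \<omega> \<partial>M)"
    using Q(2) by (simp only: quad_expectation2(1)[OF A] quad_expectation2(1)[OF B] integrable_mult_right
        Bochner_Integration.integral_add integral_mult_right_zero add.assoc)
qed

lemma quad_expectation4:
  assumes A: "symmetric_mat m A" and B: "symmetric_mat m B" and D: "symmetric_mat m D"
  shows "integrable M (\<lambda>\<omega>. quad C \<omega> * (quad A \<omega> * (quad B \<omega> * quad D \<omega>)))"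
    "(\<integral>\<omega>. quad C \<omega> * (quad A \<omega> * (quad B \<omega> * quad D \<omega>)) \<partial>M) =
      (\<Sum>k<m. C k k) * (\<integral>\<omega>. quad A \<omega> * (quad B \<omega> * quad D \<omega>) \<partial>M)
      + 2 * (\<integral>\<omega>. quad (gram m C A) \<omega> * (quad B \<omega> * quad D \<omega>) \<partial>M)
      + 2 * (\<integral>\<omega>. quad (gram m C B) \<omega> * (quad A \<omega> * quad D \<omega>) \<partial>M)
      + 2 * (\<integral>\<omega>. quad (gram m C D) \<omega> * (quad A \<omega> * quad B \<omega>) \<partial>M)"
proof -
  note Q = quad_by_parts[OF by_parts_quad[OF A by_parts_quad[OF B by_parts_quad1[OF D]]], of C]
  show "integrable M (\<lambda>\<omega>. quad C \<omega> * (quad A \<omega> * (quad B \<omega> * quad D \<omega>)))" by (rule Q(1))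
  have "(\<Sum>k<m. lin (C k) \<omega> * (2 * (lin (A k) \<omega> * (quad B \<omega> * quad D \<omega>)) +
        quad A \<omega> * (2 * (lin (B k) \<omega> * quad D \<omega>) + quad B \<omega> * (2 * lin (D k) \<omega>))))
    = 2 * (quad (gram m C A) \<omega> * (quad B \<omega> * quad D \<omega>)) + 2 * (quad (gram m C B) \<omega> * (quad A \<omega> * quad D \<omega>))
      + 2 * (quad (gram m C D) \<omega> * (quad A \<omega> * quad B \<omega>))" for \<omega>
    unfolding sum_lin_mult_lin[symmetric] sum_distrib_left sum_distrib_right sum.distrib[symmetric]
    by (intro sum.cong refl) (simp add: algebra_simps)
  then show "(\<integral>\<omega>. quad C \<omega> * (quad A \<omega> * (quad B \<omega> * quad D \<omega>)) \<partial>M) =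
      (\<Sum>k<m. C k k) * (\<integral>\<omega>. quad A \<omega> * (quad B \<omega> * quad D \<omega>) \<partial>M)
      + 2 * (\<integral>\<omega>. quad (gram m C A) \<omega> * (quad B \<omega> * quad D \<omega>) \<partial>M)
      + 2 * (\<integral>\<omega>. quad (gram m C B) \<omega> * (quad A \<omega> * quad D \<omega>) \<partial>M)
      + 2 * (\<integral>\<omega>. quad (gram m C D) \<omega> * (quad A \<omega> * quad B \<omega>) \<partial>M)"
    using Q(2) by (simp only: quad_expectation3(1)[OF A B] quad_expectation3(1)[OF A D] quad_expectation3(1)[OF B D]
        integrable_mult_right Bochner_Integration.integrable_add Bochner_Integration.integral_add
        integral_mult_right_zero add.assoc)
qed

end

text \<open>Vanishing diagonals make the traces 0, hence the forms centred and every term with a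
  trace of \<open>A\<close> or \<open>B\<close> disappear. Step kernels that are zero on diagonal
  blocks give exactly such matrices.\<close>

locale zero_diag_pair = gaussian_vector +
  fixes A B :: "nat \<Rightarrow> nat \<Rightarrow> real"
  assumes sym: "symmetric_mat m A" "symmetric_mat m B"
    and zero: "\<And>k. k < m \<Longrightarrow> A k k = 0" "\<And>k. k < m \<Longrightarrow> B k k = 0"
begin

lemma trace0: "(\<Sum>k<m. A k k) = 0" "(\<Sum>k<m. B k k) = 0"
  using zero by auto

lemma quad_moment2: "(\<integral>\<omega>. quad A \<omega> * quad B \<omega> \<partial>M) = 2 * frob m A B"
  using quad_expectation2[OF sym(2), of A] by (simp add: trace0)

lemma quad_moment3: "(\<integral>\<omega>. (quad A \<omega>)\<^sup>2 * quad B \<omega> \<partial>M) = 8 * frob m (gram m A A) B"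
proof -
  have "(\<integral>\<omega>. (quad A \<omega>)\<^sup>2 * quad B \<omega> \<partial>M) = (\<integral>\<omega>. quad B \<omega> * (quad A \<omega> * quad A \<omega>) \<partial>M)"
    by (simp add: power2_eq_square mult_ac)
  also have "\<dots> = 8 * frob m (gram m B A) A"
    using quad_expectation3[OF sym(1) sym(1), of B] quad_expectation2[OF sym(1)] by (simp add: trace0)
  also have "frob m (gram m B A) A = frob m B (gram m A A)"
    by (rule frob_gram[OF sym(1) sym(1)])
  finally show ?thesis by (simp add: frob_def mult.commute)
qed

text \<open>The first two terms are the pairings that split into two cycles. The terms with
  coefficient 16 are the connected ones: the trace of A A B B in two guises and the trace of A B A
  B. They are left as inner products of two \<open>gram\<close> matrices because that form passes to
  kernels.\<close>

lemma quad_moment4: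
  "integrable M (\<lambda>\<omega>. (quad A \<omega>)\<^sup>2 * (quad B \<omega>)\<^sup>2)"
  "(\<integral>\<omega>. (quad A \<omega>)\<^sup>2 * (quad B \<omega>)\<^sup>2 \<partial>M) = 4 * frob m A A * frob m B B + 8 * (frob m A B)\<^sup>2
     + 16 * frob m (gram m A A) (gram m B B) + 16 * frob m (gram m A B) (gram m A B)
     + 16 * frob m (gram m A B) (gram m B A)"
proof -
  have eq: "(quad A \<omega>)\<^sup>2 * (quad B \<omega>)\<^sup>2 = quad A \<omega> * (quad A \<omega> * (quad B \<omega> * quad B \<omega>))" for \<omega>
    by (simp add: power2_eq_square mult_ac)
  show "integrable M (\<lambda>\<omega>. (quad A \<omega>)\<^sup>2 * (quad B \<omega>)\<^sup>2)"
    unfolding eq by (rule quad_expectation4[OF sym(1) sym(2) sym(2)])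
  note L = frob_gram[OF sym(1) sym(2)] frob_gram[OF sym(2) sym(1)] frob_gram[OF sym(2) sym(2)]
  show "(\<integral>\<omega>. (quad A \<omega>)\<^sup>2 * (quad B \<omega>)\<^sup>2 \<partial>M) = 4 * frob m A A * frob m B B + 8 * (frob m A B)\<^sup>2
     + 16 * frob m (gram m A A) (gram m B B) + 16 * frob m (gram m A B) (gram m A B)
     + 16 * frob m (gram m A B) (gram m B A)"
  proof -
    have "(\<integral>\<omega>. quad (gram m A A) \<omega> * (quad B \<omega> * quad B \<omega>) \<partial>M) =
        2 * (frob m A A * frob m B B) + 8 * frob m (gram m A A) (gram m B B)"
      using quad_expectation3(2)[OF sym(2) sym(2), of "gram m A A"]
      by (simp add: trace0 trace_gram quad_expectation2(2)[OF sym(2)] L)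
    moreover have "(\<integral>\<omega>. quad (gram m A B) \<omega> * (quad A \<omega> * quad B \<omega>) \<partial>M) =
        2 * (frob m A B)\<^sup>2 + 4 * frob m (gram m A B) (gram m A B) + 4 * frob m (gram m A B) (gram m B A)"
      using quad_expectation3(2)[OF sym, of "gram m A B"]
      by (simp add: trace0 trace_gram quad_expectation2(2)[OF sym(1)] quad_expectation2(2)[OF sym(2)] L power2_eq_square)
    ultimately show ?thesis
      unfolding eq using quad_expectation4(2)[OF sym(1) sym(2) sym(2), of A] by (simp add: trace0)
  qed
qed

end

text \<open>For \<open>B = A\<close> the fourth moment has the coefficients 4 + 8 + 48 = 60, after
  \<open>frob_gram_le\<close>, in front of the squared Frobenius norm. The squared second moment is
  4 times that quantity, whence 15.\<close>

lemma (in gaussian_vector) quad_hypercontractive: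
  assumes "symmetric_mat m A" "\<And>k. k < m \<Longrightarrow> A k k = 0"
  shows "(\<integral>\<omega>. (quad A \<omega>) ^ 4 \<partial>M) \<le> 15 * (\<integral>\<omega>. (quad A \<omega>)\<^sup>2 \<partial>M)\<^sup>2"
    "integrable M (\<lambda>\<omega>. (quad A \<omega>) ^ 4)"
proof -
  interpret zero_diag_pair M m \<xi> A A by unfold_locales (use assms in auto)
  have eq: "(quad A \<omega>) ^ 4 = (quad A \<omega>)\<^sup>2 * (quad A \<omega>)\<^sup>2" for \<omega> by (simp flip: power_add)
  show "integrable M (\<lambda>\<omega>. (quad A \<omega>) ^ 4)" unfolding eq by (rule quad_moment4)
  show "(\<integral>\<omega>. (quad A \<omega>) ^ 4 \<partial>M) \<le> 15 * (\<integral>\<omega>. (quad A \<omega>)\<^sup>2 \<partial>M)\<^sup>2"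
    unfolding eq quad_moment4 using frob_gram_le[of m A] quad_moment2
    by (simp add: power2_eq_square power_mult_distrib)
qed

subsection \<open>Step functions on a grid\<close>

definition grid :: "nat \<Rightarrow> (nat \<Rightarrow> real) \<Rightarrow> bool" where
  "grid m s \<longleftrightarrow> 0 \<le> s 0 \<and> (\<forall>k<m. s k < s (Suc k))"

text \<open>Common form of two objects: with the Brownian path for \<open>F\<close> and
  \<open>G\<close> it is the step integral, with the indicators of \<open>{x..}\<close> and
  \<open>{y..}\<close> it is the step function at (x, y). Refinement of the grid is thereby proved
  for both at once.\<close>

definition grid_sum :: "nat \<Rightarrow> (nat \<Rightarrow> real) \<Rightarrow> (nat \<Rightarrow> nat \<Rightarrow> real) \<Rightarrow> (real \<Rightarrow> real) \<Rightarrow> (real \<Rightarrow> real) \<Rightarrow> real" where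
  "grid_sum m s a F G = (\<Sum>k<m. \<Sum>l<m. a k l * (F (s (Suc k)) - F (s k)) * (G (s (Suc l)) - G (s l)))"

lemma grid_less:
  assumes "grid m s" "i < j" "j \<le> m"
  shows "s i < s j"
  using assms(2,3)
proof (induction j)
  case (Suc j)
  then have "s j < s (Suc j)" using assms(1) by (simp add: grid_def)
  with Suc show ?case by (cases "i = j") auto
qed simp

lemma grid_less_iff:
  assumes "grid m s" "i \<le> m" "j \<le> m"
  shows "s i < s j \<longleftrightarrow> i < j"
  using grid_less[OF assms(1), of i j] grid_less[OF assms(1), of j i] assms
  by (metis less_irrefl not_less_iff_gr_or_eq order_less_asym)

lemma grid_le_iff:
  assumes "grid m s" "i \<le> m" "j \<le> m"
  shows "s i \<le> s j \<longleftrightarrow> i \<le> j"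
  using grid_less_iff[OF assms(1,3,2)] by (meson not_less)

lemma grid_nonneg: "grid m s \<Longrightarrow> i \<le> m \<Longrightarrow> 0 \<le> s i"
  using grid_le_iff[of m s 0 i] by (auto simp: grid_def)

lemma off_diagonal_step_iff: "off_diagonal_step m s a \<longleftrightarrow> grid m s \<and> (\<forall>k<m. a k k = 0)"
  by (auto simp: off_diagonal_step_def grid_def)

definition block :: "(nat \<Rightarrow> real) \<Rightarrow> nat \<Rightarrow> real \<Rightarrow> real" where
  "block s k x = indicator {s k<..s (Suc k)} x"

lemma step_function_block: "step_function m s a (x, y) = (\<Sum>k<m. \<Sum>l<m. a k l * block s k x * block s l y)"
  by (simp add: step_function_def block_def indicator_times mult.assoc)

lemma block_eq:
  assumes "grid m s" "k < m"
  shows "block s k x = indicator {x..} (s (Suc k)) - indicator {x..} (s k)"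
  using assms by (auto simp: block_def indicator_def grid_def)

lemma step_function_grid_sum:
  assumes "grid m s"
  shows "step_function m s a (x, y) = grid_sum m s a (indicator {x..}) (indicator {y..})"
  unfolding step_function_block grid_sum_def using assms by (intro sum.cong) (auto simp: block_eq)

lemma step_integral_grid_sum: "step_integral B m s a \<omega> = grid_sum m s a (\<lambda>t. B t \<omega>) (\<lambda>t. B t \<omega>)"
  by (simp add: step_integral_def grid_sum_def)

lemma block_mult:
  assumes "grid m s" "k < m" "l < m"
  shows "block s k x * block s l x = (if k = l then block s k x else 0)"
proof (cases "k = l")
  case False
  then consider "k < l" | "l < k" by linarith
  then show ?thesis
  proof cases
    case 1
    then have "s (Suc k) \<le> s l" using grid_le_iff[OF assms(1), of "Suc k" l] assms by auto
    then show ?thesis using False by (auto simp: block_def indicator_def)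
  next
    case 2
    then have "s (Suc l) \<le> s k" using grid_le_iff[OF assms(1), of "Suc l" k] assms by auto
    then show ?thesis using False by (auto simp: block_def indicator_def)
  qed
qed (simp add: block_def indicator_def)

lemma block_sum_mult:
  assumes "grid m s"
  shows "(\<Sum>k<m. u k * block s k x) * (\<Sum>k<m. v k * block s k x) = (\<Sum>k<m. u k * v k * block s k x)"
proof -
  have "(\<Sum>k<m. u k * block s k x) * (\<Sum>k<m. v k * block s k x) =
      (\<Sum>k<m. \<Sum>l<m. u k * v l * (block s k x * block s l x))"
    unfolding sum_product by (intro sum.cong refl) (simp add: mult_ac)
  also have "\<dots> = (\<Sum>k<m. \<Sum>l<m. if k = l then u k * v k * block s k x else 0)"
    using assms by (intro sum.cong refl) (simp add: block_mult)
  finally show ?thesis by simp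
qed

lemma integrable_block: "integrable lborel (block s k)"
  unfolding block_def[abs_def] by (cases "s k \<le> s (Suc k)") (auto intro!: integrable_real_indicator)

lemma integral_block: "grid m s \<Longrightarrow> k < m \<Longrightarrow> (\<integral>x. block s k x \<partial>lborel) = s (Suc k) - s k"
  by (simp add: block_def[abs_def] grid_def less_imp_le)

text \<open>The cells of one grid are disjoint, so products are formed coefficient by
  coefficient.\<close>

lemma step_function_mult:
  assumes "grid m s"
  shows "step_function m s a y * step_function m s b y = step_function m s (\<lambda>k l. a k l * b k l) y"
proof (cases y)
  case (Pair x z)
  have *: "step_function m s c (x, z) = (\<Sum>k<m. (\<Sum>l<m. c k l * block s l z) * block s k x)" for c
    unfolding step_function_block sum_distrib_right by (intro sum.cong refl) (simp add: mult_ac)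
  show ?thesis unfolding Pair * block_sum_mult[OF assms] by simp
qed

lemma step_function_integrable:
  assumes "grid m s"
  shows "integrable lborel (step_function m s a)"
    and "(\<integral>y. step_function m s a y \<partial>lborel) = (\<Sum>k<m. \<Sum>l<m. a k l * (s (Suc k) - s k) * (s (Suc l) - s l))"
proof -
  have i: "integrable (lborel \<Otimes>\<^sub>M lborel) (\<lambda>(x, y). block s k x * block s l y)"
    "(\<integral>y. (case y of (x, y) \<Rightarrow> block s k x * block s l y) \<partial>(lborel \<Otimes>\<^sub>M lborel)) = (s (Suc k) - s k) * (s (Suc l) - s l)"
    if "k < m" "l < m" for k l
  proof -
    have lt: "s k \<le> s (Suc k)" "s l \<le> s (Suc l)"
      using that assms by (auto simp: grid_def less_imp_le)
    have eq: "(\<lambda>(x, y). block s k x * block s l y) = indicator ({s k<..s (Suc k)} \<times> {s l<..s (Suc l)})"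
      by (auto simp: block_def indicator_times)
    have em: "emeasure (lborel \<Otimes>\<^sub>M lborel) ({s k<..s (Suc k)} \<times> {s l<..s (Suc l)}) =
        ennreal ((s (Suc k) - s k) * (s (Suc l) - s l))"
      using lt by (subst lborel.emeasure_pair_measure_Times) (auto simp: ennreal_mult)
    show "integrable (lborel \<Otimes>\<^sub>M lborel) (\<lambda>(x, y). block s k x * block s l y)"
      unfolding eq by (intro integrable_real_indicator) (auto simp: em)
    show "(\<integral>y. (case y of (x, y) \<Rightarrow> block s k x * block s l y) \<partial>(lborel \<Otimes>\<^sub>M lborel)) = (s (Suc k) - s k) * (s (Suc l) - s l)"
      unfolding eq using lt by (simp add: measure_def em)
  qed
  have eq: "step_function m s a = (\<lambda>y. \<Sum>k<m. \<Sum>l<m. a k l * (case y of (x, y) \<Rightarrow> block s k x * block s l y))"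
    by (auto simp: step_function_block mult_ac intro!: ext sum.cong)
  show "integrable lborel (step_function m s a)"
    unfolding eq lborel_prod[symmetric] by (intro Bochner_Integration.integrable_sum integrable_mult_right i) auto
  show "(\<integral>y. step_function m s a y \<partial>lborel) = (\<Sum>k<m. \<Sum>l<m. a k l * (s (Suc k) - s k) * (s (Suc l) - s l))"
  proof -
    let ?f = "\<lambda>k l y. a k l * (case y of (x, y) \<Rightarrow> block s k x * block s l y)"
    have "(\<integral>y. (\<Sum>k<m. \<Sum>l<m. ?f k l y) \<partial>(lborel \<Otimes>\<^sub>M lborel)) = (\<Sum>k<m. \<integral>y. (\<Sum>l<m. ?f k l y) \<partial>(lborel \<Otimes>\<^sub>M lborel))"
      by (intro Bochner_Integration.integral_sum Bochner_Integration.integrable_sum integrable_mult_right i) auto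
    also have "\<dots> = (\<Sum>k<m. \<Sum>l<m. \<integral>y. ?f k l y \<partial>(lborel \<Otimes>\<^sub>M lborel))"
      by (intro sum.cong refl Bochner_Integration.integral_sum integrable_mult_right i) auto
    also have "\<dots> = (\<Sum>k<m. \<Sum>l<m. a k l * (s (Suc k) - s k) * (s (Suc l) - s l))"
      by (intro sum.cong refl) (simp add: i)
    finally show ?thesis unfolding eq lborel_prod[symmetric] .
  qed
qed

lemma step_function_L2:
  assumes "grid m s"
  shows "L2 lborel (step_function m s a)"
  using step_function_integrable(1)[OF assms, of a] step_function_integrable(1)[OF assms, of "\<lambda>k l. a k l * a k l"]
  by (simp add: L2_def power2_eq_square step_function_mult[OF assms])

text \<open>Normalizing the increments to variance one moves the roots of the cell lengths into the
  coefficients. Frobenius products of scaled matrices then equal inner products of step functions in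
  the plane.\<close>

definition scale_mat :: "(nat \<Rightarrow> real) \<Rightarrow> (nat \<Rightarrow> nat \<Rightarrow> real) \<Rightarrow> nat \<Rightarrow> nat \<Rightarrow> real" where
  "scale_mat s a k l = a k l * sqrt (s (Suc k) - s k) * sqrt (s (Suc l) - s l)"

lemma frob_scale_mat:
  assumes "grid m s"
  shows "frob m (scale_mat s a) (scale_mat s b) = (\<integral>y. step_function m s a y * step_function m s b y \<partial>lborel)"
proof -
  have sq: "sqrt (s (Suc k) - s k) * sqrt (s (Suc k) - s k) = s (Suc k) - s k" if "k < m" for k
    using that assms by (simp add: grid_def less_imp_le)
  have "frob m (scale_mat s a) (scale_mat s b) = (\<Sum>k<m. \<Sum>l<m. a k l * b k l *
      (sqrt (s (Suc k) - s k) * sqrt (s (Suc k) - s k)) * (sqrt (s (Suc l) - s l) * sqrt (s (Suc l) - s l)))"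
    unfolding frob_def scale_mat_def by (intro sum.cong refl) (simp only: mult_ac)
  also have "\<dots> = (\<Sum>k<m. \<Sum>l<m. a k l * b k l * (s (Suc k) - s k) * (s (Suc l) - s l))"
    by (intro sum.cong refl) (simp only: sq lessThan_iff)
  finally show ?thesis using assms by (simp add: step_function_mult step_function_integrable)
qed

text \<open>The kernel of \<open>F\<^sup>* G\<close>, where \<open>F\<close> and \<open>G\<close> are the integral operators with kernels \<open>f\<close> and
  \<open>g\<close>.\<close>

definition kgram :: "(real \<times> real \<Rightarrow> real) \<Rightarrow> (real \<times> real \<Rightarrow> real) \<Rightarrow> real \<times> real \<Rightarrow> real" where
  "kgram f g = (\<lambda>(x, y). \<integral>t. f (t, x) * g (t, y) \<partial>lborel)"

definition step_gram :: "nat \<Rightarrow> (nat \<Rightarrow> real) \<Rightarrow> (nat \<Rightarrow> nat \<Rightarrow> real) \<Rightarrow> (nat \<Rightarrow> nat \<Rightarrow> real) \<Rightarrow> nat \<Rightarrow> nat \<Rightarrow> real" where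
  "step_gram m s a b p q = (\<Sum>k<m. a k p * b k q * (s (Suc k) - s k))"

lemma gram_scale_mat:
  assumes "grid m s"
  shows "gram m (scale_mat s a) (scale_mat s b) = scale_mat s (step_gram m s a b)"
proof (intro ext)
  fix p q
  have sq: "sqrt (s (Suc k) - s k) * sqrt (s (Suc k) - s k) = s (Suc k) - s k" if "k < m" for k
    using that assms by (simp add: grid_def less_imp_le)
  have "gram m (scale_mat s a) (scale_mat s b) p q = (\<Sum>k<m. a k p * b k q *
      (sqrt (s (Suc k) - s k) * sqrt (s (Suc k) - s k)) * sqrt (s (Suc p) - s p) * sqrt (s (Suc q) - s q))"
    unfolding gram_def scale_mat_def by (intro sum.cong refl) (simp only: mult_ac)
  also have "\<dots> = (\<Sum>k<m. a k p * b k q * (s (Suc k) - s k) * sqrt (s (Suc p) - s p) * sqrt (s (Suc q) - s q))"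
    by (intro sum.cong refl) (simp only: sq lessThan_iff)
  finally show "gram m (scale_mat s a) (scale_mat s b) p q = scale_mat s (step_gram m s a b) p q"
    by (simp add: scale_mat_def step_gram_def sum_distrib_right)
qed

lemma kgram_step_function:
  assumes "grid m s"
  shows "kgram (step_function m s a) (step_function m s b) = step_function m s (step_gram m s a b)"
proof (intro ext, clarify)
  fix x y
  have *: "step_function m s c (t, z) = (\<Sum>k<m. (\<Sum>l<m. c k l * block s l z) * block s k t)" for c t z
    unfolding step_function_block sum_distrib_right by (intro sum.cong refl) (simp add: mult_ac)
  have "kgram (step_function m s a) (step_function m s b) (x, y) =
      (\<integral>t. (\<Sum>k<m. ((\<Sum>l<m. a k l * block s l x) * (\<Sum>l<m. b k l * block s l y)) * block s k t) \<partial>lborel)"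
    unfolding kgram_def * prod.case block_sum_mult[OF assms] ..
  also have "\<dots> = (\<Sum>k<m. ((\<Sum>l<m. a k l * block s l x) * (\<Sum>l<m. b k l * block s l y)) * (s (Suc k) - s k))"
    using assms by (subst Bochner_Integration.integral_sum) (auto intro!: integrable_mult_right integrable_block sum.cong simp: integral_block)
  also have "\<dots> = (\<Sum>k<m. \<Sum>p<m. \<Sum>q<m. a k p * b k q * (s (Suc k) - s k) * block s p x * block s q y)"
    unfolding sum_product unfolding sum_distrib_right sum_distrib_left by (intro sum.cong refl) (simp add: mult_ac)
  also have "\<dots> = (\<Sum>p<m. \<Sum>k<m. \<Sum>q<m. a k p * b k q * (s (Suc k) - s k) * block s p x * block s q y)"
    by (rule sum.swap)
  also have "\<dots> = (\<Sum>p<m. \<Sum>q<m. \<Sum>k<m. a k p * b k q * (s (Suc k) - s k) * block s p x * block s q y)"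
    by (rule sum.cong[OF refl], rule sum.swap)
  also have "\<dots> = step_function m s (step_gram m s a b) (x, y)"
    unfolding step_function_block step_gram_def sum_distrib_right ..
  finally show "kgram (step_function m s a) (step_function m s b) (x, y) = step_function m s (step_gram m s a b) (x, y)" .
qed

section \<open>Common refinements of grids and symmetrization of step kernels\<close>

lemma grid_refine:
  assumes "grid m s" "grid m' s'"
  shows "\<exists>n t. grid n t \<and> s ` {..m} \<subseteq> t ` {..n} \<and> s' ` {..m'} \<subseteq> t ` {..n}"
proof -
  define P where "P = s ` {..m} \<union> s' ` {..m'}"
  have P: "finite P" "P \<noteq> {}" by (auto simp: P_def)
  define L where "L = sorted_list_of_set P"
  have L: "set L = P" "sorted_wrt (<) L" using P by (auto simp: L_def)
  have len: "L \<noteq> []" using L P by auto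
  \<comment> \<open>The index bound counts cells, one fewer than the points in the list.\<close>
  have "grid (length L - 1) ((!) L)"
    unfolding grid_def
  proof (intro conjI allI impI)
    have "L ! 0 \<in> P" using L len by (metis length_greater_0_conv nth_mem)
    then show "0 \<le> L ! 0" using grid_nonneg assms by (auto simp: P_def)
    fix k assume "k < length L - 1"
    then show "L ! k < L ! Suc k" using L(2) by (auto simp: sorted_wrt_iff_nth_less)
  qed
  moreover have "P \<subseteq> (!) L ` {..length L - 1}"
  proof
    fix x assume "x \<in> P"
    then obtain i where "i < length L" "L ! i = x" using L by (metis in_set_conv_nth)
    then show "x \<in> (!) L ` {..length L - 1}" by (intro image_eqI[of _ _ i]) auto
  qed
  ultimately show ?thesis unfolding P_def by blast
qed

text \<open>The cells are half-open on the left, so a step function takes its value on a cell of a finer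
  grid also at the upper right corner of that cell.\<close>

definition refine_coeff :: "nat \<Rightarrow> (nat \<Rightarrow> real) \<Rightarrow> (nat \<Rightarrow> nat \<Rightarrow> real) \<Rightarrow> (nat \<Rightarrow> real) \<Rightarrow> nat \<Rightarrow> nat \<Rightarrow> real" where
  "refine_coeff m s a t p q = step_function m s a (t (Suc p), t (Suc q))"

text \<open>The fine cells inside coarse cell \<open>k\<close> are those between the positions
  \<open>i\<close> and \<open>j\<close> of its two endpoints, so the increments telescope. Testing
  the upper endpoint \<open>t (Suc p)\<close> decides whether a fine cell lies inside.\<close>

lemma block_telescope:
  assumes s: "grid m s" and t: "grid n t" and sub: "s ` {..m} \<subseteq> t ` {..n}" and k: "k < m"
  shows "(\<Sum>p<n. block s k (t (Suc p)) * (F (t (Suc p)) - F (t p))) = F (s (Suc k)) - F (s k)"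
proof -
  have "s k \<in> t ` {..n}" "s (Suc k) \<in> t ` {..n}" using sub k by auto
  then obtain i j where ij: "s k = t i" "s (Suc k) = t j" "i \<le> n" "j \<le> n" by auto
  have "i < j" using s k ij grid_less_iff[OF t, of i j] by (auto simp: grid_def)
  have "block s k (t (Suc p)) = (if p \<in> {i..<j} then 1 else 0)" if "p < n" for p
    using that grid_less_iff[OF t, of i "Suc p"] grid_le_iff[OF t, of "Suc p" j] ij
    by (auto simp: block_def indicator_def)
  then have "(\<Sum>p<n. block s k (t (Suc p)) * (F (t (Suc p)) - F (t p))) =
      (\<Sum>p<n. if p \<in> {i..<j} then F (t (Suc p)) - F (t p) else 0)"
    by (intro sum.cong) auto
  also have "\<dots> = (\<Sum>p\<in>{i..<j}. F (t (Suc p)) - F (t p))"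
    using \<open>j \<le> n\<close> by (subst sum.inter_restrict[symmetric]) (auto intro!: sum.cong)
  also have "\<dots> = F (t j) - F (t i)"
    using \<open>i < j\<close> sum_Suc_diff'[of i j "\<lambda>p. F (t p)"] by simp
  finally show ?thesis using ij by simp
qed

lemma grid_sum_refine:
  assumes s: "grid m s" and t: "grid n t" and sub: "s ` {..m} \<subseteq> t ` {..n}"
  shows "grid_sum n t (refine_coeff m s a t) F G = grid_sum m s a F G"
proof -
  define \<Delta>F where "\<Delta>F p = F (t (Suc p)) - F (t p)" for p
  define \<Delta>G where "\<Delta>G p = G (t (Suc p)) - G (t p)" for p
  have "grid_sum n t (refine_coeff m s a t) F G = (\<Sum>p<n. \<Sum>q<n. \<Sum>k<m. \<Sum>l<m.
      a k l * (block s k (t (Suc p)) * \<Delta>F p) * (block s l (t (Suc q)) * \<Delta>G q))"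
    unfolding grid_sum_def refine_coeff_def step_function_block sum_distrib_right \<Delta>F_def \<Delta>G_def
    by (intro sum.cong refl) (simp only: mult_ac)
  also have "\<dots> = (\<Sum>p<n. \<Sum>k<m. \<Sum>q<n. \<Sum>l<m.
      a k l * (block s k (t (Suc p)) * \<Delta>F p) * (block s l (t (Suc q)) * \<Delta>G q))"
    by (rule sum.cong[OF refl], rule sum.swap)
  also have "\<dots> = (\<Sum>k<m. \<Sum>p<n. \<Sum>q<n. \<Sum>l<m.
      a k l * (block s k (t (Suc p)) * \<Delta>F p) * (block s l (t (Suc q)) * \<Delta>G q))"
    by (rule sum.swap)
  also have "\<dots> = (\<Sum>k<m. \<Sum>p<n. \<Sum>l<m. \<Sum>q<n.
      a k l * (block s k (t (Suc p)) * \<Delta>F p) * (block s l (t (Suc q)) * \<Delta>G q))"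
    by (rule sum.cong[OF refl], rule sum.cong[OF refl], rule sum.swap)
  also have "\<dots> = (\<Sum>k<m. \<Sum>l<m. \<Sum>p<n. \<Sum>q<n.
      a k l * (block s k (t (Suc p)) * \<Delta>F p) * (block s l (t (Suc q)) * \<Delta>G q))"
    by (rule sum.cong[OF refl], rule sum.swap)
  also have "\<dots> = (\<Sum>k<m. \<Sum>l<m. a k l * ((\<Sum>p<n. block s k (t (Suc p)) * \<Delta>F p) * (\<Sum>q<n. block s l (t (Suc q)) * \<Delta>G q)))"
    unfolding sum_product unfolding sum_distrib_left sum_distrib_right by (intro sum.cong refl) (simp add: mult_ac)
  also have "\<dots> = grid_sum m s a F G"
    unfolding grid_sum_def \<Delta>F_def \<Delta>G_def using block_telescope[OF s t sub]
    by (intro sum.cong refl) (simp add: mult_ac)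
  finally show ?thesis .
qed

lemma step_function_refine:
  assumes "grid m s" "grid n t" "s ` {..m} \<subseteq> t ` {..n}"
  shows "step_function n t (refine_coeff m s a t) = step_function m s a"
  using grid_sum_refine[OF assms] by (auto simp: step_function_grid_sum assms)

lemma step_integral_refine:
  assumes "grid m s" "grid n t" "s ` {..m} \<subseteq> t ` {..n}"
  shows "step_integral B n t (refine_coeff m s a t) = step_integral B m s a"
  using grid_sum_refine[OF assms] by (auto simp: step_integral_grid_sum)

text \<open>Both coordinates of the sampling point coincide, so only diagonal coarse cells could
  contain it, and their coefficients are 0.\<close>

lemma refine_coeff_diag:
  assumes "off_diagonal_step m s a"
  shows "refine_coeff m s a t p p = 0"
proof -
  have *: "a k l * block s k x * block s l x = 0" if "k < m" "l < m" for k l x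
  proof (cases "k = l")
    case False
    then show ?thesis using block_mult[of m s k l x] that assms
      by (auto simp: off_diagonal_step_iff simp del: mult_eq_0_iff simp add: mult.assoc)
  qed (use assms that in \<open>auto simp: off_diagonal_step_iff\<close>)
  show ?thesis unfolding refine_coeff_def step_function_block
    by (intro sum.neutral ballI) (simp only: * lessThan_iff)
qed

lemma refine_coeff_symmetric:
  assumes "symmetric_mat m a"
  shows "symmetric_mat n (refine_coeff m s a t)"
proof -
  have "step_function m s a (x, y) = step_function m s a (y, x)" for x y
  proof -
    have "step_function m s a (x, y) = (\<Sum>l<m. \<Sum>k<m. a k l * block s k x * block s l y)"
      unfolding step_function_block by (rule sum.swap)
    also have "\<dots> = step_function m s a (y, x)"
      unfolding step_function_block using symmetric_matD[OF assms]
      by (intro sum.cong refl) (simp add: mult_ac)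
    finally show ?thesis .
  qed
  then show ?thesis by (simp add: symmetric_mat_def refine_coeff_def)
qed

definition symmetrize :: "(nat \<Rightarrow> nat \<Rightarrow> real) \<Rightarrow> nat \<Rightarrow> nat \<Rightarrow> real" where
  "symmetrize a k l = (a k l + a l k) / 2"

lemma step_function_symmetrize:
  "step_function m s (symmetrize a) (x, y) = (step_function m s a (x, y) + step_function m s a (y, x)) / 2"
proof -
  have "step_function m s a (y, x) = (\<Sum>l<m. \<Sum>k<m. a k l * block s k y * block s l x)"
    unfolding step_function_block by (rule sum.swap)
  moreover have "step_function m s (symmetrize a) (x, y) =
      (\<Sum>k<m. \<Sum>l<m. (a k l * block s k x * block s l y + a l k * block s l y * block s k x) / 2)"
    unfolding step_function_block by (intro sum.cong refl) (simp add: symmetrize_def field_simps)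
  ultimately show ?thesis
    by (simp add: step_function_block[of m s a x y] sum.distrib sum_divide_distrib[symmetric])
qed

lemma step_integral_symmetrize: "step_integral B m s (symmetrize a) = step_integral B m s a"
proof
  fix \<omega>
  have "step_integral B m s a \<omega> =
      (\<Sum>l<m. \<Sum>k<m. a k l * (B (s (Suc k)) \<omega> - B (s k) \<omega>) * (B (s (Suc l)) \<omega> - B (s l) \<omega>))"
    unfolding step_integral_def by (rule sum.swap)
  moreover have "step_integral B m s (symmetrize a) \<omega> =
      (\<Sum>k<m. \<Sum>l<m. (a k l * (B (s (Suc k)) \<omega> - B (s k) \<omega>) * (B (s (Suc l)) \<omega> - B (s l) \<omega>)
        + a l k * (B (s (Suc l)) \<omega> - B (s l) \<omega>) * (B (s (Suc k)) \<omega> - B (s k) \<omega>)) / 2)"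
    unfolding step_integral_def by (intro sum.cong refl) (simp add: symmetrize_def field_simps)
  moreover have "step_integral B m s a \<omega> =
      (\<Sum>k<m. \<Sum>l<m. a k l * (B (s (Suc k)) \<omega> - B (s k) \<omega>) * (B (s (Suc l)) \<omega> - B (s l) \<omega>))"
    by (rule step_integral_def)
  ultimately show "step_integral B m s (symmetrize a) \<omega> = step_integral B m s a \<omega>"
    by (simp only: sum.distrib sum_divide_distrib[symmetric]) simp
qed

subsection \<open>Contraction of square-integrable kernels\<close>

lemma L2_pair_measurable:
  "L2 (lborel :: (real \<times> real) measure) f \<Longrightarrow> f \<in> borel_measurable (borel \<Otimes>\<^sub>M borel)"
  by (simp add: borel_prod L2_def)

lemma nn_integral_lborel_pair:
  assumes [measurable]: "f \<in> borel_measurable (borel \<Otimes>\<^sub>M borel)"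
  shows "(\<integral>\<^sup>+p. f p \<partial>(lborel :: (real \<times> real) measure)) = (\<integral>\<^sup>+x. \<integral>\<^sup>+y. f (x, y) \<partial>lborel \<partial>lborel)"
proof -
  have "f \<in> borel_measurable (lborel \<Otimes>\<^sub>M lborel)" by measurable
  from lborel.nn_integral_fst[OF this] show ?thesis by (simp add: lborel_prod)
qed

lemma nn_integral_lborel_pair_swap:
  assumes [measurable]: "f \<in> borel_measurable (borel \<Otimes>\<^sub>M borel)"
  shows "(\<integral>\<^sup>+p. f p \<partial>(lborel :: (real \<times> real) measure)) = (\<integral>\<^sup>+y. \<integral>\<^sup>+x. f (x, y) \<partial>lborel \<partial>lborel)"
proof -
  have "f \<in> borel_measurable (lborel \<Otimes>\<^sub>M lborel)" by measurable
  from lborel_pair.nn_integral_snd[OF this] show ?thesis by (simp add: lborel_prod)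
qed

lemma AE_lborel_pair_sections:
  assumes L: "L2 (lborel :: (real \<times> real) measure) f"
  shows "AE y in lborel. L2 lborel (\<lambda>x. f (x, y))"
proof -
  have [measurable]: "f \<in> borel_measurable (borel \<Otimes>\<^sub>M borel)" using L by (rule L2_pair_measurable)
  have "(\<integral>\<^sup>+y. \<integral>\<^sup>+x. ennreal ((f (x, y))\<^sup>2) \<partial>lborel \<partial>lborel) < \<infinity>"
    using L nn_integral_lborel_pair_swap[of "\<lambda>p. ennreal ((f p)\<^sup>2)"] by (simp add: L2_iff_nn_integral)
  then have "AE y in lborel. (\<integral>\<^sup>+x. ennreal ((f (x, y))\<^sup>2) \<partial>lborel) \<noteq> \<infinity>"
    by (intro nn_integral_PInf_AE) (auto simp: top.not_eq_extremum)
  then show ?thesis by (auto simp: L2_iff_nn_integral top.not_eq_extremum elim!: eventually_mono)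
qed

lemma AE_lborel_pairI:
  assumes "AE x in lborel. P x" "AE y in lborel. Q y"
  shows "AE p in (lborel :: (real \<times> real) measure). P (fst p) \<and> Q (snd p)"
proof -
  have *: "AE p :: real \<times> real in lborel \<Otimes>\<^sub>M lborel. P (fst p)" if H: "AE x in lborel. P x" for P :: "real \<Rightarrow> bool"
  proof -
    obtain N where N: "N \<in> null_sets lborel" "{x. \<not> P x} \<subseteq> N"
      using H[unfolded eventually_ae_filter] by auto
    have "N \<times> UNIV \<in> null_sets (lborel \<Otimes>\<^sub>M lborel)"
      using N by (auto simp: null_sets_def lborel.emeasure_pair_measure_Times)
    then show ?thesis by (rule AE_I') (use N in auto)
  qed
  have **: "AE p :: real \<times> real in lborel \<Otimes>\<^sub>M lborel. P (snd p)" if H: "AE x in lborel. P x" for P :: "real \<Rightarrow> bool"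
  proof -
    obtain N where N: "N \<in> null_sets lborel" "{x. \<not> P x} \<subseteq> N"
      using H[unfolded eventually_ae_filter] by auto
    have "UNIV \<times> N \<in> null_sets (lborel \<Otimes>\<^sub>M lborel)"
      using N by (auto simp: null_sets_def lborel.emeasure_pair_measure_Times)
    then show ?thesis by (rule AE_I') (use N in auto)
  qed
  show ?thesis
    unfolding lborel_prod[symmetric] using *[OF assms(1)] **[OF assms(2)] by (rule AE_conjI)
qed

lemma kgram_measurable[measurable]:
  assumes [measurable]: "f \<in> borel_measurable (borel \<Otimes>\<^sub>M borel)" "g \<in> borel_measurable (borel \<Otimes>\<^sub>M borel)"
  shows "kgram f g \<in> borel_measurable (borel \<Otimes>\<^sub>M borel)"
  unfolding kgram_def by measurable

text \<open>Submultiplicativity of the Hilbert-Schmidt norm: Cauchy-Schwarz in the contracted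
  variable, then Tonelli in the two free ones.\<close>

lemma kgram_bound:
  assumes f: "L2 lborel f" and g: "L2 lborel g"
  shows "L2 lborel (kgram f g)"
    and "(\<integral>p. (kgram f g p)\<^sup>2 \<partial>lborel) \<le> (\<integral>p. (f p)\<^sup>2 \<partial>lborel) * (\<integral>p. (g p)\<^sup>2 \<partial>lborel)"
proof -
  have [measurable]: "f \<in> borel_measurable (borel \<Otimes>\<^sub>M borel)" "g \<in> borel_measurable (borel \<Otimes>\<^sub>M borel)"
    using f g by (auto intro: L2_pair_measurable)
  have le: "ennreal ((kgram f g (x, y))\<^sup>2) \<le>
      (\<integral>\<^sup>+t. ennreal ((f (t, x))\<^sup>2) \<partial>lborel) * (\<integral>\<^sup>+t. ennreal ((g (t, y))\<^sup>2) \<partial>lborel)" for x y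
  proof -
    \<comment> \<open>Where the product is not integrable, \<open>kgram\<close> has the default
      value 0 and the bound is trivial; it thus holds at every point.\<close>
    have "ennreal \<bar>kgram f g (x, y)\<bar> \<le> (\<integral>\<^sup>+t. ennreal \<bar>f (t, x)\<bar> * ennreal \<bar>g (t, y)\<bar> \<partial>lborel)"
    proof (cases "integrable lborel (\<lambda>t. f (t, x) * g (t, y))")
      case True
      from integral_norm_bound_ennreal[OF this] show ?thesis
        by (simp add: kgram_def abs_mult ennreal_mult)
    qed (simp add: kgram_def not_integrable_integral_eq)
    then have "(ennreal \<bar>kgram f g (x, y)\<bar>)\<^sup>2 \<le> (\<integral>\<^sup>+t. ennreal \<bar>f (t, x)\<bar> * ennreal \<bar>g (t, y)\<bar> \<partial>lborel)\<^sup>2"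
      by (intro power_mono) auto
    also have "\<dots> \<le> (\<integral>\<^sup>+t. (ennreal \<bar>f (t, x)\<bar>)\<^sup>2 \<partial>lborel) * (\<integral>\<^sup>+t. (ennreal \<bar>g (t, y)\<bar>)\<^sup>2 \<partial>lborel)"
      by (intro Cauchy_Schwarz_nn_integral) measurable
    finally show ?thesis by (simp add: ennreal_power)
  qed
  have "(\<integral>\<^sup>+p. ennreal ((kgram f g p)\<^sup>2) \<partial>lborel) = (\<integral>\<^sup>+x. \<integral>\<^sup>+y. ennreal ((kgram f g (x, y))\<^sup>2) \<partial>lborel \<partial>lborel)"
    by (intro nn_integral_lborel_pair) measurable
  also have "\<dots> \<le> (\<integral>\<^sup>+x. \<integral>\<^sup>+y. (\<integral>\<^sup>+t. ennreal ((f (t, x))\<^sup>2) \<partial>lborel) * (\<integral>\<^sup>+t. ennreal ((g (t, y))\<^sup>2) \<partial>lborel) \<partial>lborel \<partial>lborel)"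
    by (intro nn_integral_mono le)
  also have "\<dots> = (\<integral>\<^sup>+x. \<integral>\<^sup>+t. ennreal ((f (t, x))\<^sup>2) \<partial>lborel \<partial>lborel) * (\<integral>\<^sup>+y. \<integral>\<^sup>+t. ennreal ((g (t, y))\<^sup>2) \<partial>lborel \<partial>lborel)"
    by (subst nn_integral_cmult, measurable, subst nn_integral_multc, measurable)
  also have "\<dots> = (\<integral>\<^sup>+p. ennreal ((f p)\<^sup>2) \<partial>lborel) * (\<integral>\<^sup>+p. ennreal ((g p)\<^sup>2) \<partial>lborel)"
    by (subst (1 2) nn_integral_lborel_pair_swap) measurable
  also have "\<dots> = ennreal ((\<integral>p. (f p)\<^sup>2 \<partial>lborel) * (\<integral>p. (g p)\<^sup>2 \<partial>lborel))"
    using f g by (simp add: nn_integral_eq_integral L2_def ennreal_mult)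
  finally have *: "(\<integral>\<^sup>+p. ennreal ((kgram f g p)\<^sup>2) \<partial>lborel) \<le> ennreal ((\<integral>p. (f p)\<^sup>2 \<partial>lborel) * (\<integral>p. (g p)\<^sup>2 \<partial>lborel))" .
  moreover have "kgram f g \<in> borel_measurable borel"
    unfolding borel_prod[symmetric] by measurable
  ultimately show L: "L2 lborel (kgram f g)"
    by (auto simp: L2_iff_nn_integral intro: le_less_trans)
  have "ennreal (\<integral>p. (kgram f g p)\<^sup>2 \<partial>lborel) \<le> ennreal ((\<integral>p. (f p)\<^sup>2 \<partial>lborel) * (\<integral>p. (g p)\<^sup>2 \<partial>lborel))"
    using * L by (simp add: nn_integral_eq_integral L2_def)
  then show "(\<integral>p. (kgram f g p)\<^sup>2 \<partial>lborel) \<le> (\<integral>p. (f p)\<^sup>2 \<partial>lborel) * (\<integral>p. (g p)\<^sup>2 \<partial>lborel)"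
    by (subst (asm) ennreal_le_iff) auto
qed

text \<open>\<open>kgram\<close> is bilinear only almost everywhere: splitting the integral requires
  square-integrable sections, and at the remaining points default values of the Bochner integral
  intervene.\<close>

lemma kgram_diff_AE:
  assumes f: "L2 lborel f" and g: "L2 lborel g" and f': "L2 lborel f'" and g': "L2 lborel g'"
  shows "AE p in lborel. kgram f' g' p - kgram f g p =
    kgram (\<lambda>p. f' p - f p) g' p + kgram f (\<lambda>p. g' p - g p) p"
proof -
  have "AE p in lborel. (L2 lborel (\<lambda>t. f (t, fst p)) \<and> L2 lborel (\<lambda>t. f' (t, fst p))) \<and>
      (L2 lborel (\<lambda>t. g (t, snd p)) \<and> L2 lborel (\<lambda>t. g' (t, snd p)))"
    using assms by (intro AE_lborel_pairI AE_conjI AE_lborel_pair_sections)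
  then show ?thesis
  proof (rule eventually_mono, clarsimp)
    fix x y
    assume "L2 lborel (\<lambda>t. f (t, x))" "L2 lborel (\<lambda>t. f' (t, x))" "L2 lborel (\<lambda>t. g (t, y))" "L2 lborel (\<lambda>t. g' (t, y))"
    then have "integrable lborel (\<lambda>t. f (t, x) * g (t, y))" "integrable lborel (\<lambda>t. f' (t, x) * g' (t, y))"
      "integrable lborel (\<lambda>t. f (t, x) * g' (t, y))"
      by (auto intro: L2_integrable_mult)
    then show "kgram f' g' (x, y) - kgram f g (x, y) =
       kgram (\<lambda>p. f' p - f p) g' (x, y) + kgram f (\<lambda>p. g' p - g p) (x, y)"
      by (simp add: kgram_def left_diff_distrib right_diff_distrib)
  qed
qed

lemma L2_tendsto_kgram:
  assumes F: "L2_tendsto lborel F f" and G: "L2_tendsto lborel G g"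
  shows "L2_tendsto lborel (\<lambda>r. kgram (F r) (G r)) (kgram f g)"
proof -
  have L[simp]: "L2 lborel f" "L2 lborel g" "L2 lborel (F r)" "L2 lborel (G r)" for r
    using F G by (auto simp: L2_tendsto_def)
  \<comment> \<open>Convergence of these norms keeps the factor of the first error term
    bounded.\<close>
  have "(\<lambda>r. \<integral>p. G r p * G r p \<partial>lborel) \<longlonglongrightarrow> (\<integral>p. g p * g p \<partial>lborel)"
    by (intro L2_tendsto_integral_mult G)
  then have "(\<lambda>r. 2 * ((\<integral>p. (F r p - f p)\<^sup>2 \<partial>lborel) * (\<integral>p. (G r p)\<^sup>2 \<partial>lborel)) +
      2 * ((\<integral>p. (f p)\<^sup>2 \<partial>lborel) * (\<integral>p. (G r p - g p)\<^sup>2 \<partial>lborel))) \<longlonglongrightarrow>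
      2 * (0 * (\<integral>p. (g p)\<^sup>2 \<partial>lborel)) + 2 * ((\<integral>p. (f p)\<^sup>2 \<partial>lborel) * 0)"
    using F G by (intro tendsto_intros) (auto simp: L2_tendsto_def power2_eq_square)
  moreover have "(\<integral>p. (kgram (F r) (G r) p - kgram f g p)\<^sup>2 \<partial>lborel) \<le>
      2 * ((\<integral>p. (F r p - f p)\<^sup>2 \<partial>lborel) * (\<integral>p. (G r p)\<^sup>2 \<partial>lborel)) +
      2 * ((\<integral>p. (f p)\<^sup>2 \<partial>lborel) * (\<integral>p. (G r p - g p)\<^sup>2 \<partial>lborel))" for r
  proof -
    let ?u = "kgram (\<lambda>p. F r p - f p) (G r)" and ?v = "kgram f (\<lambda>p. G r p - g p)"
    have [simp]: "L2 lborel (\<lambda>p. F r p - f p)" "L2 lborel (\<lambda>p. G r p - g p)"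
      by (auto intro: L2_diff)
    have [simp]: "L2 lborel ?u" "L2 lborel ?v" by (auto intro: kgram_bound)
    have m: "f \<in> borel_measurable (borel \<Otimes>\<^sub>M borel)" "g \<in> borel_measurable (borel \<Otimes>\<^sub>M borel)"
      "F r \<in> borel_measurable (borel \<Otimes>\<^sub>M borel)" "G r \<in> borel_measurable (borel \<Otimes>\<^sub>M borel)"
      using L by (auto intro: L2_pair_measurable)
    note [measurable] = m
    have [measurable]: "kgram (F r) (G r) \<in> borel_measurable lborel" "kgram f g \<in> borel_measurable lborel"
      using kgram_bound(1)[OF L(3)[of r] L(4)[of r]] kgram_bound(1)[OF L(1,2)] by (auto simp: L2_def)
    have [measurable]: "?u \<in> borel_measurable lborel" "?v \<in> borel_measurable lborel"
      using \<open>L2 lborel ?u\<close> \<open>L2 lborel ?v\<close> by (auto simp: L2_def)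
    have "(\<integral>p. (kgram (F r) (G r) p - kgram f g p)\<^sup>2 \<partial>lborel) = (\<integral>p. (?u p + ?v p)\<^sup>2 \<partial>lborel)"
      using kgram_diff_AE[OF L(1,2) L(3)[of r] L(4)[of r]]
      by (intro integral_cong_AE) (auto elim!: eventually_mono)
    also have "\<dots> \<le> 2 * (\<integral>p. (?u p)\<^sup>2 \<partial>lborel) + 2 * (\<integral>p. (?v p)\<^sup>2 \<partial>lborel)"
      by (intro integral_square_add_le) auto
    also have "\<dots> \<le> 2 * ((\<integral>p. (F r p - f p)\<^sup>2 \<partial>lborel) * (\<integral>p. (G r p)\<^sup>2 \<partial>lborel)) +
      2 * ((\<integral>p. (f p)\<^sup>2 \<partial>lborel) * (\<integral>p. (G r p - g p)\<^sup>2 \<partial>lborel))"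
      by (intro add_mono mult_left_mono kgram_bound) auto
    finally show ?thesis .
  qed
  ultimately have "(\<lambda>r. \<integral>p. (kgram (F r) (G r) p - kgram f g p)\<^sup>2 \<partial>lborel) \<longlonglongrightarrow> 0"
    by (elim Lim_null_comparison[rotated, OF tendsto_eq_rhs]) auto
  then show ?thesis by (auto simp: L2_tendsto_def intro: kgram_bound)
qed

lemma L2_tendsto_swap:
  assumes "L2_tendsto (lborel :: (real \<times> real) measure) F f"
  shows "L2_tendsto lborel (\<lambda>r (x, y). F r (y, x)) (\<lambda>(x, y). f (y, x))"
proof -
  have L: "L2 lborel (\<lambda>(x, y). g (y, x))" "(\<integral>p. (case p of (x, y) \<Rightarrow> g (y, x))\<^sup>2 \<partial>lborel) = (\<integral>p. (g p)\<^sup>2 \<partial>lborel)"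
    if "L2 (lborel :: (real \<times> real) measure) g" for g
  proof -
    have [measurable]: "g \<in> borel_measurable (borel \<Otimes>\<^sub>M borel)" using that by (rule L2_pair_measurable)
    have eq: "(\<lambda>p. (case p of (x, y) \<Rightarrow> g (y, x))\<^sup>2) = (\<lambda>(x, y). (g (y, x))\<^sup>2)" by auto
    have "integrable (lborel \<Otimes>\<^sub>M lborel) (\<lambda>p. (g p)\<^sup>2)" using that by (simp add: L2_def lborel_prod)
    then have "integrable (lborel \<Otimes>\<^sub>M lborel) (\<lambda>(x, y). (g (y, x))\<^sup>2)"
      by (rule lborel_pair.integrable_product_swap)
    then show "L2 lborel (\<lambda>(x, y). g (y, x))" by (simp add: L2_def eq lborel_prod borel_prod[symmetric])
    have "(\<lambda>p. (g p)\<^sup>2) \<in> borel_measurable (lborel \<Otimes>\<^sub>M lborel)" by measurable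
    from lborel_pair.integral_product_swap[OF this]
    show "(\<integral>p. (case p of (x, y) \<Rightarrow> g (y, x))\<^sup>2 \<partial>lborel) = (\<integral>p. (g p)\<^sup>2 \<partial>lborel)"
      by (simp add: eq lborel_prod)
  qed
  have L': "L2 lborel f" "L2 lborel (F r)" for r using assms by (auto simp: L2_tendsto_def)
  have "(\<integral>p. ((case p of (x, y) \<Rightarrow> F r (y, x)) - (case p of (x, y) \<Rightarrow> f (y, x)))\<^sup>2 \<partial>lborel) = (\<integral>p. (F r p - f p)\<^sup>2 \<partial>lborel)" for r
    using L(2)[OF L2_diff[OF L'(2)[of r] L'(1)]] by (simp add: case_prod_beta')
  then show ?thesis using assms by (auto simp: L2_tendsto_def intro: L(1))
qed

subsection \<open>The double Wiener integral\<close>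

locale brownian = prob_space M for M :: "'a measure" +
  fixes B :: "real \<Rightarrow> 'a \<Rightarrow> real"
  assumes BM: "standard_brownian_motion M B"
begin

definition normal_increment :: "(nat \<Rightarrow> real) \<Rightarrow> nat \<Rightarrow> 'a \<Rightarrow> real" where
  "normal_increment s k \<omega> = (B (s (Suc k)) \<omega> - B (s k) \<omega>) / sqrt (s (Suc k) - s k)"

lemma gaussian_increments:
  assumes s: "grid m s"
  shows "gaussian_vector M m (normal_increment s)"
proof
  have "indep_vars (\<lambda>_. borel) (\<lambda>k \<omega>. B (s (Suc k)) \<omega> - B (s k) \<omega>) {..<m}"
    using BM s by (auto simp: standard_brownian_motion_def grid_def)
  from indep_vars_compose2[OF this, of "\<lambda>k x. x / sqrt (s (Suc k) - s k)" "\<lambda>_. borel"]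
  show "indep_vars (\<lambda>_. borel) (normal_increment s) {..<m}"
    by (simp add: normal_increment_def[abs_def])
  fix k assume k: "k < m"
  then have lt: "0 \<le> s k" "s k < s (Suc k)" using s grid_nonneg[OF s, of k] by (auto simp: grid_def)
  then have "distributed M lborel (\<lambda>\<omega>. B (s (Suc k)) \<omega> - B (s k) \<omega>) (normal_density 0 (sqrt (s (Suc k) - s k)))"
    using BM by (auto simp: standard_brownian_motion_def)
  then show "distributed M lborel (normal_increment s k) std_normal_density"
    using lt by (subst (asm) normal_standard_normal_convert) (auto simp: normal_increment_def[abs_def])
qed

lemma step_integral_quad:
  assumes s: "grid m s"
  shows "step_integral B m s a = gaussian_vector.quad m (normal_increment s) (scale_mat s a)"
proof
  fix \<omega>
  interpret gaussian_vector M m "normal_increment s" by (rule gaussian_increments[OF s])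
  have *: "sqrt (s (Suc k) - s k) * normal_increment s k \<omega> = B (s (Suc k)) \<omega> - B (s k) \<omega>" if "k < m" for k
    using s that by (simp add: normal_increment_def grid_def)
  have "quad (scale_mat s a) \<omega> = (\<Sum>k<m. \<Sum>l<m. a k l * (sqrt (s (Suc k) - s k) * normal_increment s k \<omega>)
      * (sqrt (s (Suc l) - s l) * normal_increment s l \<omega>))"
    unfolding quad_def scale_mat_def by (intro sum.cong refl) (simp only: mult_ac)
  also have "\<dots> = step_integral B m s a \<omega>"
    unfolding step_integral_def by (intro sum.cong refl) (simp only: * lessThan_iff)
  finally show "step_integral B m s a \<omega> = quad (scale_mat s a) \<omega>" by simp
qed

end

definition sym_step :: "nat \<Rightarrow> (nat \<Rightarrow> real) \<Rightarrow> (nat \<Rightarrow> nat \<Rightarrow> real) \<Rightarrow> bool" where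
  "sym_step m s a \<longleftrightarrow> off_diagonal_step m s a \<and> symmetric_mat m a"

lemma sym_step_grid: "sym_step m s a \<Longrightarrow> grid m s"
  by (auto simp: sym_step_def off_diagonal_step_iff)

lemma sym_step_refine:
  "sym_step m s a \<Longrightarrow> grid n t \<Longrightarrow> sym_step n t (refine_coeff m s a t)"
  by (simp add: sym_step_def off_diagonal_step_iff refine_coeff_diag refine_coeff_symmetric)

lemma sym_step_scale_mat:
  assumes "sym_step m s a"
  shows "symmetric_mat m (scale_mat s a)" "k < m \<Longrightarrow> scale_mat s a k k = 0"
  using assms by (auto simp: sym_step_def off_diagonal_step_iff symmetric_mat_def scale_mat_def)

locale brownian_steps = brownian +
  fixes m s a b
  assumes ss: "sym_step m s a" "sym_step m s b"
begin

lemma s: "grid m s" using ss by (simp add: sym_step_grid)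

sublocale G: zero_diag_pair M m "normal_increment s" "scale_mat s a" "scale_mat s b"
proof -
  interpret gaussian_vector M m "normal_increment s" by (rule gaussian_increments[OF s])
  show "zero_diag_pair M m (normal_increment s) (scale_mat s a) (scale_mat s b)"
    by unfold_locales (use ss sym_step_scale_mat in auto)
qed

lemma step_integral_moments:
  shows "(\<integral>\<omega>. step_integral B m s a \<omega> * step_integral B m s b \<omega> \<partial>M) =
      2 * (\<integral>p. step_function m s a p * step_function m s b p \<partial>lborel)"
    and "(\<integral>\<omega>. (step_integral B m s a \<omega>)\<^sup>2 * step_integral B m s b \<omega> \<partial>M) =
      8 * (\<integral>p. kgram (step_function m s a) (step_function m s a) p * step_function m s b p \<partial>lborel)"
    and "(\<integral>\<omega>. (step_integral B m s a \<omega>)\<^sup>2 * (step_integral B m s b \<omega>)\<^sup>2 \<partial>M) =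
      4 * (\<integral>p. step_function m s a p * step_function m s a p \<partial>lborel)
        * (\<integral>p. step_function m s b p * step_function m s b p \<partial>lborel)
      + 8 * (\<integral>p. step_function m s a p * step_function m s b p \<partial>lborel)\<^sup>2
      + 16 * (\<integral>p. kgram (step_function m s a) (step_function m s a) p * kgram (step_function m s b) (step_function m s b) p \<partial>lborel)
      + 16 * (\<integral>p. kgram (step_function m s a) (step_function m s b) p * kgram (step_function m s a) (step_function m s b) p \<partial>lborel)
      + 16 * (\<integral>p. kgram (step_function m s a) (step_function m s b) p * kgram (step_function m s b) (step_function m s a) p \<partial>lborel)"
  unfolding step_integral_quad[OF s]
  by (simp_all only: G.quad_moment2 G.quad_moment3 G.quad_moment4 frob_scale_mat[OF s] gram_scale_mat[OF s] kgram_step_function[OF s])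

end

lemma (in brownian) step_integral_L2:
  assumes "sym_step m s a"
  shows "L2 M (step_integral B m s a)" "L2 M (\<lambda>\<omega>. (step_integral B m s a \<omega>)\<^sup>2)"
    "(\<integral>\<omega>. (step_integral B m s a \<omega>) ^ 4 \<partial>M) \<le> 15 * (\<integral>\<omega>. (step_integral B m s a \<omega>)\<^sup>2 \<partial>M)\<^sup>2"
proof -
  note s = sym_step_grid[OF assms]
  interpret gaussian_vector M m "normal_increment s" by (rule gaussian_increments[OF s])
  note A = sym_step_scale_mat[OF assms]
  have "integrable M (\<lambda>\<omega>. (quad (scale_mat s a) \<omega>)\<^sup>2)"
    using quad_expectation2(1)[OF A(1), of "scale_mat s a"] by (simp add: power2_eq_square)
  then show "L2 M (step_integral B m s a)"
    unfolding step_integral_quad[OF s] L2_def using quad_expectation(1)[of "scale_mat s a"]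
    by auto
  have "integrable M (\<lambda>\<omega>. (quad (scale_mat s a) \<omega>) ^ 4)" by (rule quad_hypercontractive(2)[OF A])
  then show "L2 M (\<lambda>\<omega>. (step_integral B m s a \<omega>)\<^sup>2)"
    unfolding step_integral_quad[OF s] L2_def using quad_expectation(1)[of "scale_mat s a"]
    by (auto simp flip: power_mult)
  show "(\<integral>\<omega>. (step_integral B m s a \<omega>) ^ 4 \<partial>M) \<le> 15 * (\<integral>\<omega>. (step_integral B m s a \<omega>)\<^sup>2 \<partial>M)\<^sup>2"
    unfolding step_integral_quad[OF s] by (rule quad_hypercontractive(1)[OF A])
qed

text \<open>Symmetric approximations suffice because a step integral depends only on the symmetrized
  coefficients, and the quadrant may be replaced by the plane because the kernels vanish off it.\<close>

definition wiener2 :: "'a measure \<Rightarrow> (real \<Rightarrow> 'a \<Rightarrow> real) \<Rightarrow> (real \<times> real \<Rightarrow> real) \<Rightarrow> ('a \<Rightarrow> real) \<Rightarrow> bool" where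
  "wiener2 M B f Y \<longleftrightarrow> (\<exists>m s a. (\<forall>r. sym_step (m r) (s r) (a r)) \<and>
     L2_tendsto lborel (\<lambda>r. step_function (m r) (s r) (a r)) f \<and>
     L2_tendsto M (\<lambda>r. step_integral B (m r) (s r) (a r)) Y)"

lemma wiener2I:
  assumes "\<And>r. sym_step (m r) (s r) (a r)"
    "L2_tendsto lborel (\<lambda>r. step_function (m r) (s r) (a r)) f"
    "L2_tendsto M (\<lambda>r. step_integral B (m r) (s r) (a r)) Y"
  shows "wiener2 M B f Y"
  unfolding wiener2_def using assms by (intro exI[of _ m] exI[of _ s] exI[of _ a]) simp

lemma wiener2_L2: "wiener2 M B f Y \<Longrightarrow> L2 lborel f" "wiener2 M B f Y \<Longrightarrow> L2 M Y"
  by (auto simp: wiener2_def L2_tendsto_def)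

text \<open>Joint moments are computed from quadratic forms in one and the same Gaussian vector.
  Both integrals must therefore be approximated on a common grid at each stage
  \<open>r\<close>.\<close>

definition joint_approx where
  "joint_approx M B f Y g Z m s a b \<longleftrightarrow>
    (\<forall>r. sym_step (m r) (s r) (a r) \<and> sym_step (m r) (s r) (b r)) \<and>
    L2_tendsto lborel (\<lambda>r. step_function (m r) (s r) (a r)) f \<and>
    L2_tendsto M (\<lambda>r. step_integral B (m r) (s r) (a r)) Y \<and>
    L2_tendsto lborel (\<lambda>r. step_function (m r) (s r) (b r)) g \<and>
    L2_tendsto M (\<lambda>r. step_integral B (m r) (s r) (b r)) Z"

lemma joint_approxD:
  assumes "joint_approx M B f Y g Z m s a b"
  shows "sym_step (m r) (s r) (a r)" "sym_step (m r) (s r) (b r)"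
    "L2_tendsto lborel (\<lambda>r. step_function (m r) (s r) (a r)) f"
    "L2_tendsto M (\<lambda>r. step_integral B (m r) (s r) (a r)) Y"
    "L2_tendsto lborel (\<lambda>r. step_function (m r) (s r) (b r)) g"
    "L2_tendsto M (\<lambda>r. step_integral B (m r) (s r) (b r)) Z"
  using assms by (simp_all add: joint_approx_def)

lemma wiener2_joint:
  assumes "wiener2 M B f Y" "wiener2 M B g Z"
  shows "\<exists>m s a b. joint_approx M B f Y g Z m s a b"
proof -
  obtain m s a where a: "\<And>r. sym_step (m r) (s r) (a r)"
     "L2_tendsto lborel (\<lambda>r. step_function (m r) (s r) (a r)) f"
     "L2_tendsto M (\<lambda>r. step_integral B (m r) (s r) (a r)) Y"
    using assms(1) by (auto simp: wiener2_def)
  obtain m' s' b where b: "\<And>r. sym_step (m' r) (s' r) (b r)"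
     "L2_tendsto lborel (\<lambda>r. step_function (m' r) (s' r) (b r)) g"
     "L2_tendsto M (\<lambda>r. step_integral B (m' r) (s' r) (b r)) Z"
    using assms(2) by (auto simp: wiener2_def)
  have "\<forall>r. \<exists>n t. grid n t \<and> s r ` {..m r} \<subseteq> t ` {..n} \<and> s' r ` {..m' r} \<subseteq> t ` {..n}"
    using grid_refine sym_step_grid[OF a(1)] sym_step_grid[OF b(1)] by blast
  then obtain n t where nt: "\<And>r. grid (n r) (t r)" "\<And>r. s r ` {..m r} \<subseteq> t r ` {..n r}"
    "\<And>r. s' r ` {..m' r} \<subseteq> t r ` {..n r}" by metis
  have "joint_approx M B f Y g Z n t (\<lambda>r. refine_coeff (m r) (s r) (a r) (t r)) (\<lambda>r. refine_coeff (m' r) (s' r) (b r) (t r))"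
    unfolding joint_approx_def using a b nt
    by (simp add: sym_step_refine step_function_refine[OF sym_step_grid[OF a(1)] nt(1,2)]
      step_function_refine[OF sym_step_grid[OF b(1)] nt(1,3)]
      step_integral_refine[OF sym_step_grid[OF a(1)] nt(1,2)]
      step_integral_refine[OF sym_step_grid[OF b(1)] nt(1,3)])
  then show ?thesis by blast
qed

lemma step_function_add: "step_function m s (\<lambda>k l. a k l + b k l) p = step_function m s a p + step_function m s b p"
  by (simp add: step_function_def sum.distrib distrib_right)

lemma step_function_cmult: "step_function m s (\<lambda>k l. c * a k l) p = c * step_function m s a p"
  unfolding step_function_def sum_distrib_left by (intro sum.cong refl) simp

lemma step_integral_add: "step_integral B m s (\<lambda>k l. a k l + b k l) \<omega> = step_integral B m s a \<omega> + step_integral B m s b \<omega>"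
  by (simp add: step_integral_def sum.distrib distrib_right)

lemma step_integral_cmult: "step_integral B m s (\<lambda>k l. c * a k l) \<omega> = c * step_integral B m s a \<omega>"
  unfolding step_integral_def sum_distrib_left by (intro sum.cong refl) simp

lemma sym_step_add: "sym_step m s a \<Longrightarrow> sym_step m s b \<Longrightarrow> sym_step m s (\<lambda>k l. a k l + b k l)"
  by (auto simp: sym_step_def off_diagonal_step_iff symmetric_mat_def)

lemma sym_step_cmult: "sym_step m s a \<Longrightarrow> sym_step m s (\<lambda>k l. c * a k l)"
  by (auto simp: sym_step_def off_diagonal_step_iff symmetric_mat_def)

lemma wiener2_cmult:
  assumes "wiener2 M B f Y"
  shows "wiener2 M B (\<lambda>p. c * f p) (\<lambda>\<omega>. c * Y \<omega>)"
proof -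
  obtain m s a where a: "\<And>r. sym_step (m r) (s r) (a r)"
     "L2_tendsto lborel (\<lambda>r. step_function (m r) (s r) (a r)) f"
     "L2_tendsto M (\<lambda>r. step_integral B (m r) (s r) (a r)) Y"
    using assms by (auto simp: wiener2_def)
  have "sym_step (m r) (s r) (\<lambda>k l. c * a r k l)" for r by (simp add: sym_step_cmult a(1))
  moreover have "L2_tendsto lborel (\<lambda>r. step_function (m r) (s r) (\<lambda>k l. c * a r k l)) (\<lambda>p. c * f p)"
    using L2_tendsto_cmult[OF a(2), of c] by (simp add: step_function_cmult[abs_def])
  moreover have "L2_tendsto M (\<lambda>r. step_integral B (m r) (s r) (\<lambda>k l. c * a r k l)) (\<lambda>\<omega>. c * Y \<omega>)"
    using L2_tendsto_cmult[OF a(3), of c] by (simp add: step_integral_cmult[abs_def])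
  ultimately show ?thesis by (rule wiener2I)
qed

lemma wiener2_add:
  assumes "wiener2 M B f Y" "wiener2 M B g Z"
  shows "wiener2 M B (\<lambda>p. f p + g p) (\<lambda>\<omega>. Y \<omega> + Z \<omega>)"
proof -
  obtain m s a b where "joint_approx M B f Y g Z m s a b"
    using wiener2_joint[OF assms] by blast
  note a = joint_approxD[OF this]
  have "sym_step (m r) (s r) (\<lambda>k l. a r k l + b r k l)" for r by (simp add: sym_step_add a(1,2))
  moreover have "L2_tendsto lborel (\<lambda>r. step_function (m r) (s r) (\<lambda>k l. a r k l + b r k l)) (\<lambda>p. f p + g p)"
    using L2_tendsto_add[OF a(3,5)] by (simp add: step_function_add[abs_def])
  moreover have "L2_tendsto M (\<lambda>r. step_integral B (m r) (s r) (\<lambda>k l. a r k l + b r k l)) (\<lambda>\<omega>. Y \<omega> + Z \<omega>)"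
    using L2_tendsto_add[OF a(4,6)] by (simp add: step_integral_add[abs_def])
  ultimately show ?thesis by (rule wiener2I)
qed

lemma wiener2_diff:
  assumes "wiener2 M B f Y" "wiener2 M B g Z"
  shows "wiener2 M B (\<lambda>p. f p - g p) (\<lambda>\<omega>. Y \<omega> - Z \<omega>)"
  using wiener2_add[OF assms(1) wiener2_cmult[OF assms(2), of "-1"]] by simp

lemma wiener2_cong_AE:
  assumes "wiener2 M B f Y" "g \<in> borel_measurable lborel" "AE p in lborel. f p = g p"
  shows "wiener2 M B g Y"
proof -
  obtain m s a where a: "\<And>r. sym_step (m r) (s r) (a r)"
     "L2_tendsto lborel (\<lambda>r. step_function (m r) (s r) (a r)) f"
     "L2_tendsto M (\<lambda>r. step_integral B (m r) (s r) (a r)) Y"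
    using assms(1) by (auto simp: wiener2_def)
  have L: "L2 lborel f" "L2 lborel (step_function (m r) (s r) (a r))" for r
    using a by (auto simp: L2_tendsto_def)
  have "(\<integral>p. (step_function (m r) (s r) (a r) p - f p)\<^sup>2 \<partial>lborel) = (\<integral>p. (step_function (m r) (s r) (a r) p - g p)\<^sup>2 \<partial>lborel)" for r
    using L assms by (intro integral_cong_AE borel_measurable_power borel_measurable_diff) (auto simp: L2_def)
  then have "L2_tendsto lborel (\<lambda>r. step_function (m r) (s r) (a r)) g"
    using a(2) L2_cong_AE[OF L(1) assms(2,3)] by (auto simp: L2_tendsto_def)
  then show ?thesis by (intro wiener2I[OF a(1) _ a(3)])
qed

context brownian
begin

lemma wiener2_step: "sym_step m s a \<Longrightarrow> wiener2 M B (step_function m s a) (step_integral B m s a)"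
  unfolding wiener2_def
  by (rule exI[of _ "\<lambda>_. m"], rule exI[of _ "\<lambda>_. s"], rule exI[of _ "\<lambda>_. a"])
     (auto intro!: L2_tendsto_const step_function_L2 step_integral_L2 sym_step_grid)

lemma wiener2_covariance:
  assumes "wiener2 M B f Y" "wiener2 M B g Z"
  shows "(\<integral>\<omega>. Y \<omega> * Z \<omega> \<partial>M) = 2 * (\<integral>p. f p * g p \<partial>lborel)"
proof -
  obtain m s a b where "joint_approx M B f Y g Z m s a b"
    using wiener2_joint[OF assms] by blast
  note a = joint_approxD[OF this]
  have "(\<lambda>r. \<integral>\<omega>. step_integral B (m r) (s r) (a r) \<omega> * step_integral B (m r) (s r) (b r) \<omega> \<partial>M)
      \<longlonglongrightarrow> (\<integral>\<omega>. Y \<omega> * Z \<omega> \<partial>M)"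
    by (intro L2_tendsto_integral_mult a)
  moreover have "(\<integral>\<omega>. step_integral B (m r) (s r) (a r) \<omega> * step_integral B (m r) (s r) (b r) \<omega> \<partial>M) =
     2 * (\<integral>p. step_function (m r) (s r) (a r) p * step_function (m r) (s r) (b r) p \<partial>lborel)" for r
  proof -
    interpret brownian_steps M B "m r" "s r" "a r" "b r" by unfold_locales (rule a)+
    show ?thesis by (rule step_integral_moments)
  qed
  moreover have "(\<lambda>r. 2 * (\<integral>p. step_function (m r) (s r) (a r) p * step_function (m r) (s r) (b r) p \<partial>lborel))
      \<longlonglongrightarrow> 2 * (\<integral>p. f p * g p \<partial>lborel)"
    by (intro tendsto_intros L2_tendsto_integral_mult a)
  ultimately show ?thesis by (simp only: LIMSEQ_unique)
qed

text \<open>As a mean-square limit \<open>Y\<close> has no fourth moment in advance. Fatou's lemma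
  along an almost surely convergent subsequence transfers the bound for step integrals, whose second
  moments converge.\<close>

lemma wiener2_hypercontractive:
  assumes "wiener2 M B f Y"
  shows "L2 M (\<lambda>\<omega>. (Y \<omega>)\<^sup>2)" "(\<integral>\<omega>. (Y \<omega>) ^ 4 \<partial>M) \<le> 15 * (\<integral>\<omega>. (Y \<omega>)\<^sup>2 \<partial>M)\<^sup>2"
proof -
  obtain m s a where a: "\<And>r. sym_step (m r) (s r) (a r)"
     "L2_tendsto M (\<lambda>r. step_integral B (m r) (s r) (a r)) Y"
    using assms by (auto simp: wiener2_def)
  define S where "S r = step_integral B (m r) (s r) (a r)" for r
  have S: "L2_tendsto M S Y" using a(2) by (simp add: S_def[abs_def])
  have LS: "L2 M (S r)" "L2 M (\<lambda>\<omega>. (S r \<omega>)\<^sup>2)" "(\<integral>\<omega>. (S r \<omega>) ^ 4 \<partial>M) \<le> 15 * (\<integral>\<omega>. (S r \<omega>)\<^sup>2 \<partial>M)\<^sup>2" for r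
    unfolding S_def by (rule step_integral_L2[OF a(1)])+
  have [measurable]: "S r \<in> borel_measurable M" "Y \<in> borel_measurable M" for r
    using LS(1) S by (auto simp: L2_def L2_tendsto_def)
  obtain \<phi> where \<phi>: "strict_mono \<phi>" "AE \<omega> in M. (\<lambda>r. S (\<phi> r) \<omega>) \<longlonglongrightarrow> Y \<omega>"
    using L2_tendsto_subseq_AE[OF S] by blast
  have "(\<integral>\<^sup>+\<omega>. ennreal ((Y \<omega>) ^ 4) \<partial>M) = (\<integral>\<^sup>+\<omega>. liminf (\<lambda>r. ennreal ((S (\<phi> r) \<omega>) ^ 4)) \<partial>M)"
  proof (intro nn_integral_cong_AE, use \<phi>(2) in eventually_elim)
    fix \<omega> assume "(\<lambda>r. S (\<phi> r) \<omega>) \<longlonglongrightarrow> Y \<omega>"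
    then have "(\<lambda>r. ennreal ((S (\<phi> r) \<omega>) ^ 4)) \<longlonglongrightarrow> ennreal ((Y \<omega>) ^ 4)"
      by (intro tendsto_ennrealI tendsto_intros)
    then show "ennreal ((Y \<omega>) ^ 4) = liminf (\<lambda>r. ennreal ((S (\<phi> r) \<omega>) ^ 4))"
      by (rule lim_imp_Liminf[OF sequentially_bot, symmetric])
  qed
  also have "\<dots> \<le> liminf (\<lambda>r. \<integral>\<^sup>+\<omega>. ennreal ((S (\<phi> r) \<omega>) ^ 4) \<partial>M)"
    by (intro nn_integral_liminf) measurable
  also have "\<dots> \<le> liminf (\<lambda>r. ennreal (15 * (\<integral>\<omega>. (S (\<phi> r) \<omega>)\<^sup>2 \<partial>M)\<^sup>2))"
  proof (intro Liminf_mono always_eventually allI)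
    fix r
    have "integrable M (\<lambda>\<omega>. (S (\<phi> r) \<omega>) ^ 4)"
      using LS(2)[of "\<phi> r"] by (simp add: L2_def flip: power_mult)
    then have "(\<integral>\<^sup>+\<omega>. ennreal ((S (\<phi> r) \<omega>) ^ 4) \<partial>M) = ennreal (\<integral>\<omega>. (S (\<phi> r) \<omega>) ^ 4 \<partial>M)"
      by (intro nn_integral_eq_integral) auto
    also have "\<dots> \<le> ennreal (15 * (\<integral>\<omega>. (S (\<phi> r) \<omega>)\<^sup>2 \<partial>M)\<^sup>2)"
      by (intro ennreal_leI LS)
    finally show "(\<integral>\<^sup>+\<omega>. ennreal ((S (\<phi> r) \<omega>) ^ 4) \<partial>M) \<le> ennreal (15 * (\<integral>\<omega>. (S (\<phi> r) \<omega>)\<^sup>2 \<partial>M)\<^sup>2)" .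
  qed
  also have "\<dots> = ennreal (15 * (\<integral>\<omega>. (Y \<omega>)\<^sup>2 \<partial>M)\<^sup>2)"
  proof -
    have "(\<lambda>r. \<integral>\<omega>. S r \<omega> * S r \<omega> \<partial>M) \<longlonglongrightarrow> (\<integral>\<omega>. Y \<omega> * Y \<omega> \<partial>M)"
      by (intro L2_tendsto_integral_mult S)
    from LIMSEQ_subseq_LIMSEQ[OF this \<phi>(1)]
    have "(\<lambda>r. \<integral>\<omega>. (S (\<phi> r) \<omega>)\<^sup>2 \<partial>M) \<longlonglongrightarrow> (\<integral>\<omega>. (Y \<omega>)\<^sup>2 \<partial>M)"
      by (simp add: power2_eq_square o_def)
    then have "(\<lambda>r. ennreal (15 * (\<integral>\<omega>. (S (\<phi> r) \<omega>)\<^sup>2 \<partial>M)\<^sup>2)) \<longlonglongrightarrow> ennreal (15 * (\<integral>\<omega>. (Y \<omega>)\<^sup>2 \<partial>M)\<^sup>2)"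
      by (intro tendsto_ennrealI tendsto_intros)
    then show ?thesis by (rule lim_imp_Liminf[OF sequentially_bot])
  qed
  finally have *: "(\<integral>\<^sup>+\<omega>. ennreal ((Y \<omega>) ^ 4) \<partial>M) \<le> ennreal (15 * (\<integral>\<omega>. (Y \<omega>)\<^sup>2 \<partial>M)\<^sup>2)" .
  then have i: "integrable M (\<lambda>\<omega>. (Y \<omega>) ^ 4)"
    by (auto simp: integrable_iff_bounded intro: le_less_trans)
  then show "L2 M (\<lambda>\<omega>. (Y \<omega>)\<^sup>2)" by (simp add: L2_def flip: power_mult)
  have "ennreal (\<integral>\<omega>. (Y \<omega>) ^ 4 \<partial>M) \<le> ennreal (15 * (\<integral>\<omega>. (Y \<omega>)\<^sup>2 \<partial>M)\<^sup>2)"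
    using * i by (simp add: nn_integral_eq_integral)
  then show "(\<integral>\<omega>. (Y \<omega>) ^ 4 \<partial>M) \<le> 15 * (\<integral>\<omega>. (Y \<omega>)\<^sup>2 \<partial>M)\<^sup>2"
    by (subst (asm) ennreal_le_iff) auto
qed

text \<open>The difference of squares is the product of \<open>S r - Y\<close> and
  \<open>S r + Y\<close>, both double integrals. Cauchy-Schwarz and the fourth moment bound reduce
  its mean square to a product of second moments, one of which tends to 0.\<close>

lemma wiener2_square_tendsto:
  assumes "\<And>r. wiener2 M B (f r) (S r)" "wiener2 M B g Y" "L2_tendsto M S Y"
  shows "L2_tendsto M (\<lambda>r \<omega>. (S r \<omega>)\<^sup>2) (\<lambda>\<omega>. (Y \<omega>)\<^sup>2)"
proof -
  have L: "L2 M (S r)" "L2 M Y" for r using assms(3) by (auto simp: L2_tendsto_def)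
  define U where "U r = (\<integral>\<omega>. (S r \<omega> - Y \<omega>)\<^sup>2 \<partial>M)" for r
  define V where "V r = (\<integral>\<omega>. (S r \<omega> + Y \<omega>)\<^sup>2 \<partial>M)" for r
  have nn: "0 \<le> U r" "0 \<le> V r" for r by (auto simp: U_def V_def)
  have "(\<integral>\<omega>. ((S r \<omega>)\<^sup>2 - (Y \<omega>)\<^sup>2)\<^sup>2 \<partial>M) \<le> 15 * U r * V r" for r
  proof -
    note D = wiener2_hypercontractive[OF wiener2_diff[OF assms(1)[of r] assms(2)]]
      and P = wiener2_hypercontractive[OF wiener2_add[OF assms(1)[of r] assms(2)]]
    have "(\<integral>\<omega>. ((S r \<omega>)\<^sup>2 - (Y \<omega>)\<^sup>2)\<^sup>2 \<partial>M) = (\<integral>\<omega>. (S r \<omega> - Y \<omega>)\<^sup>2 * (S r \<omega> + Y \<omega>)\<^sup>2 \<partial>M)"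
      by (simp add: power_mult_distrib[symmetric] algebra_simps power2_eq_square)
    also have "\<dots> \<le> sqrt (\<integral>\<omega>. ((S r \<omega> - Y \<omega>)\<^sup>2)\<^sup>2 \<partial>M) * sqrt (\<integral>\<omega>. ((S r \<omega> + Y \<omega>)\<^sup>2)\<^sup>2 \<partial>M)"
      using abs_integral_mult_L2_le[OF D(1) P(1)] by linarith
    also have "\<dots> \<le> sqrt (15 * (U r)\<^sup>2) * sqrt (15 * (V r)\<^sup>2)"
      using D(2) P(2) by (intro mult_mono real_sqrt_le_mono) (auto simp: U_def V_def simp flip: power_mult)
    also have "\<dots> = 15 * U r * V r" using nn by (simp add: real_sqrt_mult)
    finally show ?thesis .
  qed
  moreover have "V r \<le> 2 * (\<integral>\<omega>. (S r \<omega>)\<^sup>2 \<partial>M) + 2 * (\<integral>\<omega>. (Y \<omega>)\<^sup>2 \<partial>M)" for r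
    unfolding V_def by (rule integral_square_add_le[OF L])
  ultimately have le: "(\<integral>\<omega>. ((S r \<omega>)\<^sup>2 - (Y \<omega>)\<^sup>2)\<^sup>2 \<partial>M) \<le>
      15 * U r * (2 * (\<integral>\<omega>. (S r \<omega>)\<^sup>2 \<partial>M) + 2 * (\<integral>\<omega>. (Y \<omega>)\<^sup>2 \<partial>M))" for r
  proof -
    fix r
    assume 1: "\<And>r. (\<integral>\<omega>. ((S r \<omega>)\<^sup>2 - (Y \<omega>)\<^sup>2)\<^sup>2 \<partial>M) \<le> 15 * U r * V r"
      and 2: "\<And>r. V r \<le> 2 * (\<integral>\<omega>. (S r \<omega>)\<^sup>2 \<partial>M) + 2 * (\<integral>\<omega>. (Y \<omega>)\<^sup>2 \<partial>M)"
    show "(\<integral>\<omega>. ((S r \<omega>)\<^sup>2 - (Y \<omega>)\<^sup>2)\<^sup>2 \<partial>M) \<le>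
      15 * U r * (2 * (\<integral>\<omega>. (S r \<omega>)\<^sup>2 \<partial>M) + 2 * (\<integral>\<omega>. (Y \<omega>)\<^sup>2 \<partial>M))"
      by (rule order_trans[OF 1 mult_left_mono[OF 2]]) (simp add: nn)
  qed
  have "(\<lambda>r. \<integral>\<omega>. (S r \<omega>)\<^sup>2 \<partial>M) \<longlonglongrightarrow> (\<integral>\<omega>. (Y \<omega>)\<^sup>2 \<partial>M)"
    using L2_tendsto_integral_mult[OF assms(3) assms(3)] by (simp add: power2_eq_square)
  moreover have "U \<longlonglongrightarrow> 0" using assms(3) by (simp add: U_def[abs_def] L2_tendsto_def)
  ultimately have "(\<lambda>r. 15 * U r * (2 * (\<integral>\<omega>. (S r \<omega>)\<^sup>2 \<partial>M) + 2 * (\<integral>\<omega>. (Y \<omega>)\<^sup>2 \<partial>M))) \<longlonglongrightarrow>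
      15 * 0 * (2 * (\<integral>\<omega>. (Y \<omega>)\<^sup>2 \<partial>M) + 2 * (\<integral>\<omega>. (Y \<omega>)\<^sup>2 \<partial>M))"
    by (intro tendsto_intros)
  then have "(\<lambda>r. \<integral>\<omega>. ((S r \<omega>)\<^sup>2 - (Y \<omega>)\<^sup>2)\<^sup>2 \<partial>M) \<longlonglongrightarrow> 0"
    by (elim Lim_null_comparison[rotated, OF tendsto_eq_rhs]) (auto intro!: always_eventually le)
  then show ?thesis
    using wiener2_hypercontractive(1)[OF assms(1)] wiener2_hypercontractive(1)[OF assms(2)]
    by (simp add: L2_tendsto_def)
qed

lemma wiener2_moments:
  assumes "wiener2 M B f Y" "wiener2 M B g Z"
  shows "(\<integral>\<omega>. (Y \<omega>)\<^sup>2 * Z \<omega> \<partial>M) = 8 * (\<integral>p. kgram f f p * g p \<partial>lborel)" (is ?three)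
    and "(\<integral>\<omega>. (Y \<omega>)\<^sup>2 * (Z \<omega>)\<^sup>2 \<partial>M) = 4 * (\<integral>p. f p * f p \<partial>lborel) * (\<integral>p. g p * g p \<partial>lborel)
      + 8 * (\<integral>p. f p * g p \<partial>lborel)\<^sup>2 + 16 * (\<integral>p. kgram f f p * kgram g g p \<partial>lborel)
      + 16 * (\<integral>p. kgram f g p * kgram f g p \<partial>lborel) + 16 * (\<integral>p. kgram f g p * kgram g f p \<partial>lborel)" (is ?four)
proof -
  obtain m s a b where "joint_approx M B f Y g Z m s a b"
    using wiener2_joint[OF assms] by blast
  note a = joint_approxD[OF this]
  define S T F G where STFG: "S r = step_integral B (m r) (s r) (a r)" "T r = step_integral B (m r) (s r) (b r)"
    "F r = step_function (m r) (s r) (a r)" "G r = step_function (m r) (s r) (b r)" for r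
  have lim: "L2_tendsto M S Y" "L2_tendsto M T Z" "L2_tendsto lborel F f" "L2_tendsto lborel G g"
    using a by (simp_all add: STFG[abs_def])
  have w: "wiener2 M B (F r) (S r)" "wiener2 M B (G r) (T r)" for r
    unfolding STFG by (intro wiener2_step a)+
  have lim2: "L2_tendsto M (\<lambda>r \<omega>. (S r \<omega>)\<^sup>2) (\<lambda>\<omega>. (Y \<omega>)\<^sup>2)" "L2_tendsto M (\<lambda>r \<omega>. (T r \<omega>)\<^sup>2) (\<lambda>\<omega>. (Z \<omega>)\<^sup>2)"
    by (rule wiener2_square_tendsto[OF w(1) assms(1) lim(1)], rule wiener2_square_tendsto[OF w(2) assms(2) lim(2)])
  have M: "(\<integral>\<omega>. (S r \<omega>)\<^sup>2 * T r \<omega> \<partial>M) = 8 * (\<integral>p. kgram (F r) (F r) p * G r p \<partial>lborel)"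
    "(\<integral>\<omega>. (S r \<omega>)\<^sup>2 * (T r \<omega>)\<^sup>2 \<partial>M) = 4 * (\<integral>p. F r p * F r p \<partial>lborel) * (\<integral>p. G r p * G r p \<partial>lborel)
      + 8 * (\<integral>p. F r p * G r p \<partial>lborel)\<^sup>2 + 16 * (\<integral>p. kgram (F r) (F r) p * kgram (G r) (G r) p \<partial>lborel)
      + 16 * (\<integral>p. kgram (F r) (G r) p * kgram (F r) (G r) p \<partial>lborel)
      + 16 * (\<integral>p. kgram (F r) (G r) p * kgram (G r) (F r) p \<partial>lborel)" for r
  proof -
    interpret brownian_steps M B "m r" "s r" "a r" "b r" by unfold_locales (rule a)+
    show "(\<integral>\<omega>. (S r \<omega>)\<^sup>2 * T r \<omega> \<partial>M) = 8 * (\<integral>p. kgram (F r) (F r) p * G r p \<partial>lborel)"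
    "(\<integral>\<omega>. (S r \<omega>)\<^sup>2 * (T r \<omega>)\<^sup>2 \<partial>M) = 4 * (\<integral>p. F r p * F r p \<partial>lborel) * (\<integral>p. G r p * G r p \<partial>lborel)
      + 8 * (\<integral>p. F r p * G r p \<partial>lborel)\<^sup>2 + 16 * (\<integral>p. kgram (F r) (F r) p * kgram (G r) (G r) p \<partial>lborel)
      + 16 * (\<integral>p. kgram (F r) (G r) p * kgram (F r) (G r) p \<partial>lborel)
      + 16 * (\<integral>p. kgram (F r) (G r) p * kgram (G r) (F r) p \<partial>lborel)"
      unfolding STFG by (rule step_integral_moments)+
  qed
  have "(\<lambda>r. \<integral>\<omega>. (S r \<omega>)\<^sup>2 * T r \<omega> \<partial>M) \<longlonglongrightarrow> (\<integral>\<omega>. (Y \<omega>)\<^sup>2 * Z \<omega> \<partial>M)"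
    by (intro L2_tendsto_integral_mult lim lim2)
  moreover have "(\<lambda>r. \<integral>\<omega>. (S r \<omega>)\<^sup>2 * T r \<omega> \<partial>M) \<longlonglongrightarrow> 8 * (\<integral>p. kgram f f p * g p \<partial>lborel)"
    unfolding M by (intro tendsto_intros L2_tendsto_integral_mult lim L2_tendsto_kgram)
  ultimately show ?three by (rule LIMSEQ_unique)
  have "(\<lambda>r. \<integral>\<omega>. (S r \<omega>)\<^sup>2 * (T r \<omega>)\<^sup>2 \<partial>M) \<longlonglongrightarrow> (\<integral>\<omega>. (Y \<omega>)\<^sup>2 * (Z \<omega>)\<^sup>2 \<partial>M)"
    by (intro L2_tendsto_integral_mult lim2)
  moreover have "(\<lambda>r. \<integral>\<omega>. (S r \<omega>)\<^sup>2 * (T r \<omega>)\<^sup>2 \<partial>M) \<longlonglongrightarrow>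
      4 * (\<integral>p. f p * f p \<partial>lborel) * (\<integral>p. g p * g p \<partial>lborel)
      + 8 * (\<integral>p. f p * g p \<partial>lborel)\<^sup>2 + 16 * (\<integral>p. kgram f f p * kgram g g p \<partial>lborel)
      + 16 * (\<integral>p. kgram f g p * kgram f g p \<partial>lborel) + 16 * (\<integral>p. kgram f g p * kgram g f p \<partial>lborel)"
    unfolding M by (intro tendsto_intros L2_tendsto_integral_mult lim L2_tendsto_kgram)
  ultimately show ?four by (rule LIMSEQ_unique)
qed

text \<open>By the isometry, any integrals of kernels converging to \<open>f\<close> converge to
  \<open>Y\<close>, not just those of the sequence hidden in \<open>wiener2\<close>. The scaling
  argument relies on this freedom of choice.\<close>

lemma wiener2_tendsto:
  assumes Y: "wiener2 M B f Y" and S: "\<And>r. wiener2 M B (F r) (S r)" and F: "L2_tendsto lborel F f"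
  shows "L2_tendsto M S Y"
proof -
  have "(\<integral>\<omega>. (S r \<omega> - Y \<omega>)\<^sup>2 \<partial>M) = 2 * (\<integral>p. (F r p - f p)\<^sup>2 \<partial>lborel)" for r
    using wiener2_covariance[OF wiener2_diff[OF S[of r] Y] wiener2_diff[OF S[of r] Y]]
    by (simp add: power2_eq_square)
  then have "(\<lambda>r. \<integral>\<omega>. (S r \<omega> - Y \<omega>)\<^sup>2 \<partial>M) \<longlonglongrightarrow> 0"
    using F by (auto simp: L2_tendsto_def intro: tendsto_mult_right_zero)
  then show ?thesis using wiener2_L2(2)[OF Y] wiener2_L2(2)[OF S] by (simp add: L2_tendsto_def)
qed

lemma has_double_wiener_integral_wiener2:
  assumes I: "has_double_wiener_integral M B f Y"
    and sym: "\<And>x y. f (x, y) = f (y, x)" and supp: "\<And>x y. x < 0 \<Longrightarrow> f (x, y) = 0"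
  shows "wiener2 M B f Y"
proof -
  obtain m s a where a: "\<And>r. off_diagonal_step (m r) (s r) (a r)"
    "(\<lambda>r. \<integral>\<^sup>+y\<in>{0..} \<times> {0..}. ennreal ((step_function (m r) (s r) (a r) y - f y)\<^sup>2) \<partial>lborel) \<longlonglongrightarrow> 0"
    "(\<lambda>r. \<integral>\<^sup>+\<omega>. ennreal ((step_integral B (m r) (s r) (a r) \<omega> - Y \<omega>)\<^sup>2) \<partial>M) \<longlonglongrightarrow> 0"
    and fm: "f \<in> borel_measurable lborel" and Ym: "Y \<in> borel_measurable M"
    using I by (auto simp: has_double_wiener_integral_def)
  have g: "grid (m r) (s r)" for r using a(1) by (simp add: off_diagonal_step_iff)
  have block0: "block (s r) k x = 0" if "x < 0" "k < m r" for r k x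
    using that grid_nonneg[OF g[of r], of k] by (auto simp: block_def indicator_def)
  have supp': "f (x, y) = 0" if "x < 0 \<or> y < 0" for x y
    using that supp sym by metis
  have eq: "ennreal ((step_function (m r) (s r) (a r) p - f p)\<^sup>2) * indicator ({0..} \<times> {0..}) p =
      ennreal ((step_function (m r) (s r) (a r) p - f p)\<^sup>2)" for r p
  proof (cases "p \<in> {0..} \<times> {0..}")
    case False
    then have "fst p < 0 \<or> snd p < 0" by (cases p) auto
    then have "step_function (m r) (s r) (a r) p = 0"
      by (cases p) (auto simp: step_function_block block0 intro!: sum.neutral)
    moreover have "f p = 0" using \<open>fst p < 0 \<or> snd p < 0\<close> supp'[of "fst p" "snd p"] by simp
    ultimately show ?thesis by simp
  qed simp
  have lim: "L2_tendsto lborel (\<lambda>r. step_function (m r) (s r) (a r)) f"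
    using a(2) fm unfolding eq by (intro L2_tendstoI_nn step_function_L2 g)
  have sym_ss: "sym_step (m r) (s r) (symmetrize (a r))" for r
    using a(1)[of r] by (auto simp: sym_step_def off_diagonal_step_iff symmetrize_def symmetric_mat_def)
  have "(\<lambda>(x, y). f (y, x)) = f" using sym by auto
  then have "L2_tendsto lborel (\<lambda>r p. (1/2) * (step_function (m r) (s r) (a r) p +
      (case p of (x, y) \<Rightarrow> step_function (m r) (s r) (a r) (y, x)))) (\<lambda>p. (1/2) * (f p + f p))"
    using L2_tendsto_swap[OF lim] by (intro L2_tendsto_cmult L2_tendsto_add lim) auto
  also have "(\<lambda>r p. (1/2) * (step_function (m r) (s r) (a r) p +
      (case p of (x, y) \<Rightarrow> step_function (m r) (s r) (a r) (y, x)))) =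
      (\<lambda>r. step_function (m r) (s r) (symmetrize (a r)))"
    by (intro ext) (auto simp: step_function_symmetrize)
  finally have "L2_tendsto lborel (\<lambda>r. step_function (m r) (s r) (symmetrize (a r))) f" by simp
  moreover have "L2_tendsto M (\<lambda>r. step_integral B (m r) (s r) (symmetrize (a r))) Y"
    using a(3) Ym step_integral_L2(1)[OF sym_ss]
    by (intro L2_tendstoI_nn) (auto simp: step_integral_symmetrize)
  ultimately show ?thesis by (rule wiener2I[OF sym_ss])
qed

end

subsection \<open>The kernel of fractional Brownian motion\<close>

lemma nn_integral_powr_left:
  assumes "-1 < e" "p \<le> q"
  shows "(\<integral>\<^sup>+v. ennreal ((v - p) powr e) * indicator {p..q} v \<partial>lborel) = ennreal ((q - p) powr (e + 1) / (e + 1))"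
proof -
  have "(\<integral>\<^sup>+v. ennreal ((v - p) powr e) * indicator {p..q} v \<partial>lborel) =
      (\<integral>\<^sup>+x. ennreal ((p + 1 * x - p) powr e) * indicator {p..q} (p + 1 * x) \<partial>lborel)"
    by (subst nn_integral_real_affine[where c = 1 and t = p]) auto
  also have "\<dots> = (\<integral>\<^sup>+x. ennreal (x powr e) * indicator {0..q - p} x \<partial>lborel)"
    by (intro nn_integral_cong) (auto simp: indicator_def)
  also have "\<dots> = ennreal ((q - p) powr (e + 1) / (e + 1))"
    using has_integral_powr_from_0[OF assms(1), of "q - p"] assms(2)
    by (intro nn_integral_has_integral_lebesgue') auto
  finally show ?thesis .
qed

lemma nn_integral_powr_right:
  assumes "-1 < e" "p \<le> q"
  shows "(\<integral>\<^sup>+v. ennreal ((q - v) powr e) * indicator {p..q} v \<partial>lborel) = ennreal ((q - p) powr (e + 1) / (e + 1))"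
proof -
  have "(\<integral>\<^sup>+v. ennreal ((q - v) powr e) * indicator {p..q} v \<partial>lborel) =
      (\<integral>\<^sup>+x. ennreal ((q - (q + (- 1) * x)) powr e) * indicator {p..q} (q + (- 1) * x) \<partial>lborel)"
    by (subst nn_integral_real_affine[where c = "-1" and t = q]) auto
  also have "\<dots> = (\<integral>\<^sup>+x. ennreal (x powr e) * indicator {0..q - p} x \<partial>lborel)"
    by (intro nn_integral_cong) (auto simp: indicator_def)
  also have "\<dots> = ennreal ((q - p) powr (e + 1) / (e + 1))"
    using has_integral_powr_from_0[OF assms(1), of "q - p"] assms(2)
    by (intro nn_integral_has_integral_lebesgue') auto
  finally show ?thesis .
qed

lemma nn_integral_powr_abs:
  assumes "-1 < e" "p \<le> q"
  shows "(\<integral>\<^sup>+u. (\<integral>\<^sup>+v. ennreal (\<bar>u - v\<bar> powr e) * indicator {p..q} v \<partial>lborel) * indicator {p..q} u \<partial>lborel) =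
    ennreal (2 * (q - p) powr (e + 2) / ((e + 1) * (e + 2)))"
proof -
  have inner: "(\<integral>\<^sup>+v. ennreal (\<bar>u - v\<bar> powr e) * indicator {p..q} v \<partial>lborel) =
      ennreal ((u - p) powr (e + 1) / (e + 1)) + ennreal ((q - u) powr (e + 1) / (e + 1))" if "p \<le> u" "u \<le> q" for u
  proof -
    have "(\<integral>\<^sup>+v. ennreal (\<bar>u - v\<bar> powr e) * indicator {p..q} v \<partial>lborel) =
      (\<integral>\<^sup>+v. ennreal ((u - v) powr e) * indicator {p..u} v + ennreal ((v - u) powr e) * indicator {u..q} v \<partial>lborel)"
      using that by (intro nn_integral_cong) (auto simp: indicator_def)
    also have "\<dots> = (\<integral>\<^sup>+v. ennreal ((u - v) powr e) * indicator {p..u} v \<partial>lborel) +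
        (\<integral>\<^sup>+v. ennreal ((v - u) powr e) * indicator {u..q} v \<partial>lborel)"
      by (intro nn_integral_add) measurable
    finally show ?thesis using that nn_integral_powr_right[OF assms(1), of p u] nn_integral_powr_left[OF assms(1), of u q] by simp
  qed
  have "(\<integral>\<^sup>+u. (\<integral>\<^sup>+v. ennreal (\<bar>u - v\<bar> powr e) * indicator {p..q} v \<partial>lborel) * indicator {p..q} u \<partial>lborel) =
     (\<integral>\<^sup>+u. ennreal (1 / (e + 1)) * (ennreal ((u - p) powr (e + 1)) * indicator {p..q} u
        + ennreal ((q - u) powr (e + 1)) * indicator {p..q} u) \<partial>lborel)"
  proof (intro nn_integral_cong)
    fix u
    show "(\<integral>\<^sup>+v. ennreal (\<bar>u - v\<bar> powr e) * indicator {p..q} v \<partial>lborel) * indicator {p..q} u =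
      ennreal (1 / (e + 1)) * (ennreal ((u - p) powr (e + 1)) * indicator {p..q} u
        + ennreal ((q - u) powr (e + 1)) * indicator {p..q} u)"
      using assms(1) inner[of u]
      by (cases "u \<in> {p..q}") (simp_all add: distrib_left ennreal_mult[symmetric] del: ennreal_plus)
  qed
  also have "\<dots> = ennreal (1 / (e + 1)) * ((\<integral>\<^sup>+u. ennreal ((u - p) powr (e + 1)) * indicator {p..q} u \<partial>lborel)
        + (\<integral>\<^sup>+u. ennreal ((q - u) powr (e + 1)) * indicator {p..q} u \<partial>lborel))"
    by (subst nn_integral_cmult, measurable, subst nn_integral_add, measurable)
  also have "\<dots> = ennreal (1 / (e + 1)) * (ennreal ((q - p) powr (e + 2) / (e + 2)) + ennreal ((q - p) powr (e + 2) / (e + 2)))"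
    using nn_integral_powr_right[of "e + 1" p q] nn_integral_powr_left[of "e + 1" p q] assms by (simp add: add.assoc)
  also have "\<dots> = ennreal (2 * (q - p) powr (e + 2) / ((e + 1) * (e + 2)))"
    using assms(1) by (simp add: ennreal_mult[symmetric] ennreal_plus[symmetric] del: ennreal_plus)
  finally show ?thesis .
qed

text \<open>Closed form of the first partial derivative of the kernel, extended by 0 outside 0 < y <
  u so that integrals may run over the whole line.\<close>

definition fbm_deriv :: "real \<Rightarrow> real \<Rightarrow> real \<Rightarrow> real" where
  "fbm_deriv h u y = (if 0 < y \<and> y < u
     then fbm_const h * (u / y) powr (h - 1/2) * (u - y) powr (h - 3/2) else 0)"

lemma fbm_deriv_measurable[measurable]:
  "(\<lambda>(u, y). fbm_deriv h u y) \<in> borel_measurable (borel \<Otimes>\<^sub>M borel)"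
  unfolding fbm_deriv_def by measurable

lemma fbm_const_sq:
  assumes "1/2 < h" "h < 1"
  shows "0 < fbm_const h" "(fbm_const h)\<^sup>2 * Beta (2 - 2 * h) (h - 1/2) = h * (2 * h - 1)" "0 < Beta (2 - 2 * h) (h - 1/2)"
proof -
  show B: "0 < Beta (2 - 2 * h) (h - 1/2)"
    unfolding Beta_def using assms by (intro divide_pos_pos mult_pos_pos Gamma_real_pos) auto
  have p: "0 < h * (2 * h - 1) / Beta (2 - 2 * h) (h - 1/2)"
    using assms B by (intro divide_pos_pos mult_pos_pos) auto
  then show "0 < fbm_const h" by (simp add: fbm_const_def)
  show "(fbm_const h)\<^sup>2 * Beta (2 - 2 * h) (h - 1/2) = h * (2 * h - 1)"
    unfolding fbm_const_def using B p by (subst real_sqrt_pow2) auto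
qed

lemma fbm_deriv_nonneg: "1/2 < h \<Longrightarrow> h < 1 \<Longrightarrow> 0 \<le> fbm_deriv h u y"
  using fbm_const_sq(1)[of h] by (simp add: fbm_deriv_def)

text \<open>The integrand may blow up at the lower limit \<open>s\<close>, as the exponent
  \<open>h - 3/2\<close> is negative for h < 1. The integral is therefore cut at the midpoint
  \<open>m\<close> of \<open>s\<close> and \<open>u\<close>: the first piece is constant in the
  upper limit, and on the second the integrand is continuous.\<close>

lemma fbm_kernel_deriv_eq:
  assumes h: "1/2 < h" and s: "0 < s" "s < u"
  shows "fbm_kernel_deriv h u s = fbm_deriv h u s"
proof -
  define \<phi> where "\<phi> v = (v - s) powr (h - 3/2) * v powr (h - 1/2)" for v
  define m where "m = (s + u) / 2"
  have m: "s < m" "m < u" using s by (auto simp: m_def)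
  have int: "set_integrable lborel {s..x} \<phi>" if "s \<le> x" for x
  proof -
    have "(\<integral>\<^sup>+v. ennreal (norm (indicator {s..x} v *\<^sub>R \<phi> v)) \<partial>lborel) \<le>
        (\<integral>\<^sup>+v. ennreal (x powr (h - 1/2)) * (ennreal ((v - s) powr (h - 3/2)) * indicator {s..x} v) \<partial>lborel)"
      using s h that by (intro nn_integral_mono)
        (auto simp: \<phi>_def indicator_def ennreal_mult[symmetric] mult.commute intro!: ennreal_leI mult_right_mono powr_mono2)
    also have "\<dots> = ennreal (x powr (h - 1/2)) * (\<integral>\<^sup>+v. ennreal ((v - s) powr (h - 3/2)) * indicator {s..x} v \<partial>lborel)"
      by (intro nn_integral_cmult) measurable
    also have "\<dots> < \<infinity>"
      using h that by (subst nn_integral_powr_left) (auto simp: ennreal_mult[symmetric])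
    finally show ?thesis unfolding set_integrable_def integrable_iff_bounded by (auto simp: \<phi>_def)
  qed
  have G: "(LBINT v:{s..x}. \<phi> v) = integral {s..m} \<phi> + integral {m..x} \<phi>" if "m \<le> x" for x
  proof -
    have "(LBINT v:{s..x}. \<phi> v) = integral {s..x} \<phi>"
      using m that by (intro set_borel_integral_eq_integral int) auto
    also have "\<dots> = integral {s..m} \<phi> + integral {m..x} \<phi>"
      using m that set_borel_integral_eq_integral(1)[OF int[of x]]
      by (intro Henstock_Kurzweil_Integration.integral_combine[symmetric]) auto
    finally show ?thesis .
  qed
  have "continuous_on {m..u + 1} \<phi>"
    unfolding \<phi>_def using m s by (intro continuous_intros) auto
  then have "((\<lambda>x. integral {m..x} \<phi>) has_real_derivative \<phi> u) (at u within {m..u + 1})"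
    using m by (intro integral_has_real_derivative) auto
  then have "((\<lambda>x. integral {m..x} \<phi>) has_real_derivative \<phi> u) (at u)"
    using m by (simp add: at_within_interior[of u "{m..u + 1}"])
  then have "((\<lambda>x. fbm_const h * s powr (1/2 - h) * (integral {s..m} \<phi> + integral {m..x} \<phi>))
      has_real_derivative fbm_const h * s powr (1/2 - h) * \<phi> u) (at u)"
    by (auto intro!: derivative_eq_intros)
  then have "((\<lambda>x. fbm_kernel h x s) has_real_derivative fbm_const h * s powr (1/2 - h) * \<phi> u) (at u)"
  proof (rule has_field_derivative_transform_within_open)
    show "open {m<..}" "u \<in> {m<..}" using m by auto
    show "fbm_const h * s powr (1/2 - h) * (integral {s..m} \<phi> + integral {m..x} \<phi>) = fbm_kernel h x s"
      if "x \<in> {m<..}" for x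
      using that G[of x] by (simp add: fbm_kernel_def \<phi>_def[abs_def])
  qed
  then have "fbm_kernel_deriv h u s = fbm_const h * s powr (1/2 - h) * \<phi> u"
    unfolding fbm_kernel_deriv_def by (rule DERIV_imp_deriv)
  also have "s powr (1/2 - h) = inverse (s powr (h - 1/2))"
    by (subst powr_minus[symmetric]) simp
  finally show ?thesis
    using s by (simp add: fbm_deriv_def \<phi>_def powr_divide field_simps)
qed

text \<open>Valued in \<open>ennreal\<close> because the integral diverges for
  \<open>u = v > 0\<close> when 1/2 < h < 1.\<close>

definition fbm_cov :: "real \<Rightarrow> real \<Rightarrow> real \<Rightarrow> ennreal" where
  "fbm_cov h u v = (\<integral>\<^sup>+y. ennreal (fbm_deriv h u y) * ennreal (fbm_deriv h v y) \<partial>lborel)"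

text \<open>The substitution \<open>t = y (v - u) / (u (v - y))\<close> maps \<open>(0, u)\<close> onto \<open>(0, 1)\<close> and turns the
  covariance of the kernels into a Beta integral.\<close>

lemma fbm_deriv_product:
  fixes u v y h :: real
  defines "g \<equiv> \<lambda>y. y * (v - u) / (u * (v - y))"
  assumes y: "0 < y" "y < u" "u < v"
  shows "fbm_deriv h u y * fbm_deriv h v y = (fbm_const h)\<^sup>2 * (v - u) powr (2 * h - 2) *
     (g y powr (1 - 2 * h) * (1 - g y) powr (h - 3/2) * ((v - u) * v / (u * (v - y)\<^sup>2)))"
proof -
  \<comment> \<open>In terms of logarithms the identity between products of powers becomes a linear
    identity between exponents.\<close>
  define A B C D E F where ln: "A = ln y" "B = ln (u - y)" "C = ln (v - y)" "D = ln u" "E = ln v" "F = ln (v - u)"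
  have e: "exp A = y" "exp B = u - y" "exp C = v - y" "exp D = u" "exp E = v" "exp F = v - u"
    unfolding ln using y by auto
  have g1: "1 - g y = v * (u - y) / (u * (v - y))" using y by (simp add: g_def field_simps)
  have g2: "g y = exp (A + F - D - C)" by (simp add: g_def exp_add exp_diff e)
  have g3: "1 - g y = exp (E + B - D - C)" by (simp add: g1 exp_add exp_diff e)
  have g4: "(v - u) * v / (u * (v - y)\<^sup>2) = exp (F + E - D - 2 * C)"
    by (simp add: exp_add exp_diff e exp_double)
  have p: "exp x powr r = exp (r * x)" for x r :: real by (simp add: powr_def)
  have "fbm_deriv h u y * fbm_deriv h v y = (fbm_const h)\<^sup>2 *
      (exp (D - A) powr (h - 1/2) * exp B powr (h - 3/2) * (exp (E - A) powr (h - 1/2) * exp C powr (h - 3/2)))"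
    using y by (simp add: fbm_deriv_def exp_diff e power2_eq_square)
  also have "\<dots> = (fbm_const h)\<^sup>2 * exp F powr (2 * h - 2) *
     (exp (A + F - D - C) powr (1 - 2 * h) * exp (E + B - D - C) powr (h - 3/2) * exp (F + E - D - 2 * C))"
    unfolding p exp_add[symmetric] mult.assoc by (simp add: algebra_simps add_divide_distrib diff_divide_distrib)
  finally show ?thesis unfolding g3 g4 g2[symmetric] e .
qed

lemma fbm_cov_less:
  assumes h: "1/2 < h" "h < 1" and uv: "0 < u" "u < v"
  shows "fbm_cov h u v = ennreal (h * (2 * h - 1) * (v - u) powr (2 * h - 2))"
proof -
  define g where "g y = y * (v - u) / (u * (v - y))" for y
  define g' where "g' y = (v - u) * v / (u * (v - y)\<^sup>2)" for y
  define f where "f t = t powr (1 - 2 * h) * (1 - t) powr (h - 3/2)" for t :: real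
  have g01: "g 0 = 0" "g u = 1" using uv by (auto simp: g_def)
  have "(\<integral>\<^sup>+x. ennreal (f x * indicator {g 0..g u} x) \<partial>lborel) = (\<integral>\<^sup>+x. ennreal (f (g x) * g' x * indicator {0..u} x) \<partial>lborel)"
  proof (rule nn_integral_substitution)
    show "set_borel_measurable borel {g 0..g u} f"
      unfolding set_borel_measurable_def f_def by measurable
    show "(g has_real_derivative g' x) (at x)" if "x \<in> {0..u}" for x
    proof -
      have ne: "v - x \<noteq> 0" "u \<noteq> 0" using that uv by auto
      have "((\<lambda>y. (v - u) / u * (y / (v - y))) has_real_derivative
          (v - u) / u * ((1 * (v - x) - x * (0 - 1)) / ((v - x) * (v - x)))) (at x)"
        using ne by (intro DERIV_cmult DERIV_divide DERIV_ident DERIV_diff DERIV_const)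
      moreover have "(\<lambda>y. (v - u) / u * (y / (v - y))) = g"
        by (auto simp: g_def mult.commute)
      moreover have "(v - u) / u * ((1 * (v - x) - x * (0 - 1)) / ((v - x) * (v - x))) = g' x"
        by (simp add: g'_def power2_eq_square)
      ultimately show ?thesis by simp
    qed
    show "continuous_on {0..u} g'" unfolding g'_def using uv by (intro continuous_intros) auto
  qed (use uv in \<open>auto simp: g'_def\<close>)
  moreover have "(\<integral>\<^sup>+x. ennreal (f x * indicator {g 0..g u} x) \<partial>lborel) = ennreal (Beta (2 - 2 * h) (h - 1/2))"
  proof -
    have "(f has_integral Beta (2 - 2 * h) (h - 1/2)) {0..1}"
    proof -
      have "2 - 2 * h - 1 = 1 - 2 * h" "h - 1/2 - 1 = h - 3/2" by simp_all
      with has_integral_Beta_real[of "2 - 2 * h" "h - 1/2"] h show ?thesis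
        unfolding f_def by (simp only:)
    qed
    then have "(\<integral>\<^sup>+x. ennreal (f x) * indicator {0..1} x \<partial>lborel) = ennreal (Beta (2 - 2 * h) (h - 1/2))"
      by (intro nn_integral_has_integral_lebesgue') (auto simp: f_def[abs_def])
    then show ?thesis by (simp add: g01 ennreal_mult' ennreal_indicator f_def mult.commute)
  qed
  ultimately have B: "(\<integral>\<^sup>+x. ennreal (f (g x) * g' x * indicator {0..u} x) \<partial>lborel) = ennreal (Beta (2 - 2 * h) (h - 1/2))"
    by simp
  have "fbm_cov h u v = (\<integral>\<^sup>+x. ennreal ((fbm_const h)\<^sup>2 * (v - u) powr (2 * h - 2)) * ennreal (f (g x) * g' x * indicator {0..u} x) \<partial>lborel)"
    unfolding fbm_cov_def
  \<comment> \<open>The substitution rule carries the closed interval, whereas the kernel is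
    supported in the open one; the two endpoints are discarded as null sets.\<close>
  proof (intro nn_integral_cong_AE, use AE_lborel_singleton[of 0] AE_lborel_singleton[of u] in eventually_elim)
    fix y :: real assume y: "y \<noteq> 0" "y \<noteq> u"
    show "ennreal (fbm_deriv h u y) * ennreal (fbm_deriv h v y) =
      ennreal ((fbm_const h)\<^sup>2 * (v - u) powr (2 * h - 2)) * ennreal (f (g y) * g' y * indicator {0..u} y)"
    proof (cases "0 < y \<and> y < u")
      case True
      then show ?thesis
        using fbm_deriv_product[of y u v h] uv fbm_deriv_nonneg[OF h]
        by (simp add: ennreal_mult[symmetric] ennreal_mult'[symmetric] f_def g_def g'_def mult.assoc)
    next
      case False
      then have "fbm_deriv h u y = 0" "indicator {0..u} y = (0 :: real)"
        using y by (auto simp: fbm_deriv_def indicator_def)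
      then show ?thesis by simp
    qed
  qed
  also have "\<dots> = ennreal ((fbm_const h)\<^sup>2 * (v - u) powr (2 * h - 2)) * ennreal (Beta (2 - 2 * h) (h - 1/2))"
    unfolding f_def g_def g'_def by (subst nn_integral_cmult) (measurable, use B in \<open>simp add: f_def g_def g'_def\<close>)
  also have "\<dots> = ennreal (((fbm_const h)\<^sup>2 * Beta (2 - 2 * h) (h - 1/2)) * (v - u) powr (2 * h - 2))"
    using fbm_const_sq(3)[OF h] by (simp add: ennreal_mult[symmetric] ennreal_mult'[symmetric] mult_ac)
  \<comment> \<open>The denominator in \<open>fbm_const\<close> is precisely this Beta value, so
    only h (2 h - 1) remains.\<close>
  finally show ?thesis by (simp add: fbm_const_sq(2)[OF h])
qed

lemma fbm_cov_eq:
  assumes h: "1/2 < h" "h < 1" and uv: "0 < u" "0 < v" "u \<noteq> v"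
  shows "fbm_cov h u v = ennreal (h * (2 * h - 1) * \<bar>u - v\<bar> powr (2 * h - 2))"
proof (cases "u < v")
  case False
  have "fbm_cov h u v = fbm_cov h v u" by (simp add: fbm_cov_def mult.commute)
  then show ?thesis using False uv fbm_cov_less[OF h, of v u] by simp
qed (use uv fbm_cov_less[OF h, of u v] in simp)

subsection \<open>Traces of mixtures of rank-one kernels\<close>

locale kernel_family =
  fixes k :: "real \<Rightarrow> real \<Rightarrow> ennreal"
  assumes k[measurable]: "(\<lambda>(u, y). k u y) \<in> borel_measurable (borel \<Otimes>\<^sub>M borel)"
begin

text \<open>A superposition of rank-one kernels. The individual \<open>k u\<close> may have infinite
  norm, so values in [0, \<infinity>] are allowed. With \<open>rho\<close> as their Gram function,
  traces of products of mixtures become integrals of products of \<open>rho\<close> around a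
  cycle.\<close>

definition mix :: "real measure \<Rightarrow> real \<Rightarrow> real \<Rightarrow> ennreal" where
  "mix I x y = (\<integral>\<^sup>+u. k u x * k u y \<partial>I)"

definition rho :: "real \<Rightarrow> real \<Rightarrow> ennreal" where
  "rho u v = (\<integral>\<^sup>+y. k u y * k v y \<partial>lborel)"

definition mix_gram :: "real measure \<Rightarrow> real measure \<Rightarrow> real \<Rightarrow> real \<Rightarrow> ennreal" where
  "mix_gram I J x y = (\<integral>\<^sup>+t. mix I t x * mix J t y \<partial>lborel)"

lemma rho_measurable[measurable]: "(\<lambda>(u, v). rho u v) \<in> borel_measurable (borel \<Otimes>\<^sub>M borel)"
  unfolding rho_def by measurable

end

lemma nn_integral_swap:
  assumes "sigma_finite_measure I" "sigma_finite_measure J"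
    and "(\<lambda>(x, y). f x y) \<in> borel_measurable (I \<Otimes>\<^sub>M J)"
  shows "(\<integral>\<^sup>+x. \<integral>\<^sup>+y. f x y \<partial>J \<partial>I) = (\<integral>\<^sup>+y. \<integral>\<^sup>+x. f x y \<partial>I \<partial>J)"
proof -
  interpret pair_sigma_finite I J using assms by (simp add: pair_sigma_finite_def)
  show ?thesis by (rule Fubini'[symmetric]) (use assms(3) in simp)
qed

text \<open>Four measures are carried because the longest trace that occurs is that of a product of
  four mixtures. Finiteness supplies the sigma-finiteness for Tonelli's theorem.\<close>

locale kernel_mixture = kernel_family +
  fixes I J I' J' :: "real measure"
  assumes sets[measurable_cong]: "sets I = sets borel" "sets J = sets borel" "sets I' = sets borel" "sets J' = sets borel"
    and fin: "finite_measure I" "finite_measure J" "finite_measure I'" "finite_measure J'"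
begin

lemma sf[simp]: "sigma_finite_measure I" "sigma_finite_measure J" "sigma_finite_measure I'" "sigma_finite_measure J'"
  "sigma_finite_measure (lborel :: real measure)"
  using fin by (auto intro: finite_measure.sigma_finite_measure sigma_finite_lborel)

sublocale I: sigma_finite_measure I by simp
sublocale J: sigma_finite_measure J by simp
sublocale I': sigma_finite_measure I' by simp
sublocale J': sigma_finite_measure J' by simp

lemma mix_measurable[measurable]:
  "(\<lambda>(x, y). mix I x y) \<in> borel_measurable (borel \<Otimes>\<^sub>M borel)"
  "(\<lambda>(x, y). mix J x y) \<in> borel_measurable (borel \<Otimes>\<^sub>M borel)"
  unfolding mix_def by measurable

lemma mix_gram_eq: "mix_gram I J x y = (\<integral>\<^sup>+u. \<integral>\<^sup>+v. rho u v * (k u x * k v y) \<partial>J \<partial>I)"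
proof -
  have "mix_gram I J x y = (\<integral>\<^sup>+t. \<integral>\<^sup>+u. \<integral>\<^sup>+v. (k u t * k u x) * (k v t * k v y) \<partial>J \<partial>I \<partial>lborel)"
    unfolding mix_gram_def mix_def
    by (subst nn_integral_multc[symmetric], measurable, subst nn_integral_cmult[symmetric], measurable)
  also have "\<dots> = (\<integral>\<^sup>+u. \<integral>\<^sup>+t. \<integral>\<^sup>+v. (k u t * k u x) * (k v t * k v y) \<partial>J \<partial>lborel \<partial>I)"
    by (rule nn_integral_swap) (simp, simp, measurable)
  also have "\<dots> = (\<integral>\<^sup>+u. \<integral>\<^sup>+v. \<integral>\<^sup>+t. (k u t * k u x) * (k v t * k v y) \<partial>lborel \<partial>J \<partial>I)"
    by (rule nn_integral_cong, rule nn_integral_swap) (simp, simp, measurable)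
  also have "\<dots> = (\<integral>\<^sup>+u. \<integral>\<^sup>+v. rho u v * (k u x * k v y) \<partial>J \<partial>I)"
  proof (intro nn_integral_cong)
    fix u v
    have "(\<integral>\<^sup>+t. (k u t * k u x) * (k v t * k v y) \<partial>lborel) = (\<integral>\<^sup>+t. (k u t * k v t) * (k u x * k v y) \<partial>lborel)"
      by (intro nn_integral_cong) (simp add: mult_ac)
    also have "\<dots> = rho u v * (k u x * k v y)" unfolding rho_def by (intro nn_integral_multc) measurable
    finally show "(\<integral>\<^sup>+t. (k u t * k u x) * (k v t * k v y) \<partial>lborel) = rho u v * (k u x * k v y)" .
  qed
  finally show ?thesis .
qed

lemma mix_gram_measurable[measurable]: "(\<lambda>(x, y). mix_gram I J x y) \<in> borel_measurable (borel \<Otimes>\<^sub>M borel)"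
  unfolding mix_gram_def by measurable

text \<open>The cycle of length two: the inner product is the integral of \<open>mix_gram\<close>
  along the diagonal, where the edge between u and v is closed a second time.\<close>

lemma mix_inner: "(\<integral>\<^sup>+x. \<integral>\<^sup>+y. mix I x y * mix J x y \<partial>lborel \<partial>lborel) = (\<integral>\<^sup>+u. \<integral>\<^sup>+v. (rho u v)\<^sup>2 \<partial>J \<partial>I)"
proof -
  have "(\<integral>\<^sup>+x. \<integral>\<^sup>+y. mix I x y * mix J x y \<partial>lborel \<partial>lborel) = (\<integral>\<^sup>+x. mix_gram I J x x \<partial>lborel)"
    unfolding mix_gram_def by (intro nn_integral_cong) (simp add: mix_def mult.commute)
  also have "\<dots> = (\<integral>\<^sup>+u. \<integral>\<^sup>+x. \<integral>\<^sup>+v. rho u v * (k u x * k v x) \<partial>J \<partial>lborel \<partial>I)"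
    unfolding mix_gram_eq by (rule nn_integral_swap) (simp, simp, measurable)
  also have "\<dots> = (\<integral>\<^sup>+u. \<integral>\<^sup>+v. \<integral>\<^sup>+x. rho u v * (k u x * k v x) \<partial>lborel \<partial>J \<partial>I)"
    by (rule nn_integral_cong, rule nn_integral_swap) (simp, simp, measurable)
  also have "\<dots> = (\<integral>\<^sup>+u. \<integral>\<^sup>+v. (rho u v)\<^sup>2 \<partial>J \<partial>I)"
  proof (intro nn_integral_cong)
    fix u v
    have "(\<integral>\<^sup>+x. rho u v * (k u x * k v x) \<partial>lborel) = rho u v * (\<integral>\<^sup>+x. k u x * k v x \<partial>lborel)"
      by (intro nn_integral_cmult) measurable
    then show "(\<integral>\<^sup>+x. rho u v * (k u x * k v x) \<partial>lborel) = (rho u v)\<^sup>2"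
      by (simp add: rho_def power2_eq_square)
  qed
  finally show ?thesis .
qed

text \<open>The cycle of length three: the edge from u to v comes from \<open>mix_gram_eq\<close>,
  and integrating out x and y closes the edges from u to w and from v to w.\<close>

lemma mix_gram_inner_mix:
  "(\<integral>\<^sup>+x. \<integral>\<^sup>+y. mix_gram I J x y * mix I' x y \<partial>lborel \<partial>lborel) =
   (\<integral>\<^sup>+u. \<integral>\<^sup>+v. \<integral>\<^sup>+w. rho u v * (rho u w * rho v w) \<partial>I' \<partial>J \<partial>I)"
proof -
  have "(\<integral>\<^sup>+x. \<integral>\<^sup>+y. mix_gram I J x y * mix I' x y \<partial>lborel \<partial>lborel) =
    (\<integral>\<^sup>+x. \<integral>\<^sup>+y. \<integral>\<^sup>+u. \<integral>\<^sup>+v. \<integral>\<^sup>+w. rho u v * (k u x * k v y) * (k w x * k w y) \<partial>I' \<partial>J \<partial>I \<partial>lborel \<partial>lborel)"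
    unfolding mix_gram_eq mix_def
    by (subst nn_integral_multc[symmetric], measurable, subst nn_integral_multc[symmetric], measurable,
        subst nn_integral_cmult[symmetric], measurable)
  also have "\<dots> = (\<integral>\<^sup>+x. \<integral>\<^sup>+u. \<integral>\<^sup>+y. \<integral>\<^sup>+v. \<integral>\<^sup>+w. rho u v * (k u x * k v y) * (k w x * k w y) \<partial>I' \<partial>J \<partial>lborel \<partial>I \<partial>lborel)"
    by (rule nn_integral_cong, rule nn_integral_swap) (simp, simp, measurable)
  also have "\<dots> = (\<integral>\<^sup>+u. \<integral>\<^sup>+x. \<integral>\<^sup>+y. \<integral>\<^sup>+v. \<integral>\<^sup>+w. rho u v * (k u x * k v y) * (k w x * k w y) \<partial>I' \<partial>J \<partial>lborel \<partial>lborel \<partial>I)"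
    by (rule nn_integral_swap) (simp, simp, measurable)
  also have "\<dots> = (\<integral>\<^sup>+u. \<integral>\<^sup>+x. \<integral>\<^sup>+v. \<integral>\<^sup>+y. \<integral>\<^sup>+w. rho u v * (k u x * k v y) * (k w x * k w y) \<partial>I' \<partial>lborel \<partial>J \<partial>lborel \<partial>I)"
    by (rule nn_integral_cong, rule nn_integral_cong, rule nn_integral_swap) (simp, simp, measurable)
  also have "\<dots> = (\<integral>\<^sup>+u. \<integral>\<^sup>+v. \<integral>\<^sup>+x. \<integral>\<^sup>+y. \<integral>\<^sup>+w. rho u v * (k u x * k v y) * (k w x * k w y) \<partial>I' \<partial>lborel \<partial>lborel \<partial>J \<partial>I)"
    by (rule nn_integral_cong, rule nn_integral_swap) (simp, simp, measurable)
  also have "\<dots> = (\<integral>\<^sup>+u. \<integral>\<^sup>+v. \<integral>\<^sup>+x. \<integral>\<^sup>+w. \<integral>\<^sup>+y. rho u v * (k u x * k v y) * (k w x * k w y) \<partial>lborel \<partial>I' \<partial>lborel \<partial>J \<partial>I)"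
    by (rule nn_integral_cong, rule nn_integral_cong, rule nn_integral_cong, rule nn_integral_swap) (simp, simp, measurable)
  also have "\<dots> = (\<integral>\<^sup>+u. \<integral>\<^sup>+v. \<integral>\<^sup>+w. \<integral>\<^sup>+x. \<integral>\<^sup>+y. rho u v * (k u x * k v y) * (k w x * k w y) \<partial>lborel \<partial>lborel \<partial>I' \<partial>J \<partial>I)"
    by (rule nn_integral_cong, rule nn_integral_cong, rule nn_integral_swap) (simp, simp, measurable)
  also have "\<dots> = (\<integral>\<^sup>+u. \<integral>\<^sup>+v. \<integral>\<^sup>+w. rho u v * (rho u w * rho v w) \<partial>I' \<partial>J \<partial>I)"
  proof (intro nn_integral_cong)
    fix u v w
    have "(\<integral>\<^sup>+x. \<integral>\<^sup>+y. rho u v * (k u x * k v y) * (k w x * k w y) \<partial>lborel \<partial>lborel) =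
      (\<integral>\<^sup>+x. \<integral>\<^sup>+y. rho u v * (k u x * k w x) * (k v y * k w y) \<partial>lborel \<partial>lborel)"
      by (intro nn_integral_cong) (simp add: mult_ac)
    also have "\<dots> = rho u v * rho u w * rho v w"
      unfolding rho_def[of u w] rho_def[of v w]
      by (subst nn_integral_cmult, measurable, subst nn_integral_multc, measurable, subst nn_integral_cmult, measurable)
    finally show "(\<integral>\<^sup>+x. \<integral>\<^sup>+y. rho u v * (k u x * k v y) * (k w x * k w y) \<partial>lborel \<partial>lborel) = rho u v * (rho u w * rho v w)"
      by (simp add: mult.assoc)
  qed
  finally show ?thesis .
qed

text \<open>The cycle of length four through u, v, v', u'. The second instance of the locale, with
  the two pairs of measures exchanged, expands the second factor; integrating out x and y joins u to
  u' and v to v'.\<close>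

lemma mix_gram_inner:
  assumes "kernel_mixture k I' J' I J"
  shows "(\<integral>\<^sup>+x. \<integral>\<^sup>+y. mix_gram I J x y * mix_gram I' J' x y \<partial>lborel \<partial>lborel) =
   (\<integral>\<^sup>+u. \<integral>\<^sup>+v. \<integral>\<^sup>+u'. \<integral>\<^sup>+v'. rho u v * rho u' v' * (rho u u' * rho v v') \<partial>J' \<partial>I' \<partial>J \<partial>I)"
proof -
  let ?F = "\<lambda>x y u v u' v'. rho u v * (k u x * k v y) * (rho u' v' * (k u' x * k v' y))"
  have "(\<integral>\<^sup>+x. \<integral>\<^sup>+y. mix_gram I J x y * mix_gram I' J' x y \<partial>lborel \<partial>lborel) =
    (\<integral>\<^sup>+x. \<integral>\<^sup>+y. \<integral>\<^sup>+u. \<integral>\<^sup>+v. \<integral>\<^sup>+u'. \<integral>\<^sup>+v'. ?F x y u v u' v' \<partial>J' \<partial>I' \<partial>J \<partial>I \<partial>lborel \<partial>lborel)"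
    unfolding mix_gram_eq kernel_mixture.mix_gram_eq[OF assms]
    by (subst nn_integral_multc[symmetric], measurable, subst nn_integral_multc[symmetric], measurable,
        subst nn_integral_cmult[symmetric], measurable, subst nn_integral_cmult[symmetric], measurable)
  also have "\<dots> = (\<integral>\<^sup>+x. \<integral>\<^sup>+u. \<integral>\<^sup>+y. \<integral>\<^sup>+v. \<integral>\<^sup>+u'. \<integral>\<^sup>+v'. ?F x y u v u' v' \<partial>J' \<partial>I' \<partial>J \<partial>lborel \<partial>I \<partial>lborel)"
    by (rule nn_integral_cong, rule nn_integral_swap) (simp, simp, measurable)
  also have "\<dots> = (\<integral>\<^sup>+u. \<integral>\<^sup>+x. \<integral>\<^sup>+y. \<integral>\<^sup>+v. \<integral>\<^sup>+u'. \<integral>\<^sup>+v'. ?F x y u v u' v' \<partial>J' \<partial>I' \<partial>J \<partial>lborel \<partial>lborel \<partial>I)"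
    by (rule nn_integral_swap) (simp, simp, measurable)
  also have "\<dots> = (\<integral>\<^sup>+u. \<integral>\<^sup>+x. \<integral>\<^sup>+v. \<integral>\<^sup>+y. \<integral>\<^sup>+u'. \<integral>\<^sup>+v'. ?F x y u v u' v' \<partial>J' \<partial>I' \<partial>lborel \<partial>J \<partial>lborel \<partial>I)"
    by (rule nn_integral_cong, rule nn_integral_cong, rule nn_integral_swap) (simp, simp, measurable)
  also have "\<dots> = (\<integral>\<^sup>+u. \<integral>\<^sup>+v. \<integral>\<^sup>+x. \<integral>\<^sup>+y. \<integral>\<^sup>+u'. \<integral>\<^sup>+v'. ?F x y u v u' v' \<partial>J' \<partial>I' \<partial>lborel \<partial>lborel \<partial>J \<partial>I)"
    by (rule nn_integral_cong, rule nn_integral_swap) (simp, simp, measurable)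
  also have "\<dots> = (\<integral>\<^sup>+u. \<integral>\<^sup>+v. \<integral>\<^sup>+x. \<integral>\<^sup>+u'. \<integral>\<^sup>+y. \<integral>\<^sup>+v'. ?F x y u v u' v' \<partial>J' \<partial>lborel \<partial>I' \<partial>lborel \<partial>J \<partial>I)"
    by (rule nn_integral_cong, rule nn_integral_cong, rule nn_integral_cong, rule nn_integral_swap) (simp, simp, measurable)
  also have "\<dots> = (\<integral>\<^sup>+u. \<integral>\<^sup>+v. \<integral>\<^sup>+u'. \<integral>\<^sup>+x. \<integral>\<^sup>+y. \<integral>\<^sup>+v'. ?F x y u v u' v' \<partial>J' \<partial>lborel \<partial>lborel \<partial>I' \<partial>J \<partial>I)"
    by (rule nn_integral_cong, rule nn_integral_cong, rule nn_integral_swap) (simp, simp, measurable)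
  also have "\<dots> = (\<integral>\<^sup>+u. \<integral>\<^sup>+v. \<integral>\<^sup>+u'. \<integral>\<^sup>+x. \<integral>\<^sup>+v'. \<integral>\<^sup>+y. ?F x y u v u' v' \<partial>lborel \<partial>J' \<partial>lborel \<partial>I' \<partial>J \<partial>I)"
    by (rule nn_integral_cong, rule nn_integral_cong, rule nn_integral_cong, rule nn_integral_cong, rule nn_integral_swap) (simp, simp, measurable)
  also have "\<dots> = (\<integral>\<^sup>+u. \<integral>\<^sup>+v. \<integral>\<^sup>+u'. \<integral>\<^sup>+v'. \<integral>\<^sup>+x. \<integral>\<^sup>+y. ?F x y u v u' v' \<partial>lborel \<partial>lborel \<partial>J' \<partial>I' \<partial>J \<partial>I)"
    by (rule nn_integral_cong, rule nn_integral_cong, rule nn_integral_cong, rule nn_integral_swap) (simp, simp, measurable)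
  also have "\<dots> = (\<integral>\<^sup>+u. \<integral>\<^sup>+v. \<integral>\<^sup>+u'. \<integral>\<^sup>+v'. rho u v * rho u' v' * (rho u u' * rho v v') \<partial>J' \<partial>I' \<partial>J \<partial>I)"
  proof (intro nn_integral_cong)
    fix u v u' v'
    have "(\<integral>\<^sup>+x. \<integral>\<^sup>+y. ?F x y u v u' v' \<partial>lborel \<partial>lborel) =
      (\<integral>\<^sup>+x. \<integral>\<^sup>+y. rho u v * rho u' v' * (k u x * k u' x) * (k v y * k v' y) \<partial>lborel \<partial>lborel)"
      by (intro nn_integral_cong) (simp add: mult_ac)
    also have "\<dots> = rho u v * rho u' v' * rho u u' * rho v v'"
      unfolding rho_def[of u u'] rho_def[of v v']
      by (subst nn_integral_cmult, measurable, subst nn_integral_multc, measurable, subst nn_integral_cmult, measurable)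
    finally show "(\<integral>\<^sup>+x. \<integral>\<^sup>+y. ?F x y u v u' v' \<partial>lborel \<partial>lborel) = rho u v * rho u' v' * (rho u u' * rho v v')"
      by (simp add: mult.assoc)
  qed
  finally show ?thesis .
qed

end

subsection \<open>The kernels of the Rosenblatt increments\<close>

text \<open>\<open>represents f F\<close>: the nonnegative square-integrable kernel \<open>f\<close> agrees almost everywhere with
  \<open>F\<close>, which may take the value \<open>\<infinity>\<close>; Tonelli's theorem is applied to \<open>F\<close>.\<close>

definition represents :: "(real \<times> real \<Rightarrow> real) \<Rightarrow> (real \<Rightarrow> real \<Rightarrow> ennreal) \<Rightarrow> bool" where
  "represents f F \<longleftrightarrow> L2 lborel f \<and> (\<forall>p. 0 \<le> f p) \<and>
     (\<lambda>(x, y). F x y) \<in> borel_measurable (borel \<Otimes>\<^sub>M borel) \<and>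
     (AE p in lborel. ennreal (f p) = F (fst p) (snd p))"

lemma represents_inner:
  assumes f: "represents f F" and g: "represents g G"
  shows "ennreal (\<integral>p. f p * g p \<partial>lborel) = (\<integral>\<^sup>+x. \<integral>\<^sup>+y. F x y * G x y \<partial>lborel \<partial>lborel)"
proof -
  have [measurable]: "(\<lambda>p. F (fst p) (snd p)) \<in> borel_measurable (borel \<Otimes>\<^sub>M borel)"
    "(\<lambda>p. G (fst p) (snd p)) \<in> borel_measurable (borel \<Otimes>\<^sub>M borel)"
    using f g by (simp_all add: represents_def case_prod_beta')
  have "ennreal (\<integral>p. f p * g p \<partial>lborel) = (\<integral>\<^sup>+p. ennreal (f p * g p) \<partial>lborel)"
    using f g by (intro nn_integral_eq_integral[symmetric] L2_integrable_mult) (auto simp: represents_def)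
  also have "\<dots> = (\<integral>\<^sup>+p. F (fst p) (snd p) * G (fst p) (snd p) \<partial>lborel)"
    using f g by (intro nn_integral_cong_AE) (auto simp: represents_def ennreal_mult)
  also have "\<dots> = (\<integral>\<^sup>+x. \<integral>\<^sup>+y. F x y * G x y \<partial>lborel \<partial>lborel)"
    using nn_integral_lborel_pair[of "\<lambda>p. F (fst p) (snd p) * G (fst p) (snd p)"] by simp
  finally show ?thesis .
qed

text \<open>Fubini gives almost sure agreement on sections in the second variable, while the
  contraction runs over the first; symmetry of the kernels exchanges the two. On good sections the
  Bochner and the nonnegative integral coincide.\<close>

lemma represents_kgram:
  assumes f: "represents f F" and g: "represents g G"
    and sym: "\<And>x y. f (x, y) = f (y, x)" "\<And>x y. g (x, y) = g (y, x)"
      "\<And>x y. F x y = F y x" "\<And>x y. G x y = G y x"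
  shows "represents (kgram f g) (\<lambda>x y. \<integral>\<^sup>+t. F t x * G t y \<partial>lborel)"
proof -
  have [measurable]: "(\<lambda>(x, y). F x y) \<in> borel_measurable (borel \<Otimes>\<^sub>M borel)"
    "(\<lambda>(x, y). G x y) \<in> borel_measurable (borel \<Otimes>\<^sub>M borel)"
    using f g by (auto simp: represents_def)
  have nn: "0 \<le> f p" "0 \<le> g p" for p using f g unfolding represents_def by blast+
  have *: "AE x in lborel. L2 lborel (\<lambda>t. f' (t, x)) \<and> (AE t in lborel. ennreal (f' (t, x)) = F' t x)"
    if "represents f' F'" and sym: "\<And>x y. f' (x, y) = f' (y, x)" "\<And>x y. F' x y = F' y x" for f' F'
  proof -
    have "AE p in lborel. ennreal (f' p) = F' (fst p) (snd p)"
      using that(1) by (simp add: represents_def)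
    then have "AE x in lborel. AE t in lborel. ennreal (f' (x, t)) = F' (fst (x, t)) (snd (x, t))"
      unfolding lborel_prod[symmetric] by (rule lborel_pair.AE_pair)
    moreover have "ennreal (f' (x, t)) = F' (fst (x, t)) (snd (x, t)) \<longleftrightarrow> ennreal (f' (t, x)) = F' t x" for x t
      unfolding fst_conv snd_conv sym(1)[of x t] sym(2)[of x t] ..
    ultimately have "AE x in lborel. AE t in lborel. ennreal (f' (t, x)) = F' t x"
      by (simp only:)
    moreover have "AE x in lborel. L2 lborel (\<lambda>t. f' (t, x))"
      using that(1) by (intro AE_lborel_pair_sections) (simp add: represents_def)
    ultimately show ?thesis by (intro AE_conjI)
  qed
  have "AE p in lborel. (L2 lborel (\<lambda>t. f (t, fst p)) \<and> (AE t in lborel. ennreal (f (t, fst p)) = F t (fst p))) \<and>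
      (L2 lborel (\<lambda>t. g (t, snd p)) \<and> (AE t in lborel. ennreal (g (t, snd p)) = G t (snd p)))"
    by (rule AE_lborel_pairI[OF *[OF f sym(1) sym(3)] *[OF g sym(2) sym(4)]])
  then have "AE p in lborel. ennreal (kgram f g p) = (\<integral>\<^sup>+t. F t (fst p) * G t (snd p) \<partial>lborel)"
  proof (rule eventually_mono)
    fix p assume A: "(L2 lborel (\<lambda>t. f (t, fst p)) \<and> (AE t in lborel. ennreal (f (t, fst p)) = F t (fst p))) \<and>
      (L2 lborel (\<lambda>t. g (t, snd p)) \<and> (AE t in lborel. ennreal (g (t, snd p)) = G t (snd p)))"
    have "ennreal (kgram f g p) = ennreal (\<integral>t. f (t, fst p) * g (t, snd p) \<partial>lborel)"
      by (simp add: kgram_def case_prod_beta)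
    also have "\<dots> = (\<integral>\<^sup>+t. ennreal (f (t, fst p) * g (t, snd p)) \<partial>lborel)"
      using A nn by (intro nn_integral_eq_integral[symmetric] L2_integrable_mult) auto
    also have "\<dots> = (\<integral>\<^sup>+t. F t (fst p) * G t (snd p) \<partial>lborel)"
      using A nn by (intro nn_integral_cong_AE) (auto simp: ennreal_mult)
    finally show "ennreal (kgram f g p) = (\<integral>\<^sup>+t. F t (fst p) * G t (snd p) \<partial>lborel)" .
  qed
  moreover have "L2 lborel (kgram f g)"
    using f g by (intro kgram_bound) (auto simp: represents_def)
  moreover have "0 \<le> kgram f g p" for p
    using nn by (auto simp: kgram_def case_prod_beta intro!: integral_nonneg_AE)
  ultimately show ?thesis unfolding represents_def by simp
qed

text \<open>Not normalized: the total mass is the length of the interval, hence 1 for the unit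
  cells. Half-open intervals make the measures of adjacent cells add up.\<close>

definition unif :: "real \<Rightarrow> real \<Rightarrow> real measure" where
  "unif p q = density lborel (indicator {p<..q})"

lemma sets_unif[measurable_cong, simp]: "sets (unif p q) = sets borel"
  by (simp add: unif_def)

lemma space_unif[simp]: "space (unif p q) = UNIV"
  by (simp add: unif_def)

lemma nn_integral_unif:
  "f \<in> borel_measurable borel \<Longrightarrow> (\<integral>\<^sup>+u. f u \<partial>unif p q) = (\<integral>\<^sup>+u. f u * indicator {p<..q} u \<partial>lborel)"
  unfolding unif_def by (subst nn_integral_density) (auto simp: mult.commute)

lemma emeasure_unif: "p \<le> q \<Longrightarrow> emeasure (unif p q) UNIV = ennreal (q - p)"
  unfolding unif_def by (subst emeasure_density) auto

lemma finite_unif: "p \<le> q \<Longrightarrow> finite_measure (unif p q)"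
  by (intro finite_measureI) (simp add: emeasure_unif)

lemma AE_unif: "AE u in unif p q. p < u \<and> u \<le> q"
  unfolding unif_def by (subst AE_density) (auto simp: indicator_def)

text \<open>\<open>r\<close> is prescribed off the diagonal and at positive arguments only, which
  accommodates a function that is infinite on the diagonal. The half-open interval avoids 0, and the
  diagonal meets each section in a null set.\<close>

lemma nn_integral_unif_powr:
  assumes r: "\<And>u v. 0 < u \<Longrightarrow> 0 < v \<Longrightarrow> u \<noteq> v \<Longrightarrow> r u v = ennreal (C * \<bar>u - v\<bar> powr e)"
    and rm[measurable]: "(\<lambda>(u, v). r u v) \<in> borel_measurable (borel \<Otimes>\<^sub>M borel)"
    and e: "-1 < e" and C: "0 \<le> C" and pq: "0 \<le> p" "p \<le> q"
  shows "(\<integral>\<^sup>+u. \<integral>\<^sup>+v. r u v \<partial>unif p q \<partial>unif p q) = ennreal (C * (2 * (q - p) powr (e + 2) / ((e + 1) * (e + 2))))"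
proof -
  interpret finite_measure "unif p q" by (rule finite_unif[OF pq(2)])
  have "(\<integral>\<^sup>+u. \<integral>\<^sup>+v. r u v \<partial>unif p q \<partial>unif p q) = (\<integral>\<^sup>+u. (\<integral>\<^sup>+v. r u v \<partial>unif p q) * indicator {p<..q} u \<partial>lborel)"
    by (rule nn_integral_unif) measurable
  also have "\<dots> = (\<integral>\<^sup>+u. (\<integral>\<^sup>+v. r u v * indicator {p<..q} v \<partial>lborel) * indicator {p<..q} u \<partial>lborel)"
    by (intro nn_integral_cong arg_cong2[where f = "(*)"] refl nn_integral_unif) measurable
  also have "\<dots> = (\<integral>\<^sup>+u. ennreal C * ((\<integral>\<^sup>+v. ennreal (\<bar>u - v\<bar> powr e) * indicator {p..q} v \<partial>lborel) * indicator {p..q} u) \<partial>lborel)"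
  proof (intro nn_integral_cong_AE, use AE_lborel_singleton[of p] in eventually_elim)
    fix u :: real assume u: "u \<noteq> p"
    show "(\<integral>\<^sup>+v. r u v * indicator {p<..q} v \<partial>lborel) * indicator {p<..q} u =
      ennreal C * ((\<integral>\<^sup>+v. ennreal (\<bar>u - v\<bar> powr e) * indicator {p..q} v \<partial>lborel) * indicator {p..q} u)"
    proof (cases "u \<in> {p<..q}")
      case True
      have "(\<integral>\<^sup>+v. r u v * indicator {p<..q} v \<partial>lborel) = (\<integral>\<^sup>+v. ennreal C * (ennreal (\<bar>u - v\<bar> powr e) * indicator {p..q} v) \<partial>lborel)"
      proof (intro nn_integral_cong_AE, use AE_lborel_singleton[of p] AE_lborel_singleton[of u] in eventually_elim)
        fix v :: real assume "v \<noteq> p" "v \<noteq> u"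
        then show "r u v * indicator {p<..q} v = ennreal C * (ennreal (\<bar>u - v\<bar> powr e) * indicator {p..q} v)"
          using r[of u v] True pq C by (auto simp: indicator_def ennreal_mult)
      qed
      also have "\<dots> = ennreal C * (\<integral>\<^sup>+v. ennreal (\<bar>u - v\<bar> powr e) * indicator {p..q} v \<partial>lborel)"
        by (intro nn_integral_cmult) measurable
      finally show ?thesis using True by simp
    next
      case False
      then have "u \<notin> {p..q}" using u by auto
      then show ?thesis using False by simp
    qed
  qed
  also have "\<dots> = ennreal C * (\<integral>\<^sup>+u. (\<integral>\<^sup>+v. ennreal (\<bar>u - v\<bar> powr e) * indicator {p..q} v \<partial>lborel) * indicator {p..q} u \<partial>lborel)"
    by (intro nn_integral_cmult) measurable
  also have "\<dots> = ennreal C * ennreal (2 * (q - p) powr (e + 2) / ((e + 1) * (e + 2)))"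
    by (subst nn_integral_powr_abs[OF e pq(2)]) simp
  also have "\<dots> = ennreal (C * (2 * (q - p) powr (e + 2) / ((e + 1) * (e + 2))))"
    using e C by (intro ennreal_mult[symmetric]) auto
  finally show ?thesis .
qed

section \<open>Constants and kernels for a fixed Hurst parameter\<close>

locale hurst =
  fixes H :: real
  assumes H: "1/2 < H" "H < 1"
begin

abbreviation "h \<equiv> (H + 1) / 2"
abbreviation "c \<equiv> rosenblatt_const H"

text \<open>The constant in front of the power in \<open>rho\<close>: it is \<open>c\<close> times h
  (2 h - 1) for h = (H + 1) / 2.\<close>

definition b :: real where "b = c * (H * (H + 1) / 2)"

lemma h: "1/2 < h" "h < 1" using H by auto

lemma c_pos: "0 < c" using H by (simp add: rosenblatt_const_def)

lemma b_pos: "0 < b" using H c_pos by (simp add: b_def)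

text \<open>This value makes the integral of the squared \<open>rho\<close> over a unit square equal
  to 1/2, so that the increments over unit intervals have variance one.\<close>

lemma b_sq: "b\<^sup>2 = H * (2 * H - 1) / 2"
proof -
  have "c\<^sup>2 = (1 / (H + 1))\<^sup>2 * (2 * (2 * H - 1) / H)"
    using H unfolding rosenblatt_const_def power_mult_distrib by (subst real_sqrt_pow2) auto
  then have "b\<^sup>2 = (1 / (H + 1))\<^sup>2 * (2 * (2 * H - 1) / H) * (H * (H + 1) / 2)\<^sup>2"
    by (simp only: b_def power_mult_distrib[of c])
  also have "\<dots> = H * (2 * H - 1) / 2"
    using H by (simp add: power2_eq_square divide_simps)
  finally show ?thesis .
qed

text \<open>The factor \<open>sqrt c\<close> absorbs the normalizing constant of the Rosenblatt kernel.\<close>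

definition ker :: "real \<Rightarrow> real \<Rightarrow> ennreal" where
  "ker u y = ennreal (sqrt c * fbm_deriv h u y)"

sublocale kernel_family ker
proof
  show "(\<lambda>(u, y). ker u y) \<in> borel_measurable (borel \<Otimes>\<^sub>M borel)"
    unfolding ker_def by measurable
qed

lemma rho_eq:
  assumes "0 < u" "0 < v" "u \<noteq> v"
  shows "rho u v = ennreal (b * \<bar>u - v\<bar> powr (H - 1))"
proof -
  have "rho u v = (\<integral>\<^sup>+y. ennreal c * (ennreal (fbm_deriv h u y) * ennreal (fbm_deriv h v y)) \<partial>lborel)"
    unfolding rho_def ker_def
  proof (intro nn_integral_cong)
    fix y
    have "ennreal (sqrt c * fbm_deriv h u y) * ennreal (sqrt c * fbm_deriv h v y) =
        ennreal ((sqrt c * sqrt c) * (fbm_deriv h u y * fbm_deriv h v y))"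
      using c_pos fbm_deriv_nonneg[OF h] by (subst ennreal_mult[symmetric]) (auto simp: mult_ac)
    also have "\<dots> = ennreal c * (ennreal (fbm_deriv h u y) * ennreal (fbm_deriv h v y))"
      using c_pos fbm_deriv_nonneg[OF h] by (simp add: ennreal_mult)
    finally show "ennreal (sqrt c * fbm_deriv h u y) * ennreal (sqrt c * fbm_deriv h v y) =
      ennreal c * (ennreal (fbm_deriv h u y) * ennreal (fbm_deriv h v y))" .
  qed
  also have "\<dots> = ennreal c * fbm_cov h u v"
    unfolding fbm_cov_def by (intro nn_integral_cmult) measurable
  also have "\<dots> = ennreal c * ennreal (h * (2 * h - 1) * \<bar>u - v\<bar> powr (2 * h - 2))"
    by (subst fbm_cov_eq[OF h assms]) simp
  also have "\<dots> = ennreal (b * \<bar>u - v\<bar> powr (H - 1))"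
  proof -
    have "h * (2 * h - 1) = H * (H + 1) / 2" "2 * h - 2 = H - 1" by (simp_all add: field_simps)
    then show ?thesis
      using c_pos H by (simp only: b_def mult.assoc) (subst ennreal_mult[symmetric], auto)
  qed
  finally show ?thesis .
qed

text \<open>The same \<open>c\<close> that normalizes the kernel reappears as the total weight of
  \<open>rho\<close> over a unit square, since 2 b = H (H + 1) c. This coincidence is what singles
  out \<open>4 * c\<close> as divisor in the diagonal entries.\<close>

lemma rho_integral:
  assumes "0 \<le> p"
  shows "(\<integral>\<^sup>+u. \<integral>\<^sup>+v. rho u v \<partial>unif p (p + 1) \<partial>unif p (p + 1)) = ennreal c"
proof -
  have "(\<integral>\<^sup>+u. \<integral>\<^sup>+v. rho u v \<partial>unif p (p + 1) \<partial>unif p (p + 1)) =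
      ennreal (b * (2 * (p + 1 - p) powr (H - 1 + 2) / ((H - 1 + 1) * (H - 1 + 2))))"
    using H b_pos assms by (intro nn_integral_unif_powr rho_eq) auto
  also have "\<dots> = ennreal (b * (2 / (H * (H + 1))))" by (simp add: add.commute)
  also have "b * (2 / (H * (H + 1))) = c"
  proof -
    have "H \<noteq> 0" "H + 1 \<noteq> 0" using H by auto
    then show ?thesis by (simp add: b_def)
  qed
  finally show ?thesis .
qed

lemma rho_square_integral:
  assumes "0 \<le> p" "p \<le> q"
  shows "(\<integral>\<^sup>+u. \<integral>\<^sup>+v. (rho u v)\<^sup>2 \<partial>unif p q \<partial>unif p q) = ennreal ((q - p) powr (2 * H) / 2)"
proof -
  have "(rho u v)\<^sup>2 = ennreal (b\<^sup>2 * \<bar>u - v\<bar> powr (2 * H - 2))" if "0 < u" "0 < v" "u \<noteq> v" for u v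
  proof -
    have "(\<bar>u - v\<bar> powr (H - 1))\<^sup>2 = \<bar>u - v\<bar> powr (2 * H - 2)"
      by (simp add: power2_eq_square flip: powr_add)
    then show ?thesis using b_pos that by (simp add: rho_eq ennreal_power power_mult_distrib)
  qed
  then have "(\<integral>\<^sup>+u. \<integral>\<^sup>+v. (rho u v)\<^sup>2 \<partial>unif p q \<partial>unif p q) =
      ennreal (b\<^sup>2 * (2 * (q - p) powr (2 * H - 2 + 2) / ((2 * H - 2 + 1) * (2 * H - 2 + 2))))"
    using H assms by (intro nn_integral_unif_powr) auto
  also have "b\<^sup>2 * (2 * (q - p) powr (2 * H - 2 + 2) / ((2 * H - 2 + 1) * (2 * H - 2 + 2))) = (q - p) powr (2 * H) / 2"
    using H unfolding b_sq by (simp add: field_simps)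
  finally show ?thesis .
qed

lemma mixture:
  assumes "p1 \<le> q1" "p2 \<le> q2" "p3 \<le> q3" "p4 \<le> q4"
  shows "kernel_mixture ker (unif p1 q1) (unif p2 q2) (unif p3 q3) (unif p4 q4)"
  by (intro kernel_mixture.intro kernel_mixture_axioms.intro kernel_family_axioms finite_unif assms sets_unif)

text \<open>\<open>enn2real\<close> sends the value \<infinity> to 0; for
  \<open>0 \<le> p \<le> q\<close> this affects only a null set.\<close>

definition inc_kernel :: "real \<Rightarrow> real \<Rightarrow> real \<times> real \<Rightarrow> real" where
  "inc_kernel p q = (\<lambda>(x, y). enn2real (mix (unif p q) x y))"

lemma mix_commute: "mix I x y = mix I y x"
  by (simp add: mix_def mult.commute)

lemma inc_kernel_commute: "inc_kernel p q (x, y) = inc_kernel p q (y, x)"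
  by (simp add: inc_kernel_def mix_commute)

lemma represents_inc_kernel:
  assumes pq: "0 \<le> p" "p \<le> q"
  shows "represents (inc_kernel p q) (mix (unif p q))"
    and "AE z in lborel. mix (unif p q) (fst z) (snd z) < \<infinity>"
proof -
  interpret K: kernel_mixture ker "unif p q" "unif p q" "unif p q" "unif p q" by (intro mixture pq)
  note [measurable] = K.mix_measurable
  have m: "inc_kernel p q \<in> borel_measurable (borel \<Otimes>\<^sub>M borel)"
    unfolding inc_kernel_def by measurable
  have "(\<integral>\<^sup>+z. (mix (unif p q) (fst z) (snd z))\<^sup>2 \<partial>lborel) =
      (\<integral>\<^sup>+x. \<integral>\<^sup>+y. mix (unif p q) x y * mix (unif p q) x y \<partial>lborel \<partial>lborel)"
    by (subst nn_integral_lborel_pair) (measurable, simp add: power2_eq_square)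
  also have "\<dots> = ennreal ((q - p) powr (2 * H) / 2)"
    unfolding K.mix_inner by (rule rho_square_integral[OF pq])
  finally have fin: "(\<integral>\<^sup>+z. (mix (unif p q) (fst z) (snd z))\<^sup>2 \<partial>lborel) < \<infinity>" by simp
  have "AE z in lborel. (mix (unif p q) (fst z) (snd z))\<^sup>2 \<noteq> \<infinity>"
  proof (rule nn_integral_PInf_AE)
    show "(\<lambda>z. (mix (unif p q) (fst z) (snd z))\<^sup>2) \<in> borel_measurable lborel"
      by (simp add: borel_prod[symmetric])
  qed (use fin in auto)
  then show AE: "AE z in lborel. mix (unif p q) (fst z) (snd z) < \<infinity>"
    by (rule eventually_mono) (auto simp: ennreal_mult_less_top power2_eq_square top.not_eq_extremum)
  then have eq: "AE z in lborel. ennreal (inc_kernel p q z) = mix (unif p q) (fst z) (snd z)"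
    by (rule eventually_mono) (auto simp: inc_kernel_def case_prod_beta)
  have "(\<integral>\<^sup>+z. ennreal ((inc_kernel p q z)\<^sup>2) \<partial>lborel) = (\<integral>\<^sup>+z. (mix (unif p q) (fst z) (snd z))\<^sup>2 \<partial>lborel)"
  proof (intro nn_integral_cong_AE, use eq in eventually_elim)
    fix z assume e: "ennreal (inc_kernel p q z) = mix (unif p q) (fst z) (snd z)"
    show "ennreal ((inc_kernel p q z)\<^sup>2) = (mix (unif p q) (fst z) (snd z))\<^sup>2"
      unfolding e[symmetric] by (simp add: ennreal_power inc_kernel_def case_prod_beta)
  qed
  then have "L2 lborel (inc_kernel p q)"
    using m fin by (simp add: L2_iff_nn_integral borel_prod)
  then show "represents (inc_kernel p q) (mix (unif p q))"
    unfolding represents_def using eq by (auto simp: inc_kernel_def)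
qed

lemma rosenblatt_kernel_eq:
  assumes t: "0 \<le> t" and xy: "0 < x" "0 < y"
  shows "rosenblatt_kernel H t (x, y) = inc_kernel 0 t (x, y)"
proof -
  have m: "(\<lambda>u. fbm_deriv h u x * fbm_deriv h u y) \<in> borel_measurable borel" by measurable
  have nn: "0 \<le> fbm_deriv h u x * fbm_deriv h u y" for u using fbm_deriv_nonneg[OF h] by simp
  have mixeq: "mix (unif 0 t) x y = ennreal c * (\<integral>\<^sup>+u. ennreal (fbm_deriv h u x * fbm_deriv h u y * indicator {0<..t} u) \<partial>lborel)"
  proof -
    have "mix (unif 0 t) x y = (\<integral>\<^sup>+u. ker u x * ker u y * indicator {0<..t} u \<partial>lborel)"
      unfolding mix_def by (rule nn_integral_unif) measurable
    also have "\<dots> = (\<integral>\<^sup>+u. ennreal c * ennreal (fbm_deriv h u x * fbm_deriv h u y * indicator {0<..t} u) \<partial>lborel)"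
    proof (intro nn_integral_cong)
      fix u
      have "ker u x * ker u y = ennreal ((sqrt c * sqrt c) * (fbm_deriv h u x * fbm_deriv h u y))"
        unfolding ker_def using c_pos fbm_deriv_nonneg[OF h] by (subst ennreal_mult[symmetric]) (auto simp: mult_ac)
      then have "ker u x * ker u y = ennreal c * ennreal (fbm_deriv h u x * fbm_deriv h u y)"
        using c_pos nn by (simp add: ennreal_mult)
      then show "ker u x * ker u y * indicator {0<..t} u = ennreal c * ennreal (fbm_deriv h u x * fbm_deriv h u y * indicator {0<..t} u)"
        by (simp add: indicator_def)
    qed
    also have "\<dots> = ennreal c * (\<integral>\<^sup>+u. ennreal (fbm_deriv h u x * fbm_deriv h u y * indicator {0<..t} u) \<partial>lborel)"
      using m by (intro nn_integral_cmult) measurable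
    finally show ?thesis .
  qed
  have "inc_kernel 0 t (x, y) = c * enn2real (\<integral>\<^sup>+u. ennreal (fbm_deriv h u x * fbm_deriv h u y * indicator {0<..t} u) \<partial>lborel)"
    using c_pos by (simp add: inc_kernel_def mixeq enn2real_mult)
  also have "\<dots> = c * (\<integral>u. fbm_deriv h u x * fbm_deriv h u y * indicator {0<..t} u \<partial>lborel)"
    using m nn by (subst integral_eq_nn_integral) auto
  also have "\<dots> = rosenblatt_kernel H t (x, y)"
  proof (cases "x \<le> t \<and> y \<le> t")
    case True
    have "(LBINT u:{max x y..t}. fbm_kernel_deriv h u x * fbm_kernel_deriv h u y) =
      (\<integral>u. fbm_deriv h u x * fbm_deriv h u y * indicator {0<..t} u \<partial>lborel)"
      unfolding set_lebesgue_integral_def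
    proof (rule integral_cong_AE)
      show eq: "AE u in lborel. indicat_real {max x y..t} u *\<^sub>R (fbm_kernel_deriv h u x * fbm_kernel_deriv h u y) =
          fbm_deriv h u x * fbm_deriv h u y * indicat_real {0<..t} u"
        using AE_lborel_singleton[of x] AE_lborel_singleton[of y]
      proof eventually_elim
        fix u assume "u \<noteq> x" "u \<noteq> y"
        show "indicat_real {max x y..t} u *\<^sub>R (fbm_kernel_deriv h u x * fbm_kernel_deriv h u y) =
          fbm_deriv h u x * fbm_deriv h u y * indicat_real {0<..t} u"
        proof (cases "x < u \<and> y < u")
          case True
          then show ?thesis using xy fbm_kernel_deriv_eq[OF h(1), of x u] fbm_kernel_deriv_eq[OF h(1), of y u]
            by (auto simp: indicator_def)
        next
          case False
          then show ?thesis using \<open>u \<noteq> x\<close> \<open>u \<noteq> y\<close> by (auto simp: fbm_deriv_def indicator_def)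
        qed
      qed
      show "(\<lambda>u. fbm_deriv h u x * fbm_deriv h u y * indicat_real {0<..t} u) \<in> borel_measurable lborel"
        using m by measurable
      \<comment> \<open>At \<open>u = max x y\<close> nothing is known about the value of the
        derivative. Everywhere else the integrand equals the closed form, so it is a measurable
        function altered at a single point.\<close>
      have *: "(\<lambda>u. indicat_real {max x y..t} u *\<^sub>R (fbm_kernel_deriv h u x * fbm_kernel_deriv h u y)) =
        (\<lambda>u. if u = max x y then indicat_real {max x y..t} u *\<^sub>R (fbm_kernel_deriv h (max x y) x * fbm_kernel_deriv h (max x y) y)
          else fbm_deriv h u x * fbm_deriv h u y * indicat_real {0<..t} u)"
      proof
        fix u
        show "indicat_real {max x y..t} u *\<^sub>R (fbm_kernel_deriv h u x * fbm_kernel_deriv h u y) =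
          (if u = max x y then indicat_real {max x y..t} u *\<^sub>R (fbm_kernel_deriv h (max x y) x * fbm_kernel_deriv h (max x y) y)
          else fbm_deriv h u x * fbm_deriv h u y * indicat_real {0<..t} u)"
        proof (cases "max x y < u")
          case True
          then show ?thesis using xy fbm_kernel_deriv_eq[OF h(1), of x u] fbm_kernel_deriv_eq[OF h(1), of y u]
            by (auto simp: indicator_def)
        next
          case False
          then show ?thesis by (auto simp: fbm_deriv_def indicator_def max_def split: if_splits)
        qed
      qed
      show "(\<lambda>u. indicat_real {max x y..t} u *\<^sub>R (fbm_kernel_deriv h u x * fbm_kernel_deriv h u y)) \<in> borel_measurable lborel"
        unfolding * using m by measurable
    qed
    then show ?thesis using True xy by (simp add: rosenblatt_kernel_def)
  next
    case False
    then have "fbm_deriv h u x * fbm_deriv h u y * indicator {0<..t} u = 0" for u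
      by (auto simp: fbm_deriv_def indicator_def)
    then have "(\<integral>u. fbm_deriv h u x * fbm_deriv h u y * indicator {0<..t} u \<partial>lborel) = 0"
      by (simp only:) simp
    then show ?thesis using False by (auto simp: rosenblatt_kernel_def)
  qed
  finally show ?thesis by simp
qed

lemma mix_unif_add:
  assumes "0 \<le> p" "p \<le> q"
  shows "mix (unif 0 q) x y = mix (unif 0 p) x y + mix (unif p q) x y"
proof -
  have *: "mix (unif p q) x y = (\<integral>\<^sup>+u. ker u x * ker u y * indicator {p<..q} u \<partial>lborel)" for p q
    unfolding mix_def by (rule nn_integral_unif) measurable
  show ?thesis unfolding *
    using assms by (subst nn_integral_add[symmetric]) (measurable, auto intro!: nn_integral_cong simp: indicator_def)
qed

lemma AE_coordinates_nonzero:
  "AE z in lborel. fst z \<noteq> 0 \<and> snd (z :: real \<times> real) \<noteq> 0"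
  by (intro AE_lborel_pairI AE_lborel_singleton)

lemma inc_kernel_neg: "x \<le> 0 \<or> y \<le> 0 \<Longrightarrow> inc_kernel p q (x, y) = 0"
  by (auto simp: inc_kernel_def mix_def ker_def fbm_deriv_def)

lemma rosenblatt_kernel_AE:
  assumes t: "0 \<le> t"
  shows "AE z in lborel. rosenblatt_kernel H t z = inc_kernel 0 t z"
  using AE_coordinates_nonzero
proof eventually_elim
  fix z :: "real \<times> real" assume z: "fst z \<noteq> 0 \<and> snd z \<noteq> 0"
  obtain x y where [simp]: "z = (x, y)" by (cases z)
  show "rosenblatt_kernel H t z = inc_kernel 0 t z"
  proof (cases "0 < x \<and> 0 < y")
    case False
    then have "x < 0 \<or> y < 0" using z by auto
    then show ?thesis using inc_kernel_neg[of x y 0 t] by (auto simp: rosenblatt_kernel_def)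
  qed (use rosenblatt_kernel_eq[OF t] in auto)
qed

text \<open>The mixtures over adjacent intervals add up everywhere, but \<open>enn2real\<close> is
  additive only where they are finite, hence the almost everywhere statement.\<close>

lemma inc_kernel_diff_AE:
  assumes "0 \<le> p" "p \<le> q"
  shows "AE z in lborel. rosenblatt_kernel H q z - rosenblatt_kernel H p z = inc_kernel p q z"
proof -
  have q: "0 \<le> q" using assms by simp
  show ?thesis
    using rosenblatt_kernel_AE[OF q] rosenblatt_kernel_AE[OF assms(1)]
      represents_inc_kernel(2)[OF assms] represents_inc_kernel(2)[OF order_refl assms(1)]
    by eventually_elim (auto simp: inc_kernel_def case_prod_beta mix_unif_add[OF assms] enn2real_plus)
qed

lemma inc_kernel_norm:
  assumes "0 \<le> p" "p \<le> q"
  shows "(\<integral>z. inc_kernel p q z * inc_kernel p q z \<partial>lborel) = (q - p) powr (2 * H) / 2"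
proof -
  interpret K: kernel_mixture ker "unif p q" "unif p q" "unif p q" "unif p q" by (intro mixture assms)
  have "ennreal (\<integral>z. inc_kernel p q z * inc_kernel p q z \<partial>lborel) = ennreal ((q - p) powr (2 * H) / 2)"
    using represents_inner[OF represents_inc_kernel(1)[OF assms] represents_inc_kernel(1)[OF assms]]
    by (simp add: K.mix_inner rho_square_integral assms)
  then show ?thesis by (subst (asm) ennreal_inj) auto
qed

end

subsection \<open>Moments of the Rosenblatt increments\<close>

context hurst
begin

abbreviation "U j \<equiv> unif (real j) (real j + 1)"
abbreviation "f j \<equiv> inc_kernel (real j) (real j + 1)"

text \<open>Points of two cells at distance \<open>r\<close> are between \<open>r - 1\<close> and
  \<open>r + 1\<close> apart, and \<open>rho\<close> decreases with the distance. The condition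
  \<open>2 \<le> r\<close> keeps the lower end positive.\<close>

lemma rho_bounds:
  assumes r: "\<bar>real j - real l\<bar> = r" "2 \<le> r"
    and u: "real j < u \<and> u \<le> real j + 1" and v: "real l < v \<and> v \<le> real l + 1"
  shows "rho u v \<le> ennreal (b * (r - 1) powr (H - 1))" "ennreal (b * (r + 1) powr (H - 1)) \<le> rho u v"
proof -
  have d: "r - 1 \<le> \<bar>u - v\<bar>" "\<bar>u - v\<bar> \<le> r + 1" using assms by linarith+
  have pos: "0 < u" "0 < v" "u \<noteq> v" using u v d r by auto
  show "rho u v \<le> ennreal (b * (r - 1) powr (H - 1))"
    unfolding rho_eq[OF pos] using H b_pos d r
    by (intro ennreal_leI mult_left_mono powr_mono2') auto
  show "ennreal (b * (r + 1) powr (H - 1)) \<le> rho u v"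
    unfolding rho_eq[OF pos] using H b_pos d r
    by (intro ennreal_leI mult_left_mono powr_mono2') auto
qed

lemma nn_integral_U_const: "(\<integral>\<^sup>+u. C \<partial>U j) = C"
  by (simp add: emeasure_unif)

lemma nn_integral_U_le: "(\<And>u. real j < u \<and> u \<le> real j + 1 \<Longrightarrow> g u \<le> C) \<Longrightarrow> (\<integral>\<^sup>+u. g u \<partial>U j) \<le> C"
proof -
  assume g: "\<And>u. real j < u \<and> u \<le> real j + 1 \<Longrightarrow> g u \<le> C"
  have "(\<integral>\<^sup>+u. g u \<partial>U j) \<le> (\<integral>\<^sup>+u. C \<partial>U j)"
    by (rule nn_integral_mono_AE, rule eventually_mono[OF AE_unif g])
  then show ?thesis by (simp only: nn_integral_U_const)
qed

lemma nn_integral_U_mono: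
  "(\<And>u. real j < u \<and> u \<le> real j + 1 \<Longrightarrow> g u \<le> g' u) \<Longrightarrow> (\<integral>\<^sup>+u. g u \<partial>U j) \<le> (\<integral>\<^sup>+u. g' u \<partial>U j)"
  by (rule nn_integral_mono_AE, rule eventually_mono[OF AE_unif])

lemma mixture_U: "kernel_mixture ker (U i) (U j) (U k) (U l)"
  by (intro mixture) auto

lemma represents_f: "represents (f j) (mix (U j))"
  by (intro represents_inc_kernel) auto

lemma represents_kgram_f: "represents (kgram (f j) (f l)) (mix_gram (U j) (U l))"
  using represents_kgram[OF represents_f[of j] represents_f[of l] inc_kernel_commute inc_kernel_commute mix_commute mix_commute]
  unfolding mix_gram_def[abs_def] .

context
  fixes j l :: nat and r :: real
  assumes r: "\<bar>real j - real l\<bar> = r" "2 \<le> r"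
begin

text \<open>Upper and, with \<open>E\<close>, lower bound of \<open>rho\<close> between the cells
  \<open>j\<close> and \<open>l\<close>. Both depend on \<open>r\<close> alone, but their defining
  equations carry the assumptions of the context, which is why later uses discharge them.\<close>

definition "D = b * (r - 1) powr (H - 1)"
definition "E = b * (r + 1) powr (H - 1)"

lemma DE_nonneg: "0 \<le> D" "0 \<le> E" using b_pos by (simp_all add: D_def E_def)

lemma rho_jl:
  assumes "real j < u \<and> u \<le> real j + 1" "real l < v \<and> v \<le> real l + 1"
  shows "rho u v \<le> ennreal D" "rho v u \<le> ennreal D" "ennreal E \<le> rho u v" "ennreal E \<le> rho v u"
proof -
  have "rho v u = rho u v" by (simp add: rho_def mult.commute)
  then show "rho u v \<le> ennreal D" "rho v u \<le> ennreal D" "ennreal E \<le> rho u v" "ennreal E \<le> rho v u"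
    using rho_bounds[OF r assms] by (simp_all add: D_def E_def)
qed

lemma f_inner_le: "(\<integral>z. f j z * f l z \<partial>lborel) \<le> D\<^sup>2"
proof -
  interpret K: kernel_mixture ker "U j" "U l" "U j" "U l" by (rule mixture_U)
  have "ennreal (\<integral>z. f j z * f l z \<partial>lborel) = (\<integral>\<^sup>+u. \<integral>\<^sup>+v. (rho u v)\<^sup>2 \<partial>U l \<partial>U j)"
    by (simp add: represents_inner[OF represents_f represents_f] K.mix_inner)
  also have "\<dots> \<le> (ennreal D)\<^sup>2"
    by (intro nn_integral_U_le power_mono rho_jl) auto
  finally show ?thesis using DE_nonneg by (simp add: ennreal_power ennreal_le_iff)
qed

text \<open>The edge of the triangle inside cell \<open>j\<close> is integrated exactly and gives
  \<open>c\<close>; the two edges leading to cell \<open>l\<close> are replaced by \<open>E\<close>.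
  A lower bound is wanted because this moment enters the covariance of the errors with a negative
  sign.\<close>

lemma kgram_inner_mix_ge: "c * E\<^sup>2 \<le> (\<integral>z. kgram (f j) (f j) z * f l z \<partial>lborel)"
proof -
  interpret K: kernel_mixture ker "U j" "U j" "U l" "U l" by (rule mixture_U)
  have "ennreal c * (ennreal E * ennreal E) = (\<integral>\<^sup>+u. \<integral>\<^sup>+v. rho u v * (ennreal E * ennreal E) \<partial>U j \<partial>U j)"
    unfolding rho_integral[of "real j", symmetric, simplified]
    by (subst nn_integral_multc, measurable, subst nn_integral_multc, measurable)
  also have "\<dots> = (\<integral>\<^sup>+u. \<integral>\<^sup>+v. \<integral>\<^sup>+w. rho u v * (ennreal E * ennreal E) \<partial>U l \<partial>U j \<partial>U j)"
    by (simp only: nn_integral_U_const)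
  also have "\<dots> \<le> (\<integral>\<^sup>+u. \<integral>\<^sup>+v. \<integral>\<^sup>+w. rho u v * (rho u w * rho v w) \<partial>U l \<partial>U j \<partial>U j)"
    by (intro nn_integral_U_mono mult_left_mono mult_mono rho_jl) auto
  also have "\<dots> = ennreal (\<integral>z. kgram (f j) (f j) z * f l z \<partial>lborel)"
    by (simp add: represents_inner[OF represents_kgram_f represents_f] K.mix_gram_inner_mix)
  finally have "ennreal (c * E\<^sup>2) \<le> ennreal (\<integral>z. kgram (f j) (f j) z * f l z \<partial>lborel)"
    using DE_nonneg c_pos by (simp add: ennreal_mult power2_eq_square)
  moreover have "0 \<le> (\<integral>z. kgram (f j) (f j) z * f l z \<partial>lborel)"
    using represents_f[of l] represents_kgram_f[of j j] by (auto simp: represents_def intro!: integral_nonneg_AE)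
  ultimately show ?thesis by (simp add: ennreal_le_iff)
qed

text \<open>Of the four edges of the cycle, one lies inside each cell and contributes
  \<open>c\<close>; the two crossing edges are bounded by \<open>D\<close>.\<close>

lemma kgram_inner_diag_le: "(\<integral>z. kgram (f j) (f j) z * kgram (f l) (f l) z \<partial>lborel) \<le> c\<^sup>2 * D\<^sup>2"
proof -
  interpret K: kernel_mixture ker "U j" "U j" "U l" "U l" by (rule mixture_U)
  have "ennreal (\<integral>z. kgram (f j) (f j) z * kgram (f l) (f l) z \<partial>lborel) =
      (\<integral>\<^sup>+u. \<integral>\<^sup>+v. \<integral>\<^sup>+u'. \<integral>\<^sup>+v'. rho u v * rho u' v' * (rho u u' * rho v v') \<partial>U l \<partial>U l \<partial>U j \<partial>U j)"
    by (simp add: represents_inner[OF represents_kgram_f represents_kgram_f] K.mix_gram_inner[OF mixture_U])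
  also have "\<dots> \<le> (\<integral>\<^sup>+u. \<integral>\<^sup>+v. \<integral>\<^sup>+u'. \<integral>\<^sup>+v'. rho u v * rho u' v' * (ennreal D * ennreal D) \<partial>U l \<partial>U l \<partial>U j \<partial>U j)"
    by (intro nn_integral_U_mono mult_left_mono mult_mono rho_jl) auto
  also have "\<dots> = (\<integral>\<^sup>+u. \<integral>\<^sup>+v. rho u v * (ennreal c * (ennreal D * ennreal D)) \<partial>U j \<partial>U j)"
    unfolding rho_integral[of "real l", symmetric, simplified] mult.assoc
    by (subst nn_integral_cmult, measurable, subst nn_integral_cmult, measurable,
        subst nn_integral_multc, measurable, subst nn_integral_multc, measurable)
  also have "\<dots> = ennreal c * (ennreal c * (ennreal D * ennreal D))"
    by (subst nn_integral_multc, measurable, subst nn_integral_multc, measurable, simp add: rho_integral)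
  also have "\<dots> = ennreal (c\<^sup>2 * D\<^sup>2)"
    using DE_nonneg c_pos by (simp add: ennreal_mult power2_eq_square mult_ac)
  finally show ?thesis by (simp add: ennreal_le_iff)
qed

text \<open>Here the edges inside the cells join u to u' and v to v'. Once the crossing edges are
  bounded, the fourfold integral factors into the two cell integrals, each equal to
  \<open>c\<close>.\<close>

lemma kgram_inner_same_le: "(\<integral>z. kgram (f j) (f l) z * kgram (f j) (f l) z \<partial>lborel) \<le> c\<^sup>2 * D\<^sup>2"
proof -
  interpret K: kernel_mixture ker "U j" "U l" "U j" "U l" by (rule mixture_U)
  have "ennreal (\<integral>z. kgram (f j) (f l) z * kgram (f j) (f l) z \<partial>lborel) =
      (\<integral>\<^sup>+u. \<integral>\<^sup>+v. \<integral>\<^sup>+u'. \<integral>\<^sup>+v'. rho u v * rho u' v' * (rho u u' * rho v v') \<partial>U l \<partial>U j \<partial>U l \<partial>U j)"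
    by (simp add: represents_inner[OF represents_kgram_f represents_kgram_f] K.mix_gram_inner[OF mixture_U])
  also have "\<dots> \<le> (\<integral>\<^sup>+u. \<integral>\<^sup>+v. \<integral>\<^sup>+u'. \<integral>\<^sup>+v'. (ennreal D * ennreal D) * (rho u u' * rho v v') \<partial>U l \<partial>U j \<partial>U l \<partial>U j)"
    by (intro nn_integral_U_mono mult_right_mono mult_mono rho_jl) auto
  also have "\<dots> = (\<integral>\<^sup>+u. \<integral>\<^sup>+v. (ennreal D * ennreal D) * ((\<integral>\<^sup>+u'. rho u u' \<partial>U j) * (\<integral>\<^sup>+v'. rho v v' \<partial>U l)) \<partial>U l \<partial>U j)"
    by (subst nn_integral_cmult, measurable, subst nn_integral_cmult, measurable,
        subst nn_integral_cmult, measurable, subst nn_integral_multc, measurable)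
  also have "\<dots> = (ennreal D * ennreal D) * ((\<integral>\<^sup>+u. \<integral>\<^sup>+u'. rho u u' \<partial>U j \<partial>U j) * (\<integral>\<^sup>+v. \<integral>\<^sup>+v'. rho v v' \<partial>U l \<partial>U l))"
    by (subst nn_integral_cmult, measurable, subst nn_integral_cmult, measurable,
        subst nn_integral_cmult, measurable, subst nn_integral_multc, measurable)
  also have "\<dots> = ennreal (c\<^sup>2 * D\<^sup>2)"
    using DE_nonneg c_pos by (simp add: rho_integral ennreal_mult power2_eq_square mult_ac)
  finally show ?thesis by (simp add: ennreal_le_iff)
qed

text \<open>The vertices alternate between the two cells, so all four edges are crossing. This is
  the contribution of the smaller order \<open>r powr (4 * H - 4)\<close>.\<close>

lemma kgram_inner_cross_le: "(\<integral>z. kgram (f j) (f l) z * kgram (f l) (f j) z \<partial>lborel) \<le> D ^ 4"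
proof -
  interpret K: kernel_mixture ker "U j" "U l" "U l" "U j" by (rule mixture_U)
  have "ennreal (\<integral>z. kgram (f j) (f l) z * kgram (f l) (f j) z \<partial>lborel) =
      (\<integral>\<^sup>+u. \<integral>\<^sup>+v. \<integral>\<^sup>+u'. \<integral>\<^sup>+v'. rho u v * rho u' v' * (rho u u' * rho v v') \<partial>U j \<partial>U l \<partial>U l \<partial>U j)"
    by (simp add: represents_inner[OF represents_kgram_f represents_kgram_f] K.mix_gram_inner[OF mixture_U])
  also have "\<dots> \<le> ennreal D * ennreal D * (ennreal D * ennreal D)"
    by (intro nn_integral_U_le mult_mono rho_jl) auto
  also have "\<dots> = ennreal (D ^ 4)"
    using DE_nonneg by (simp add: ennreal_mult[symmetric] power4_eq_xxxx mult_ac)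
  finally show ?thesis by (simp add: ennreal_le_iff)
qed

end

lemma f_norm: "(\<integral>z. f j z * f j z \<partial>lborel) = 1 / 2"
  using inc_kernel_norm[of "real j" "real j + 1"] by simp

lemma f_inner_nonneg: "0 \<le> (\<integral>z. f j z * f l z \<partial>lborel)"
  using represents_f by (auto simp: represents_def intro!: integral_nonneg_AE)

end

lemma (in brownian) wiener2_mean:
  assumes "wiener2 M B g Y"
  shows "(\<integral>\<omega>. Y \<omega> \<partial>M) = 0"
proof -
  obtain m s a where a: "\<And>r. sym_step (m r) (s r) (a r)"
     "L2_tendsto M (\<lambda>r. step_integral B (m r) (s r) (a r)) Y"
    using assms by (auto simp: wiener2_def)
  have "L2 M (\<lambda>_. 1)" by (simp add: L2_def)
  from L2_tendsto_integral_mult[OF a(2) L2_tendsto_const[OF this]]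
  have "(\<lambda>r. \<integral>\<omega>. step_integral B (m r) (s r) (a r) \<omega> \<partial>M) \<longlonglongrightarrow> (\<integral>\<omega>. Y \<omega> \<partial>M)" by simp
  moreover have "(\<integral>\<omega>. step_integral B (m r) (s r) (a r) \<omega> \<partial>M) = 0" for r
  proof -
    interpret brownian_steps M B "m r" "s r" "a r" "a r" by unfold_locales (rule a)+
    show ?thesis unfolding step_integral_quad[OF s] G.quad_expectation(2) by (rule G.trace0)
  qed
  ultimately show ?thesis by (simp add: LIMSEQ_const_iff)
qed

locale rosenblatt = hurst H + brownian M B for H and M :: "'a measure" and B +
  fixes Z :: "real \<Rightarrow> 'a \<Rightarrow> real"
  assumes Z: "rosenblatt_process M B H Z"
begin

lemma wiener2_Z: "0 \<le> t \<Longrightarrow> wiener2 M B (rosenblatt_kernel H t) (Z t)"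
  using Z by (intro has_double_wiener_integral_wiener2)
    (auto simp: rosenblatt_process_def rosenblatt_kernel_def mult.commute max.commute indicator_def)

definition X :: "nat \<Rightarrow> 'a \<Rightarrow> real" where
  "X j \<omega> = Z (real j + 1) \<omega> - Z (real j) \<omega>"

lemma wiener2_X: "wiener2 M B (f j) (X j)"
proof -
  have "wiener2 M B (\<lambda>z. rosenblatt_kernel H (real j + 1) z - rosenblatt_kernel H (real j) z) (X j)"
    unfolding X_def by (intro wiener2_diff wiener2_Z) auto
  then show ?thesis
    using represents_f[of j] inc_kernel_diff_AE[of "real j" "real j + 1"]
    by (elim wiener2_cong_AE) (auto simp: represents_def L2_def)
qed

lemma L2_X: "L2 M (X j)" "L2 M (\<lambda>\<omega>. (X j \<omega>)\<^sup>2)"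
  using wiener2_L2(2)[OF wiener2_X] wiener2_hypercontractive(1)[OF wiener2_X] by auto

lemma X_second_moment: "(\<integral>\<omega>. (X j \<omega>)\<^sup>2 \<partial>M) = 1"
  using wiener2_covariance[OF wiener2_X wiener2_X, of j j] by (simp add: f_norm power2_eq_square)

lemma X_covariance: "(\<integral>\<omega>. X j \<omega> * X l \<omega> \<partial>M) = 2 * (\<integral>z. f j z * f l z \<partial>lborel)"
  by (rule wiener2_covariance[OF wiener2_X wiener2_X])

lemma X_covariance_bounds:
  "0 \<le> (\<integral>\<omega>. X j \<omega> * X l \<omega> \<partial>M)" "(\<integral>\<omega>. X j \<omega> * X l \<omega> \<partial>M) \<le> 1"
proof -
  show "0 \<le> (\<integral>\<omega>. X j \<omega> * X l \<omega> \<partial>M)" unfolding X_covariance using f_inner_nonneg by simp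
  show "(\<integral>\<omega>. X j \<omega> * X l \<omega> \<partial>M) \<le> 1"
    using abs_integral_mult_L2_le[OF L2_X(1)[of j] L2_X(1)[of l]] by (simp add: X_second_moment)
qed

text \<open>Up to \<open>Z 0 = 0\<close>, the sum of the first \<open>d\<close> terms \<open>xi j\<close> is \<open>d powr H\<close> times the difference between a
  diagonal entry of the renormalized matrix and \<open>d powr (- H) * Z d\<close>.\<close>

definition xi :: "nat \<Rightarrow> 'a \<Rightarrow> real" where
  "xi j \<omega> = ((X j \<omega>)\<^sup>2 - 1) / (4 * c) - X j \<omega>"

lemma L2_one: "L2 M (\<lambda>_. C)" by (simp add: L2_def)

lemma L2_xi: "L2 M (xi j)"
  unfolding xi_def[abs_def] divide_inverse mult.commute[of _ "inverse _"]
  by (intro L2_diff L2_cmult L2_X L2_one)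

lemma xi_second_moment: "(\<integral>\<omega>. (xi j \<omega>)\<^sup>2 \<partial>M) \<le> 28 / (16 * c\<^sup>2) + 2"
proof -
  have L: "L2 M (\<lambda>\<omega>. (X j \<omega>)\<^sup>2 - 1)" by (intro L2_diff L2_X L2_one)
  have L': "L2 M (\<lambda>\<omega>. ((X j \<omega>)\<^sup>2 - 1) / (4 * c))"
    using L2_cmult[OF L, of "1 / (4 * c)"] by simp
  have "(\<integral>\<omega>. ((X j \<omega>)\<^sup>2 - 1)\<^sup>2 \<partial>M) = (\<integral>\<omega>. ((X j \<omega>) ^ 4 - 2 * (X j \<omega>)\<^sup>2) + 1 \<partial>M)"
    by (intro Bochner_Integration.integral_cong refl) (simp add: power2_diff flip: power_mult)
  also have "\<dots> = (\<integral>\<omega>. (X j \<omega>) ^ 4 \<partial>M) - 2 * (\<integral>\<omega>. (X j \<omega>)\<^sup>2 \<partial>M) + 1"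
    using L2_X[of j] by (simp add: L2_def prob_space flip: power_mult)
  \<comment> \<open>With unit second moment the fourth moment is at most 15, and 15 - 2 + 1 =
    14.\<close>
  also have "\<dots> \<le> 14"
    using wiener2_hypercontractive(2)[OF wiener2_X, of j] by (simp add: X_second_moment)
  finally have A: "(\<integral>\<omega>. ((X j \<omega>)\<^sup>2 - 1)\<^sup>2 \<partial>M) \<le> 14" .
  have "(\<integral>\<omega>. (xi j \<omega>)\<^sup>2 \<partial>M) \<le> 2 * (\<integral>\<omega>. (((X j \<omega>)\<^sup>2 - 1) / (4 * c))\<^sup>2 \<partial>M) + 2 * (\<integral>\<omega>. (- X j \<omega>)\<^sup>2 \<partial>M)"
    using integral_square_add_le[OF L' L2_cmult[OF L2_X(1)[of j], of "-1"]] by (simp add: xi_def)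
  also have "\<dots> = 2 * (1 / (16 * c\<^sup>2) * (\<integral>\<omega>. ((X j \<omega>)\<^sup>2 - 1)\<^sup>2 \<partial>M)) + 2"
    by (simp add: power_divide power_mult_distrib X_second_moment)
  also have "\<dots> \<le> 2 * (1 / (16 * c\<^sup>2) * 14) + 2"
    using A by (intro add_mono mult_left_mono) auto
  finally show ?thesis by simp
qed

text \<open>With k = 1 / (4 c), the terms of leading order are 32 c^2 k^2 D^2 = 2 D^2 from the
  squares, - 16 c k E^2 = - 4 E^2 from the mixed third moments and 2 D^2 from the covariance. They
  sum to 4 (D^2 - E^2), and D and E differ only by the shifts of \<open>r\<close>. The remaining 24
  k^2 D^4 collects 8 from the squared inner product and 16 from the alternating cycle.\<close>

lemma xi_covariance_le:
  assumes r: "\<bar>real j - real l\<bar> = r" "2 \<le> r"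
  shows "(\<integral>\<omega>. xi j \<omega> * xi l \<omega> \<partial>M) \<le>
    4 * b\<^sup>2 * ((r - 1) powr (2 * H - 2) - (r + 1) powr (2 * H - 2)) + 3 / 2 * (b ^ 4 / c\<^sup>2) * (r - 1) powr (4 * H - 4)"
proof -
  define DD where "DD = D r"
  define EE where "EE = E r"
  define T where "T = (\<integral>z. f j z * f l z \<partial>lborel)"
  have r': "\<bar>real l - real j\<bar> = r" using r by linarith
  have T: "0 \<le> T" "T \<le> DD\<^sup>2"
    using f_inner_nonneg f_inner_le[OF r] by (auto simp: T_def DD_def)
  have T2: "T\<^sup>2 \<le> DD ^ 4" using power_mono[OF T(2) T(1), of 2] by (simp flip: power_mult)
  have m22: "(\<integral>\<omega>. (X j \<omega>)\<^sup>2 * (X l \<omega>)\<^sup>2 \<partial>M) \<le> 1 + 24 * DD ^ 4 + 32 * (c\<^sup>2 * DD\<^sup>2)"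
    unfolding wiener2_moments(2)[OF wiener2_X wiener2_X] f_norm T_def[symmetric]
    using kgram_inner_diag_le[OF r] kgram_inner_same_le[OF r] kgram_inner_cross_le[OF r] T2
    unfolding DD_def by linarith
  have m21: "8 * (c * EE\<^sup>2) \<le> (\<integral>\<omega>. (X j \<omega>)\<^sup>2 * X l \<omega> \<partial>M)" "8 * (c * EE\<^sup>2) \<le> (\<integral>\<omega>. (X l \<omega>)\<^sup>2 * X j \<omega> \<partial>M)"
    unfolding wiener2_moments(1)[OF wiener2_X wiener2_X] EE_def
    using kgram_inner_mix_ge[OF r] kgram_inner_mix_ge[OF r' r(2)] by linarith+
  have m11: "(\<integral>\<omega>. X j \<omega> * X l \<omega> \<partial>M) \<le> 2 * DD\<^sup>2"
    unfolding X_covariance T_def[symmetric] using T by simp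
  let ?k = "1 / (4 * c)"
  have i: "integrable M (\<lambda>\<omega>. (X j \<omega>)\<^sup>2 * (X l \<omega>)\<^sup>2)" "integrable M (\<lambda>\<omega>. (X j \<omega>)\<^sup>2)" "integrable M (\<lambda>\<omega>. (X l \<omega>)\<^sup>2)"
    "integrable M (\<lambda>\<omega>. (X j \<omega>)\<^sup>2 * X l \<omega>)" "integrable M (\<lambda>\<omega>. (X l \<omega>)\<^sup>2 * X j \<omega>)"
    "integrable M (X j)" "integrable M (X l)" "integrable M (\<lambda>\<omega>. X j \<omega> * X l \<omega>)"
    using L2_X[of j] L2_X[of l] by (auto intro: L2_integrable_mult L2_integrable_square abs_integral_le_L2)
  have "(\<integral>\<omega>. xi j \<omega> * xi l \<omega> \<partial>M) =
     (\<integral>\<omega>. ?k\<^sup>2 * ((X j \<omega>)\<^sup>2 * (X l \<omega>)\<^sup>2 - (X j \<omega>)\<^sup>2 - (X l \<omega>)\<^sup>2 + 1)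
      - ?k * ((X j \<omega>)\<^sup>2 * X l \<omega> + (X l \<omega>)\<^sup>2 * X j \<omega> - X j \<omega> - X l \<omega>) + X j \<omega> * X l \<omega> \<partial>M)"
  proof (rule Bochner_Integration.integral_cong[OF refl])
    fix \<omega>
    have e: "xi i \<omega> = ?k * ((X i \<omega>)\<^sup>2 - 1) - X i \<omega>" for i by (simp add: xi_def)
    show "xi j \<omega> * xi l \<omega> = ?k\<^sup>2 * ((X j \<omega>)\<^sup>2 * (X l \<omega>)\<^sup>2 - (X j \<omega>)\<^sup>2 - (X l \<omega>)\<^sup>2 + 1)
      - ?k * ((X j \<omega>)\<^sup>2 * X l \<omega> + (X l \<omega>)\<^sup>2 * X j \<omega> - X j \<omega> - X l \<omega>) + X j \<omega> * X l \<omega>"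
    proof -
      have "(k * (x\<^sup>2 - 1) - x) * (k * (y\<^sup>2 - 1) - y) =
        k\<^sup>2 * (x\<^sup>2 * y\<^sup>2 - x\<^sup>2 - y\<^sup>2 + 1) - k * (x\<^sup>2 * y + y\<^sup>2 * x - x - y) + x * y" for k x y :: real
        by (simp add: algebra_simps power2_eq_square)
      then show ?thesis unfolding e .
    qed
  qed
  also have "\<dots> = ?k\<^sup>2 * ((\<integral>\<omega>. (X j \<omega>)\<^sup>2 * (X l \<omega>)\<^sup>2 \<partial>M) - 1)
      - ?k * ((\<integral>\<omega>. (X j \<omega>)\<^sup>2 * X l \<omega> \<partial>M) + (\<integral>\<omega>. (X l \<omega>)\<^sup>2 * X j \<omega> \<partial>M)) + (\<integral>\<omega>. X j \<omega> * X l \<omega> \<partial>M)"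
    using i by (simp add: X_second_moment wiener2_mean[OF wiener2_X] prob_space)
  also have "\<dots> \<le> ?k\<^sup>2 * (24 * DD ^ 4 + 32 * (c\<^sup>2 * DD\<^sup>2)) - ?k * (16 * (c * EE\<^sup>2)) + 2 * DD\<^sup>2"
    using m22 m21 m11 c_pos by (intro add_mono diff_mono mult_left_mono) auto
  also have "\<dots> = 4 * DD\<^sup>2 - 4 * EE\<^sup>2 + 3 / 2 * (DD ^ 4 / c\<^sup>2)"
    using c_pos by (simp add: power_divide power_mult_distrib field_simps)
  also have "DD\<^sup>2 = b\<^sup>2 * (r - 1) powr (2 * H - 2)"
    by (simp add: DD_def D_def[OF r] power_mult_distrib power2_eq_square flip: powr_add)
  also have "EE\<^sup>2 = b\<^sup>2 * (r + 1) powr (2 * H - 2)"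
    by (simp add: EE_def E_def[OF r] power_mult_distrib power2_eq_square flip: powr_add)
  also have "DD ^ 4 = b ^ 4 * (r - 1) powr (4 * H - 4)"
    by (simp add: DD_def D_def[OF r] power_mult_distrib power4_eq_xxxx flip: powr_add)
  finally show ?thesis by (simp add: algebra_simps)
qed

lemma X_covariance_square_le:
  assumes r: "\<bar>real j - real l\<bar> = r" "2 \<le> r"
  shows "(\<integral>\<omega>. X j \<omega> * X l \<omega> \<partial>M)\<^sup>2 \<le> 4 * b ^ 4 * (r - 1) powr (4 * H - 4)"
proof -
  have "(\<integral>\<omega>. X j \<omega> * X l \<omega> \<partial>M) \<le> 2 * (D r)\<^sup>2"
    unfolding X_covariance using f_inner_le[OF r] by simp
  then have "(\<integral>\<omega>. X j \<omega> * X l \<omega> \<partial>M)\<^sup>2 \<le> (2 * (D r)\<^sup>2)\<^sup>2"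
    using X_covariance_bounds(1) by (intro power_mono) auto
  also have "\<dots> = 4 * b ^ 4 * (r - 1) powr (4 * H - 4)"
    by (simp add: D_def[OF r] power_mult_distrib power4_eq_xxxx power2_eq_square flip: powr_add)
  finally show ?thesis .
qed

end

subsection \<open>Double sums over pairs of increments\<close>

text \<open>Every distance occurs at most once on each side of \<open>j\<close>.\<close>

lemma sum_distance_le:
  fixes q :: "nat \<Rightarrow> real"
  assumes q: "\<And>r. 0 \<le> q r" and j: "j < d"
  shows "(\<Sum>l<d. q (if l \<le> j then j - l else l - j)) \<le> 2 * (\<Sum>r<d. q r)"
proof -
  have split: "{..<d} = {..j} \<union> {j<..<d}" using j by auto
  have "(\<Sum>l<d. q (if l \<le> j then j - l else l - j)) = (\<Sum>l\<in>{..j}. q (j - l)) + (\<Sum>l\<in>{j<..<d}. q (l - j))"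
    unfolding split by (subst sum.union_disjoint) (auto intro!: arg_cong2[where f = "(+)"] sum.cong)
  also have "(\<Sum>l\<in>{..j}. q (j - l)) = sum q ((\<lambda>l. j - l) ` {..j})"
    by (subst sum.reindex) (auto simp: inj_on_def)
  also have "\<dots> \<le> (\<Sum>r<d. q r)" using j q by (intro sum_mono2) auto
  also have "(\<Sum>l\<in>{j<..<d}. q (l - j)) = sum q ((\<lambda>l. l - j) ` {j<..<d})"
    by (subst sum.reindex) (auto simp: inj_on_def)
  also have "\<dots> \<le> (\<Sum>r<d. q r)" using j q by (intro sum_mono2) auto
  finally show ?thesis by simp
qed

definition power_sum :: "real \<Rightarrow> nat \<Rightarrow> real" where
  "power_sum e d = (\<Sum>r=1..d. real r powr e)"

lemma power_sum_ge_1: "1 \<le> d \<Longrightarrow> 1 \<le> power_sum e d"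
  unfolding power_sum_def using member_le_sum[of 1 "{1..d}" "\<lambda>r. real r powr e"] by simp

text \<open>The differences multiplied by \<open>C1\<close> telescope when summed over the distance \<open>r\<close>, so that they
  contribute at most a constant per row.\<close>

lemma (in hurst) double_sum_le:
  fixes G :: "nat \<Rightarrow> nat \<Rightarrow> real"
  assumes C: "0 \<le> C0" "0 \<le> C1" "0 \<le> C2"
    and G0: "\<And>j l. G j l \<le> C0"
    and G: "\<And>j l r. \<bar>real j - real l\<bar> = r \<Longrightarrow> 2 \<le> r \<Longrightarrow>
      G j l \<le> C1 * ((r - 1) powr (2 * H - 2) - (r + 1) powr (2 * H - 2)) + C2 * (r - 1) powr (4 * H - 4)"
    and d: "1 \<le> d"
  shows "(\<Sum>j<d. \<Sum>l<d. G j l) \<le> (4 * C0 + 4 * C1 + 2 * C2) * (real d * power_sum (4 * H - 4) d)"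
proof -
  define \<phi> where "\<phi> r = real r powr (2 * H - 2)" for r
  define \<psi> where "\<psi> r = real r powr (4 * H - 4)" for r
  \<comment> \<open>Equal and adjacent cells fall outside the decay estimate and are covered by
    \<open>C0\<close>.\<close>
  define q where "q r = (if r \<le> 1 then C0 else C1 * (\<phi> (r - 1) - \<phi> (r + 1)) + C2 * \<psi> (r - 1))" for r
  have \<phi>: "0 \<le> \<phi> r" "1 \<le> r \<Longrightarrow> \<phi> r \<le> 1" for r
    using H by (auto simp: \<phi>_def intro!: powr_mono2'[of "2 - 2 * H" 1 "real r", simplified] order_trans[OF powr_mono2'[of "2 * H - 2" 1 "real r"]])
  have dec: "\<phi> (r + 1) \<le> \<phi> (r - 1)" if "2 \<le> r" for r
    unfolding \<phi>_def using H that by (intro powr_mono2') auto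
  have q0: "0 \<le> q r" for r
    using C dec[of r] by (auto simp: q_def \<psi>_def intro!: add_nonneg_nonneg mult_nonneg_nonneg)
  have Gq: "G j l \<le> q (if l \<le> j then j - l else l - j)" for j l
  proof -
    define r where "r = (if l \<le> j then j - l else l - j)"
    have r: "\<bar>real j - real l\<bar> = real r" by (auto simp: r_def)
    show ?thesis
    proof (cases "r \<le> 1")
      case True
      then show ?thesis using G0[of j l] by (simp add: q_def r_def[symmetric])
    next
      case False
      then show ?thesis using G[OF r] by (simp add: q_def r_def[symmetric] \<phi>_def \<psi>_def of_nat_diff add.commute)
    qed
  qed
  \<comment> \<open>The differences telescope with step two, so two initial and two final values of
    \<open>\<phi>\<close> survive; the distances 0 and 1 account for \<open>2 * C0\<close>.\<close>
  have q_sum: "(\<Sum>r<n + 2. q r) = 2 * C0 + C1 * (\<phi> 1 + \<phi> 2 - \<phi> (n + 1) - \<phi> (n + 2)) + C2 * power_sum (4 * H - 4) n" for n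
  proof (induction n)
    case 0
    have "{..<2::nat} = {0, 1}" by auto
    then show ?case by (simp add: q_def power_sum_def numeral_2_eq_2)
  next
    case (Suc n)
    have "(\<Sum>r<Suc n + 2. q r) = (\<Sum>r<n + 2. q r) + q (n + 2)" by simp
    moreover have "q (n + 2) = C1 * (\<phi> (n + 1) - \<phi> (n + 3)) + C2 * \<psi> (n + 1)" by (simp add: q_def eval_nat_numeral)
    moreover have "power_sum (4 * H - 4) (Suc n) = power_sum (4 * H - 4) n + \<psi> (n + 1)"
      by (simp add: power_sum_def \<psi>_def)
    ultimately show ?case unfolding Suc.IH by (simp add: algebra_simps eval_nat_numeral)
  qed
  have P: "1 \<le> power_sum (4 * H - 4) d" by (rule power_sum_ge_1[OF d])
  \<comment> \<open>Two nonnegative terms are added so that the closed form applies for every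
    \<open>d\<close>.\<close>
  have "(\<Sum>r<d. q r) \<le> (\<Sum>r<d + 2. q r)" using q0 by (intro sum_mono2) auto
  also have "\<dots> \<le> 2 * C0 + C1 * 2 + C2 * power_sum (4 * H - 4) d"
    unfolding q_sum using C \<phi>(1)[of "d + 1"] \<phi>(1)[of "d + 2"] \<phi>(2)[of 1] \<phi>(2)[of 2]
    by (intro add_mono mult_left_mono order_refl) auto
  also have "\<dots> \<le> (2 * C0 + 2 * C1 + C2) * power_sum (4 * H - 4) d"
    using C mult_left_mono[OF P, of "2 * C0"] mult_left_mono[OF P, of "2 * C1"] by (simp add: algebra_simps)
  finally have Q: "(\<Sum>r<d. q r) \<le> (2 * C0 + 2 * C1 + C2) * power_sum (4 * H - 4) d" .
  have "(\<Sum>j<d. \<Sum>l<d. G j l) \<le> (\<Sum>j<d. 2 * ((2 * C0 + 2 * C1 + C2) * power_sum (4 * H - 4) d))"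
  proof (intro sum_mono)
    fix j assume j: "j \<in> {..<d}"
    have "(\<Sum>l<d. G j l) \<le> (\<Sum>l<d. q (if l \<le> j then j - l else l - j))" by (intro sum_mono Gq)
    also have "\<dots> \<le> 2 * (\<Sum>r<d. q r)" using q0 j by (intro sum_distance_le) auto
    finally show "(\<Sum>l<d. G j l) \<le> 2 * ((2 * C0 + 2 * C1 + C2) * power_sum (4 * H - 4) d)" using Q by linarith
  qed
  then show ?thesis by (simp add: algebra_simps)
qed

section \<open>Growth of power sums and the three rates\<close>

lemma power_sum_le:
  assumes "-1 < e" "e \<le> 0"
  shows "power_sum e d \<le> real d powr (e + 1) / (e + 1)"
proof (induction d)
  case (Suc d)
  \<comment> \<open>Comparison of the sum with the integral, one unit interval at a time, through
    the mean value theorem.\<close>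
  have "(e + 1) * real (Suc d) powr e \<le> real (Suc d) powr (e + 1) - real d powr (e + 1)"
  proof (cases "d = 0")
    case False
    have "\<exists>z. real d < z \<and> z < real (Suc d) \<and>
        real (Suc d) powr (e + 1) - real d powr (e + 1) = (real (Suc d) - real d) * ((e + 1) * z powr e)"
      using False by (intro MVT2) (auto intro!: derivative_eq_intros)
    then obtain z where z: "real d < z" "z < real (Suc d)"
      "real (Suc d) powr (e + 1) - real d powr (e + 1) = (e + 1) * z powr e" by auto
    then show ?thesis using assms False by (auto intro!: mult_left_mono powr_mono2')
  qed (use assms in auto)
  then have "real (Suc d) powr e \<le> (real (Suc d) powr (e + 1) - real d powr (e + 1)) / (e + 1)"
    using assms by (simp add: field_simps)
  then show ?case using Suc by (simp add: power_sum_def diff_divide_distrib)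
qed (use assms in \<open>simp add: power_sum_def\<close>)

lemma power_sum_harmonic_le:
  assumes "1 \<le> d"
  shows "power_sum (-1) d \<le> 1 + ln (real d)"
  using assms
proof (induction d rule: dec_induct)
  case (step d)
  have "ln (real d / real (Suc d)) \<le> real d / real (Suc d) - 1"
    using step by (intro ln_le_minus_one) auto
  moreover have "ln (real d / real (Suc d)) = ln (real d) - ln (real (Suc d))"
    using step by (simp add: ln_div)
  moreover have "real d / real (Suc d) - 1 = - (real (Suc d) powr (-1))"
    by (simp add: powr_minus field_simps)
  ultimately show ?case using step by (simp add: power_sum_def)
qed (simp add: power_sum_def)

lemma power_sum_bounded:
  assumes "e < -1"
  shows "\<exists>C>0. \<forall>d. power_sum e d \<le> C"
proof -
  have s: "summable (\<lambda>r. real r powr e)" using assms by (simp add: summable_real_powr_iff)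
  have "power_sum e d \<le> (\<Sum>r. real r powr e) + 1" for d
    unfolding power_sum_def using sum_le_suminf[OF s, of "{1..d}"] by auto
  moreover have "0 \<le> (\<Sum>r. real r powr e)" by (intro suminf_nonneg s) auto
  ultimately show ?thesis by (intro exI[of _ "(\<Sum>r. real r powr e) + 1"]) auto
qed

text \<open>The exponent 4 H - 4 crosses -1 at H = 3/4. Below, the sum is bounded; at 3/4 it is
  harmonic; above, it grows like d^(4 H - 3). Times d^(1 - 2 H) these are the squares of the three
  rates. At H = 3/4 and d = 1 the left side is 1 while the rate is 0 because of the logarithm, so
  that case is left out.\<close>

lemma (in hurst) power_sum_rate:
  "\<exists>C>0. \<forall>d\<ge>1. (H = 3/4 \<longrightarrow> d \<ge> 2) \<longrightarrow>
     real d powr (1 - 2 * H) * power_sum (4 * H - 4) d \<le> C * (wasserstein_rate H 1 d)\<^sup>2"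
proof -
  have sq: "(real d powr e)\<^sup>2 = real d powr (2 * e)" for d e by (simp add: power2_eq_square flip: powr_add)
  consider "H < 3/4" | "H = 3/4" | "3/4 < H" by linarith
  then show ?thesis
  proof cases
    case 1
    then obtain C where C: "C > 0" "\<And>d. power_sum (4 * H - 4) d \<le> C"
      using power_sum_bounded[of "4 * H - 4"] by auto
    have "(wasserstein_rate H 1 d)\<^sup>2 = real d powr (1 - 2 * H)" for d
      using 1 by (simp add: wasserstein_rate_def sq)
    then show ?thesis using C by (intro exI[of _ C]) (auto intro!: mult_left_mono simp: mult.commute)
  next
    case 2
    have "real d powr (1 - 2 * H) * power_sum (4 * H - 4) d \<le> (1 + 1 / ln 2) * (wasserstein_rate H 1 d)\<^sup>2" if "2 \<le> d" for d
    proof -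
      have ln: "ln 2 \<le> ln (real d)" using that by simp
      have "power_sum (4 * H - 4) d \<le> 1 + ln (real d)"
      proof -
        have "4 * H - 4 = -1" using 2 by simp
        then show ?thesis using power_sum_harmonic_le[of d] that by (simp only:)
      qed
      \<comment> \<open>The summand 1 is absorbed into the constant, as \<open>ln (real d)\<close>
        is at least \<open>ln 2\<close> for \<open>d \<ge> 2\<close>.\<close>
      also have "1 + ln (real d) \<le> (1 + 1 / ln 2) * ln (real d)"
        using ln by (simp add: field_simps)
      finally have P: "power_sum (4 * H - 4) d \<le> (1 + 1 / ln 2) * ln (real d)" .
      have e: "1 - 2 * H = - 1/2" using 2 by simp
      have "real d powr (1 - 2 * H) * power_sum (4 * H - 4) d \<le> real d powr (- 1/2) * ((1 + 1 / ln 2) * ln (real d))"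
        unfolding e by (intro mult_left_mono P) auto
      also have "\<dots> = (1 + 1 / ln 2) * (wasserstein_rate H 1 d)\<^sup>2"
      proof -
        have w: "wasserstein_rate H 1 d = sqrt (ln (real d)) * real d powr (- 1/4)"
          using 2 by (simp add: wasserstein_rate_def)
        have q: "(real d powr (- 1/4))\<^sup>2 = real d powr (- 1/2)" using sq[of d "- 1/4"] by simp
        have "0 \<le> ln (real d)" using that by simp
        then show ?thesis unfolding w power_mult_distrib q by simp
      qed
      finally show ?thesis .
    qed
    then have "\<forall>d\<ge>1. (H = 3/4 \<longrightarrow> d \<ge> 2) \<longrightarrow>
      real d powr (1 - 2 * H) * power_sum (4 * H - 4) d \<le> (1 + 1 / ln 2) * (wasserstein_rate H 1 d)\<^sup>2"
      using \<open>H = 3/4\<close> by blast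
    moreover have "0 < 1 + 1 / ln (2 :: real)" by (intro add_pos_pos) auto
    ultimately show ?thesis by blast
  next
    case 3
    have "real d powr (1 - 2 * H) * power_sum (4 * H - 4) d \<le> (1 / (4 * H - 3)) * (wasserstein_rate H 1 d)\<^sup>2" for d
    proof -
      have "power_sum (4 * H - 4) d \<le> real d powr (4 * H - 3) / (4 * H - 3)"
        using power_sum_le[of "4 * H - 4" d] 3 H by simp
      then have "real d powr (1 - 2 * H) * power_sum (4 * H - 4) d \<le> real d powr (1 - 2 * H) * (real d powr (4 * H - 3) / (4 * H - 3))"
        by (intro mult_left_mono) auto
      also have "\<dots> = (1 / (4 * H - 3)) * real d powr (2 * (H - 1))" by (simp flip: powr_add)
      finally show ?thesis using 3 by (simp add: wasserstein_rate_def sq)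
    qed
    then show ?thesis using 3 by (intro exI[of _ "1 / (4 * H - 3)"]) auto
  qed
qed

lemma (in hurst) wasserstein_rate_tendsto_0: "(\<lambda>d. wasserstein_rate H 1 d) \<longlonglongrightarrow> 0"
proof -
  consider "H < 3/4" | "H = 3/4" | "3/4 < H" by linarith
  then show ?thesis
  proof cases
    case 1
    have "(\<lambda>d. real d powr (1/2 - H)) \<longlonglongrightarrow> 0"
      using H by (intro tendsto_neg_powr filterlim_real_sequentially) auto
    then show ?thesis using 1 by (simp add: wasserstein_rate_def)
  next
    case 2
    have "(\<lambda>d. sqrt (ln (real d)) * real d powr (- 1/4)) \<longlonglongrightarrow> 0" by real_asymp
    then show ?thesis using 2 by (simp add: wasserstein_rate_def)
  next
    case 3
    have "(\<lambda>d. real d powr (H - 1)) \<longlonglongrightarrow> 0"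
      using H by (intro tendsto_neg_powr filterlim_real_sequentially) auto
    then show ?thesis using 3 by (simp add: wasserstein_rate_def)
  qed
qed

context rosenblatt
begin

lemma square_sum_integral:
  assumes "\<And>j. L2 M (g j)"
  shows "(\<integral>\<omega>. (\<Sum>j<d. g j \<omega>)\<^sup>2 \<partial>M) = (\<Sum>j<d. \<Sum>l<d. \<integral>\<omega>. g j \<omega> * g l \<omega> \<partial>M)"
proof -
  have "(\<integral>\<omega>. (\<Sum>j<d. g j \<omega>)\<^sup>2 \<partial>M) = (\<integral>\<omega>. (\<Sum>j<d. \<Sum>l<d. g j \<omega> * g l \<omega>) \<partial>M)"
    by (simp add: power2_eq_square sum_product)
  also have "\<dots> = (\<Sum>j<d. \<Sum>l<d. \<integral>\<omega>. g j \<omega> * g l \<omega> \<partial>M)"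
    using L2_integrable_mult[OF assms assms] by (simp add: Bochner_Integration.integral_sum Bochner_Integration.integrable_sum)
  finally show ?thesis .
qed

lemma xi_sum_bound:
  assumes d: "1 \<le> d"
  shows "(\<integral>\<omega>. (\<Sum>j<d. xi j \<omega>)\<^sup>2 \<partial>M) \<le>
    (4 * (28 / (16 * c\<^sup>2) + 2) + 4 * (4 * b\<^sup>2) + 2 * (3 / 2 * (b ^ 4 / c\<^sup>2))) * (real d * power_sum (4 * H - 4) d)"
  unfolding square_sum_integral[OF L2_xi]
proof (rule double_sum_le[OF _ _ _ _ xi_covariance_le d])
  show "(\<integral>\<omega>. xi j \<omega> * xi l \<omega> \<partial>M) \<le> 28 / (16 * c\<^sup>2) + 2" for j l
  proof -
    let ?K = "28 / (16 * c\<^sup>2) + 2"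
    have "(\<integral>\<omega>. xi j \<omega> * xi l \<omega> \<partial>M) \<le> sqrt (\<integral>\<omega>. (xi j \<omega>)\<^sup>2 \<partial>M) * sqrt (\<integral>\<omega>. (xi l \<omega>)\<^sup>2 \<partial>M)"
      using abs_integral_mult_L2_le[OF L2_xi L2_xi, of j l] by linarith
    also have "\<dots> \<le> sqrt ?K * sqrt ?K"
      using xi_second_moment by (intro mult_mono real_sqrt_le_mono) auto
    also have "\<dots> = ?K" by (intro real_sqrt_mult_self[THEN trans]) (simp add: add_nonneg_nonneg)
    finally show ?thesis .
  qed
qed auto

end

subsection \<open>Independence and equality in law\<close>

text \<open>The step integral as a functional on the path space over nonnegative times, the space on
  which independence of the Brownian motions is expressed.\<close>

definition path_functional :: "nat \<Rightarrow> (nat \<Rightarrow> real) \<Rightarrow> (nat \<Rightarrow> nat \<Rightarrow> real) \<Rightarrow> (real \<Rightarrow> real) \<Rightarrow> real" where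
  "path_functional m s a w = grid_sum m s a w w"

lemma path_functional_measurable:
  assumes "grid m s"
  shows "path_functional m s a \<in> borel_measurable (Pi\<^sub>M {0..} (\<lambda>_. borel))"
proof -
  have c: "(\<lambda>w. w (s k)) \<in> borel_measurable (Pi\<^sub>M {0..} (\<lambda>_. borel))" if "k \<le> m" for k
    using grid_nonneg[OF assms that] by (intro measurable_component_singleton) auto
  then show ?thesis
    unfolding path_functional_def grid_sum_def
    by (intro borel_measurable_sum borel_measurable_times borel_measurable_diff borel_measurable_const c) auto
qed

lemma step_integral_path_functional:
  assumes "grid m s"
  shows "step_integral B m s a \<omega> = path_functional m s a (\<lambda>t\<in>{0..}. B t \<omega>)"
  unfolding step_integral_def path_functional_def grid_sum_def
  using grid_nonneg[OF assms] by (intro sum.cong refl) (simp add: Suc_leI)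

locale rosenblatt_family = hurst H + prob_space M for H and M :: "'a measure" +
  fixes B Z :: "nat \<Rightarrow> real \<Rightarrow> 'a \<Rightarrow> real"
  assumes BM: "\<And>i. 1 \<le> i \<Longrightarrow> standard_brownian_motion M (B i)"
    and indep: "indep_processes M {1..} B"
    and Z: "\<And>i. 1 \<le> i \<Longrightarrow> rosenblatt_process M (B i) H (Z i)"
begin

lemma R: "1 \<le> i \<Longrightarrow> rosenblatt H M (B i) (Z i)"
  by unfold_locales (auto intro: BM Z)

lemma brownian: "1 \<le> i \<Longrightarrow> brownian M (B i)"
  by unfold_locales (auto intro: BM)

lemma indep_functionals:
  assumes I: "I \<subseteq> {1..}" and \<Phi>: "\<And>i. i \<in> I \<Longrightarrow> \<Phi> i \<in> borel_measurable (Pi\<^sub>M {0..} (\<lambda>_. borel))"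
  shows "indep_vars (\<lambda>_. borel) (\<lambda>i \<omega>. \<Phi> i (\<lambda>t\<in>{0..}. B i t \<omega>)) I"
proof -
  have "indep_vars (\<lambda>_. Pi\<^sub>M {0..} (\<lambda>_. borel)) (\<lambda>i \<omega>. \<lambda>t\<in>{0..}. B i t \<omega>) I"
    using indep I unfolding indep_processes_def by (rule indep_vars_subset)
  from indep_vars_compose2[OF this, of \<Phi> "\<lambda>_. borel"] \<Phi> show ?thesis by simp
qed

abbreviation X where "X i \<equiv> rosenblatt.X (Z i)"

text \<open>Polarization: a product is a quarter of the difference of the squares of sum and
  difference. Squares of approximating step integrals converge in mean square, hence so do their
  products, which are functionals of the path.\<close>

lemma (in brownian) wiener2_product_approx:
  assumes "wiener2 M B f Y" "wiener2 M B g Y'"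
  shows "\<exists>\<Phi>. (\<forall>r. \<Phi> r \<in> borel_measurable (Pi\<^sub>M {0..} (\<lambda>_. borel))) \<and>
     L2_tendsto M (\<lambda>r \<omega>. \<Phi> r (\<lambda>t\<in>{0..}. B t \<omega>)) (\<lambda>\<omega>. Y \<omega> * Y' \<omega>)"
proof -
  obtain m s a b where "joint_approx M B f Y g Y' m s a b"
    using wiener2_joint[OF assms] by blast
  note a = joint_approxD[OF this]
  define S T where ST: "S r = step_integral B (m r) (s r) (a r)" "T r = step_integral B (m r) (s r) (b r)" for r
  have w: "wiener2 M B (step_function (m r) (s r) (a r)) (S r)" "wiener2 M B (step_function (m r) (s r) (b r)) (T r)" for r
    unfolding ST by (intro wiener2_step a)+
  have lim: "L2_tendsto M S Y" "L2_tendsto M T Y'" using a(4,6) by (simp_all add: ST[abs_def])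
  have "L2_tendsto M (\<lambda>r \<omega>. (S r \<omega> + T r \<omega>)\<^sup>2) (\<lambda>\<omega>. (Y \<omega> + Y' \<omega>)\<^sup>2)"
    by (rule wiener2_square_tendsto[OF wiener2_add[OF w] wiener2_add[OF assms] L2_tendsto_add[OF lim]])
  moreover have "L2_tendsto M (\<lambda>r \<omega>. (S r \<omega> + (-1) * T r \<omega>)\<^sup>2) (\<lambda>\<omega>. (Y \<omega> + (-1) * Y' \<omega>)\<^sup>2)"
    by (rule wiener2_square_tendsto[OF wiener2_add[OF w(1) wiener2_cmult[OF w(2)]]
          wiener2_add[OF assms(1) wiener2_cmult[OF assms(2)]] L2_tendsto_add[OF lim(1) L2_tendsto_cmult[OF lim(2)]]])
  ultimately have "L2_tendsto M (\<lambda>r \<omega>. (1/4) * ((S r \<omega> + T r \<omega>)\<^sup>2 + (-1) * (S r \<omega> + (-1) * T r \<omega>)\<^sup>2))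
      (\<lambda>\<omega>. (1/4) * ((Y \<omega> + Y' \<omega>)\<^sup>2 + (-1) * (Y \<omega> + (-1) * Y' \<omega>)\<^sup>2))"
    by (intro L2_tendsto_cmult L2_tendsto_add)
  moreover have pol: "(1/4) * ((x + y)\<^sup>2 + (-1) * (x + (-1) * y)\<^sup>2) = x * y" for x y :: real
    by (simp add: algebra_simps power2_eq_square)
  ultimately have L: "L2_tendsto M (\<lambda>r \<omega>. S r \<omega> * T r \<omega>) (\<lambda>\<omega>. Y \<omega> * Y' \<omega>)" by (simp only: pol)
  define \<Phi> where "\<Phi> r w = path_functional (m r) (s r) (a r) w * path_functional (m r) (s r) (b r) w" for r w
  have "\<Phi> r \<in> borel_measurable (Pi\<^sub>M {0..} (\<lambda>_. borel))" for r
    unfolding \<Phi>_def by (intro borel_measurable_times path_functional_measurable sym_step_grid[OF a(1)])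
  moreover have "(\<lambda>r \<omega>. \<Phi> r (\<lambda>t\<in>{0..}. B t \<omega>)) = (\<lambda>r \<omega>. S r \<omega> * T r \<omega>)"
    by (intro ext) (simp add: \<Phi>_def ST step_integral_path_functional[OF sym_step_grid[OF a(1)]])
  ultimately show ?thesis using L by (intro exI[of _ \<Phi>]) simp
qed

text \<open>The increments are given as limits, not as functionals of the Brownian paths. The
  expectation is factored for the approximating path functionals, for which independence is known,
  and the factorization passes to the limit.\<close>

lemma X_product_indep:
  assumes ik: "1 \<le> i" "1 \<le> k" "i \<noteq> k"
  shows "L2 M (\<lambda>\<omega>. X i j \<omega> * X k j \<omega>)"
    and "(\<integral>\<omega>. (X i j \<omega> * X k j \<omega>) * (X i l \<omega> * X k l \<omega>) \<partial>M) =
      (\<integral>\<omega>. X i j \<omega> * X i l \<omega> \<partial>M) * (\<integral>\<omega>. X k j \<omega> * X k l \<omega> \<partial>M)"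
proof -
  interpret Ri: rosenblatt H M "B i" "Z i" by (rule R[OF ik(1)])
  interpret Rk: rosenblatt H M "B k" "Z k" by (rule R[OF ik(2)])
  show "(\<integral>\<omega>. (X i j \<omega> * X k j \<omega>) * (X i l \<omega> * X k l \<omega>) \<partial>M) =
      (\<integral>\<omega>. X i j \<omega> * X i l \<omega> \<partial>M) * (\<integral>\<omega>. X k j \<omega> * X k l \<omega> \<partial>M)"
  proof -
    obtain \<Phi> where \<Phi>: "\<And>r. \<Phi> r \<in> borel_measurable (Pi\<^sub>M {0..} (\<lambda>_. borel))"
      "L2_tendsto M (\<lambda>r \<omega>. \<Phi> r (\<lambda>t\<in>{0..}. B i t \<omega>)) (\<lambda>\<omega>. X i j \<omega> * X i l \<omega>)"
      using Ri.wiener2_product_approx[OF Ri.wiener2_X Ri.wiener2_X] by blast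
    obtain \<Psi> where \<Psi>: "\<And>r. \<Psi> r \<in> borel_measurable (Pi\<^sub>M {0..} (\<lambda>_. borel))"
      "L2_tendsto M (\<lambda>r \<omega>. \<Psi> r (\<lambda>t\<in>{0..}. B k t \<omega>)) (\<lambda>\<omega>. X k j \<omega> * X k l \<omega>)"
      using Rk.wiener2_product_approx[OF Rk.wiener2_X Rk.wiener2_X] by blast
    define P Q where PQ: "P r \<omega> = \<Phi> r (\<lambda>t\<in>{0..}. B i t \<omega>)" "Q r \<omega> = \<Psi> r (\<lambda>t\<in>{0..}. B k t \<omega>)" for r \<omega>
    have lim: "L2_tendsto M P (\<lambda>\<omega>. X i j \<omega> * X i l \<omega>)" "L2_tendsto M Q (\<lambda>\<omega>. X k j \<omega> * X k l \<omega>)"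
      using \<Phi>(2) \<Psi>(2) by (simp_all add: PQ[abs_def])
    have L: "L2 M (P r)" "L2 M (Q r)" for r using lim by (auto simp: L2_tendsto_def)
    have fac: "(\<integral>\<omega>. P r \<omega> * Q r \<omega> \<partial>M) = (\<integral>\<omega>. P r \<omega> \<partial>M) * (\<integral>\<omega>. Q r \<omega> \<partial>M)" for r
    proof -
      let ?\<Phi> = "\<lambda>x. if x = i then \<Phi> r else \<Psi> r"
      have iv: "indep_vars (\<lambda>_. borel) (\<lambda>x \<omega>. ?\<Phi> x (\<lambda>t\<in>{0..}. B x t \<omega>)) {i, k}"
        using ik by (intro indep_functionals) (auto simp: \<Phi> \<Psi>)
      have "(\<integral>\<omega>. (\<Prod>x\<in>{i, k}. ?\<Phi> x (\<lambda>t\<in>{0..}. B x t \<omega>)) \<partial>M) = (\<Prod>x\<in>{i, k}. \<integral>\<omega>. ?\<Phi> x (\<lambda>t\<in>{0..}. B x t \<omega>) \<partial>M)"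
        using iv abs_integral_le_L2(2)[OF L(1)] abs_integral_le_L2(2)[OF L(2)] ik
        by (intro indep_vars_lebesgue_integral) (auto simp: PQ[abs_def])
      then show ?thesis using ik by (simp add: PQ)
    qed
    have one: "L2 M (\<lambda>_. 1)" by (simp add: L2_def)
    have "(\<lambda>r. \<integral>\<omega>. P r \<omega> * Q r \<omega> \<partial>M) \<longlonglongrightarrow> (\<integral>\<omega>. (X i j \<omega> * X i l \<omega>) * (X k j \<omega> * X k l \<omega>) \<partial>M)"
      by (intro L2_tendsto_integral_mult lim)
    moreover have "(\<lambda>r. (\<integral>\<omega>. P r \<omega> * 1 \<partial>M) * (\<integral>\<omega>. Q r \<omega> * 1 \<partial>M)) \<longlonglongrightarrow>
        (\<integral>\<omega>. (X i j \<omega> * X i l \<omega>) * 1 \<partial>M) * (\<integral>\<omega>. (X k j \<omega> * X k l \<omega>) * 1 \<partial>M)"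
      by (intro tendsto_mult L2_tendsto_integral_mult lim L2_tendsto_const one)
    ultimately have "(\<integral>\<omega>. (X i j \<omega> * X i l \<omega>) * (X k j \<omega> * X k l \<omega>) \<partial>M) =
       (\<integral>\<omega>. X i j \<omega> * X i l \<omega> \<partial>M) * (\<integral>\<omega>. X k j \<omega> * X k l \<omega> \<partial>M)"
      unfolding fac by (simp add: LIMSEQ_unique)
    moreover have "(\<lambda>\<omega>. (X i j \<omega> * X k j \<omega>) * (X i l \<omega> * X k l \<omega>)) = (\<lambda>\<omega>. (X i j \<omega> * X i l \<omega>) * (X k j \<omega> * X k l \<omega>))"
      by (simp add: mult_ac)
    ultimately show ?thesis by simp
  qed
  have "integrable M (\<lambda>\<omega>. (X i j \<omega>)\<^sup>2 * (X k j \<omega>)\<^sup>2)"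
    by (intro L2_integrable_mult Ri.L2_X Rk.L2_X)
  then show "L2 M (\<lambda>\<omega>. X i j \<omega> * X k j \<omega>)"
    using Ri.L2_X(1)[of j] Rk.L2_X(1)[of j] by (auto simp: L2_def power_mult_distrib)
qed

text \<open>Independence of the rows turns the covariance of two products into a product of
  covariances, and these agree for all rows. The squared covariance already has order
  \<open>r powr (4 * H - 4)\<close>, so the telescoping part has coefficient 0.\<close>

lemma off_diagonal_bound:
  assumes ik: "1 \<le> i" "1 \<le> k" "i \<noteq> k" and d: "1 \<le> d"
  shows "(\<integral>\<omega>. (\<Sum>j<d. X i j \<omega> * X k j \<omega>)\<^sup>2 \<partial>M) \<le> (4 * 1 + 4 * 0 + 2 * (4 * b ^ 4)) * (real d * power_sum (4 * H - 4) d)"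
proof -
  interpret Ri: rosenblatt H M "B i" "Z i" by (rule R[OF ik(1)])
  interpret Rk: rosenblatt H M "B k" "Z k" by (rule R[OF ik(2)])
  have eq: "(\<integral>\<omega>. X i j \<omega> * X i l \<omega> \<partial>M) = (\<integral>\<omega>. X k j \<omega> * X k l \<omega> \<partial>M)" for j l
    unfolding Ri.X_covariance Rk.X_covariance ..
  have "(\<integral>\<omega>. (\<Sum>j<d. X i j \<omega> * X k j \<omega>)\<^sup>2 \<partial>M) = (\<Sum>j<d. \<Sum>l<d. (\<integral>\<omega>. X i j \<omega> * X i l \<omega> \<partial>M)\<^sup>2)"
    unfolding Ri.square_sum_integral[OF X_product_indep(1)[OF ik]]
    unfolding X_product_indep(2)[OF ik] eq power2_eq_square ..
  also have "\<dots> \<le> (4 * 1 + 4 * 0 + 2 * (4 * b ^ 4)) * (real d * power_sum (4 * H - 4) d)"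
  proof (rule double_sum_le[OF _ _ _ _ _ d])
    show "(\<integral>\<omega>. X i j \<omega> * X i l \<omega> \<partial>M)\<^sup>2 \<le> 1" for j l
      using Ri.X_covariance_bounds by (simp add: power_le_one)
  qed (use Ri.X_covariance_square_le in auto)
  finally show ?thesis .
qed

end

section \<open>Self-similarity of the kernels and laws of step integrals\<close>

lemma nn_integral_lborel_pair_scale:
  assumes [measurable]: "F \<in> borel_measurable (borel \<Otimes>\<^sub>M borel)" and c: "0 < (c :: real)"
  shows "(\<integral>\<^sup>+p. F p \<partial>(lborel :: (real \<times> real) measure)) = ennreal (c\<^sup>2) * (\<integral>\<^sup>+p. F (c * fst p, c * snd p) \<partial>lborel)"
proof -
  have "(\<integral>\<^sup>+p. F p \<partial>(lborel :: (real \<times> real) measure)) = (\<integral>\<^sup>+x. \<integral>\<^sup>+y. F (x, y) \<partial>lborel \<partial>lborel)"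
    by (rule nn_integral_lborel_pair) measurable
  also have "\<dots> = (\<integral>\<^sup>+x. ennreal c * (\<integral>\<^sup>+y. F (x, c * y) \<partial>lborel) \<partial>lborel)"
    using c by (intro nn_integral_cong) (subst nn_integral_real_affine[where c = c and t = 0], auto)
  also have "\<dots> = ennreal c * (\<integral>\<^sup>+x. \<integral>\<^sup>+y. F (x, c * y) \<partial>lborel \<partial>lborel)"
    by (intro nn_integral_cmult) measurable
  also have "(\<integral>\<^sup>+x. \<integral>\<^sup>+y. F (x, c * y) \<partial>lborel \<partial>lborel) = ennreal c * (\<integral>\<^sup>+x. \<integral>\<^sup>+y. F (c * x, c * y) \<partial>lborel \<partial>lborel)"
    by (subst nn_integral_real_affine[where c = c and t = 0]) (measurable, use c in simp_all)
  also have "(\<integral>\<^sup>+x. \<integral>\<^sup>+y. F (c * x, c * y) \<partial>lborel \<partial>lborel) = (\<integral>\<^sup>+p. F (c * fst p, c * snd p) \<partial>lborel)"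
    by (subst nn_integral_lborel_pair) auto
  finally show ?thesis using c by (simp add: ennreal_mult[symmetric] mult.assoc[symmetric] power2_eq_square)
qed

context hurst
begin

lemma fbm_deriv_scale: "0 < t \<Longrightarrow> fbm_deriv h (t * u) (t * y) = t powr (h - 3/2) * fbm_deriv h u y"
  by (auto simp: fbm_deriv_def powr_mult right_diff_distrib[symmetric] zero_less_mult_iff)

text \<open>Substituting t u for u gives a factor t from Lebesgue measure and t^(h - 3/2) from each
  of the two kernels, in total t^(1 + 2 h - 3) = t^(H - 1).\<close>

lemma inc_kernel_scale:
  assumes t: "0 < t"
  shows "inc_kernel 0 t (t * x, t * y) = t powr (H - 1) * inc_kernel 0 1 (x, y)"
proof -
  have "mix (unif 0 t) (t * x) (t * y) = (\<integral>\<^sup>+u. ker u (t * x) * ker u (t * y) * indicator {0<..t} u \<partial>lborel)"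
    unfolding mix_def by (rule nn_integral_unif) measurable
  also have "\<dots> = ennreal t * (\<integral>\<^sup>+u. ker (t * u) (t * x) * ker (t * u) (t * y) * indicator {0<..t} (t * u) \<partial>lborel)"
    by (subst nn_integral_real_affine[where c = t and t = 0]) (measurable, use t in simp_all)
  also have "\<dots> = ennreal t * (\<integral>\<^sup>+u. ennreal (t powr (H - 2)) * (ker u x * ker u y * indicator {0<..1} u) \<partial>lborel)"
  proof (rule arg_cong2[where f = "(*)", OF refl], rule nn_integral_cong)
    fix u
    have k: "ker (t * u) (t * z) = ennreal (t powr (h - 3/2)) * ker u z" for z
      using t c_pos fbm_deriv_nonneg[OF h] by (simp add: ker_def fbm_deriv_scale ennreal_mult[symmetric] mult_ac)
    have i: "indicator {0<..t} (t * u) = (indicator {0<..1} u :: ennreal)"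
      using t by (auto simp: indicator_def zero_less_mult_iff)
    have p: "ennreal (t powr (h - 3/2)) * ennreal (t powr (h - 3/2)) = ennreal (t powr (H - 2))"
    proof -
      have "t powr (h - 3/2) * t powr (h - 3/2) = t powr ((h - 3/2) + (h - 3/2))" by (simp only: powr_add)
      also have "(h - 3/2) + (h - 3/2) = H - 2" by (simp add: field_simps)
      finally show ?thesis by (simp add: ennreal_mult[symmetric])
    qed
    show "ker (t * u) (t * x) * ker (t * u) (t * y) * indicator {0<..t} (t * u) =
      ennreal (t powr (H - 2)) * (ker u x * ker u y * indicator {0<..1} u)"
      unfolding k i p[symmetric] by (simp only: mult_ac)
  qed
  also have "\<dots> = ennreal t * (ennreal (t powr (H - 2)) * mix (unif 0 1) x y)"
  proof -
    have eq: "mix (unif 0 1) x y = (\<integral>\<^sup>+u. ker u x * ker u y * indicator {0<..1} u \<partial>lborel)"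
      unfolding mix_def by (rule nn_integral_unif) measurable
    have m: "(\<lambda>u. ker u x * ker u y) \<in> borel_measurable lborel" by measurable
    have "(\<lambda>u. ker u x * ker u y * indicator {0<..1} u) \<in> borel_measurable lborel"
      by (intro borel_measurable_times_ennreal m borel_measurable_indicator) auto
    then show ?thesis unfolding eq by (subst nn_integral_cmult) auto
  qed
  also have "\<dots> = ennreal (t powr (H - 1)) * mix (unif 0 1) x y"
  proof -
    have "t * t powr (H - 2) = t powr (1 + (H - 2))" using t by (simp only: powr_add powr_one)
    then show ?thesis using t by (simp add: ennreal_mult[symmetric] mult.assoc[symmetric])
  qed
  finally show ?thesis by (simp add: inc_kernel_def enn2real_mult)
qed

end

lemma step_function_scale:
  assumes "0 < t"
  shows "step_function m (\<lambda>k. t * s k) a (t * x, t * y) = step_function m s a (x, y)"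
  using assms by (simp add: step_function_block block_def indicator_def)

lemma grid_scale: "grid m s \<Longrightarrow> 0 < t \<Longrightarrow> grid m (\<lambda>k. t * s k)"
  by (auto simp: grid_def)

lemma sym_step_scale: "sym_step m s a \<Longrightarrow> 0 < t \<Longrightarrow> sym_step m (\<lambda>k. t * s k) (\<lambda>k l. c * a k l)"
  by (auto simp: sym_step_def off_diagonal_step_iff grid_scale symmetric_mat_def)

text \<open>Brownian scaling with the Brownian motion kept fixed: the grid is stretched by
  \<open>t\<close> instead. The coefficients are divided by \<open>t\<close> because t^(-H) t^(H -
  1) = 1/t. The planar change of variables contributes t^2, which cancels the square of this
  factor.\<close>

lemma (in rosenblatt) scaled_step_tendsto:
  assumes a: "\<And>r. sym_step (m r) (s r) (a r)"
    "L2_tendsto lborel (\<lambda>r. step_function (m r) (s r) (a r)) (inc_kernel 0 1)" and t: "0 < t"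
  shows "L2_tendsto M (\<lambda>r. step_integral B (m r) (\<lambda>k. t * s r k) (\<lambda>k l. (1 / t) * a r k l)) (\<lambda>\<omega>. t powr (- H) * Z t \<omega>)"
proof -
  let ?g = "\<lambda>p. t powr (- H) * inc_kernel 0 t p"
  let ?S = "\<lambda>r. step_function (m r) (\<lambda>k. t * s r k) (\<lambda>k l. (1 / t) * a r k l)"
  have rep: "represents (inc_kernel 0 t) (mix (unif 0 t))" by (rule represents_inc_kernel) (use t in auto)
  have Lg: "L2 lborel ?g" using rep by (intro L2_cmult) (simp add: represents_def)
  have w: "wiener2 M B ?g (\<lambda>\<omega>. t powr (- H) * Z t \<omega>)"
  proof (rule wiener2_cmult)
    show "wiener2 M B (inc_kernel 0 t) (Z t)"
      using t rosenblatt_kernel_AE[of t] rep by (intro wiener2_cong_AE[OF wiener2_Z]) (auto simp: represents_def L2_def)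
  qed
  have LS: "L2 lborel (?S r)" for r
    by (intro step_function_L2 sym_step_grid[OF sym_step_scale[OF a(1) t]])
  have int: "(\<integral>p. (?S r p - ?g p)\<^sup>2 \<partial>lborel) = (\<integral>p. (step_function (m r) (s r) (a r) p - inc_kernel 0 1 p)\<^sup>2 \<partial>lborel)" for r
  proof -
    have L1: "L2 lborel (\<lambda>p. step_function (m r) (s r) (a r) p - inc_kernel 0 1 p)"
      using a(2) by (auto simp: L2_tendsto_def intro: L2_diff)
    have "ennreal (\<integral>p. (?S r p - ?g p)\<^sup>2 \<partial>lborel) = (\<integral>\<^sup>+p. ennreal ((?S r p - ?g p)\<^sup>2) \<partial>lborel)"
      using L2_diff[OF LS[of r] Lg] by (simp add: nn_integral_eq_integral L2_def)
    also have "\<dots> = ennreal (t\<^sup>2) * (\<integral>\<^sup>+p. ennreal ((?S r (t * fst p, t * snd p) - ?g (t * fst p, t * snd p))\<^sup>2) \<partial>lborel)"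
    proof (rule nn_integral_lborel_pair_scale[OF _ t])
      show "(\<lambda>p. ennreal ((?S r p - ?g p)\<^sup>2)) \<in> borel_measurable (borel \<Otimes>\<^sub>M borel)"
        by (rule measurable_compose[OF L2_pair_measurable[OF L2_diff[OF LS[of r] Lg]], of "\<lambda>x. ennreal (x\<^sup>2)" borel]) measurable
    qed
    also have "\<dots> = (\<integral>\<^sup>+p. ennreal ((step_function (m r) (s r) (a r) p - inc_kernel 0 1 p)\<^sup>2) \<partial>lborel)"
    proof -
      have "(?S r (t * fst p, t * snd p) - ?g (t * fst p, t * snd p))\<^sup>2 =
          (1 / t\<^sup>2) * (step_function (m r) (s r) (a r) p - inc_kernel 0 1 p)\<^sup>2" for p
      proof -
        have "t powr (- H) * (t powr (H - 1) * x) = (1 / t) * x" for x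
        proof -
          have "t powr (- H) * t powr (H - 1) = t powr (- H + (H - 1))" by (simp only: powr_add)
          also have "\<dots> = 1 / t" using t by (simp add: powr_minus_divide)
          finally show ?thesis by (simp add: mult.assoc[symmetric])
        qed
        then have "?S r (t * fst p, t * snd p) - ?g (t * fst p, t * snd p) =
            (1 / t) * (step_function (m r) (s r) (a r) p - inc_kernel 0 1 p)"
          by (simp add: step_function_cmult step_function_scale[OF t] inc_kernel_scale[OF t] right_diff_distrib del: times_divide_eq_left)
        then show ?thesis by (simp add: power_mult_distrib power_divide)
      qed
      moreover have "(\<integral>\<^sup>+p. ennreal ((1 / t\<^sup>2) * (step_function (m r) (s r) (a r) p - inc_kernel 0 1 p)\<^sup>2) \<partial>lborel) =
          ennreal (1 / t\<^sup>2) * (\<integral>\<^sup>+p. ennreal ((step_function (m r) (s r) (a r) p - inc_kernel 0 1 p)\<^sup>2) \<partial>lborel)"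
      proof -
        have "(\<integral>\<^sup>+p. ennreal ((1 / t\<^sup>2) * (step_function (m r) (s r) (a r) p - inc_kernel 0 1 p)\<^sup>2) \<partial>lborel) =
          (\<integral>\<^sup>+p. ennreal (1 / t\<^sup>2) * ennreal ((step_function (m r) (s r) (a r) p - inc_kernel 0 1 p)\<^sup>2) \<partial>lborel)"
          by (intro nn_integral_cong ennreal_mult) auto
        also have "\<dots> = ennreal (1 / t\<^sup>2) * (\<integral>\<^sup>+p. ennreal ((step_function (m r) (s r) (a r) p - inc_kernel 0 1 p)\<^sup>2) \<partial>lborel)"
          using L1 by (intro nn_integral_cmult) (auto simp: L2_def)
        finally show ?thesis .
      qed
      ultimately show ?thesis
        using t by (simp only: mult.assoc[symmetric] ennreal_mult[symmetric]) (simp add: ennreal_mult[symmetric] mult.assoc[symmetric])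
    qed
    also have "\<dots> = ennreal (\<integral>p. (step_function (m r) (s r) (a r) p - inc_kernel 0 1 p)\<^sup>2 \<partial>lborel)"
      using L1 by (simp add: nn_integral_eq_integral L2_def)
    finally show ?thesis by (subst (asm) ennreal_inj) auto
  qed
  have "L2_tendsto lborel ?S ?g"
    unfolding L2_tendsto_def int using a(2) LS Lg by (auto simp: L2_tendsto_def)
  then show ?thesis
    by (intro wiener2_tendsto[OF w wiener2_step[OF sym_step_scale[OF a(1) t]]])
qed

text \<open>The law depends on the grid and the coefficients only through the number of cells and
  \<open>scale_mat\<close>, so two step integrals with equal scaled matrices are equal in
  law.\<close>

lemma (in brownian) quad_law:
  assumes "grid m s"
  shows "distr M borel (step_integral B m s a) =
    distr (Pi\<^sub>M {..<m} (\<lambda>_. density lborel std_normal_density)) borel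
      (\<lambda>x. \<Sum>k<m. \<Sum>l<m. scale_mat s a k l * x k * x l)"
proof (cases "m = 0")
  \<comment> \<open>Without cells both laws are the point mass at 0. The product characterization of
    independence serves the nonempty case.\<close>
  case True
  interpret P: prob_space "Pi\<^sub>M {..<m} (\<lambda>_. density lborel std_normal_density :: real measure)"
    by (intro prob_space_PiM prob_space_normal_density) auto
  have "step_integral B m s a = (\<lambda>_. 0)" using True by (auto simp: step_integral_def)
  moreover have "(\<lambda>x. \<Sum>k<m. \<Sum>l<m. scale_mat s a k l * x k * x l) = (\<lambda>x :: nat \<Rightarrow> real. 0 :: real)"
    using True by auto
  ultimately show ?thesis by (simp only: distr_const P.distr_const space_borel UNIV_I)
next
  case False
  interpret G: gaussian_vector M m "normal_increment s" by (rule gaussian_increments[OF assms])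
  let ?q = "\<lambda>x. \<Sum>k<m. \<Sum>l<m. scale_mat s a k l * x k * x l :: real"
  have q: "?q \<in> borel_measurable (Pi\<^sub>M {..<m} (\<lambda>_. borel))"
    by (intro borel_measurable_sum borel_measurable_times borel_measurable_const measurable_component_singleton) auto
  have law: "distr M borel (normal_increment s k) = density lborel std_normal_density" if "k < m" for k
    using G.std_normal[OF that] by (simp add: distributed_def cong: distr_cong)
  have "distr M (Pi\<^sub>M {..<m} (\<lambda>_. borel)) (\<lambda>\<omega>. \<lambda>k\<in>{..<m}. normal_increment s k \<omega>) =
      Pi\<^sub>M {..<m} (\<lambda>k. distr M borel (normal_increment s k))"
    using G.indep False by (subst (asm) indep_vars_iff_distr_eq_PiM') auto
  also have "\<dots> = Pi\<^sub>M {..<m} (\<lambda>_. density lborel std_normal_density)"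
    by (intro PiM_cong refl law) auto
  finally have P: "distr M (Pi\<^sub>M {..<m} (\<lambda>_. borel)) (\<lambda>\<omega>. \<lambda>k\<in>{..<m}. normal_increment s k \<omega>) =
      Pi\<^sub>M {..<m} (\<lambda>_. density lborel std_normal_density)" .
  have "step_integral B m s a = (\<lambda>\<omega>. ?q (\<lambda>k\<in>{..<m}. normal_increment s k \<omega>))"
    unfolding step_integral_quad[OF assms] G.quad_def by auto
  then have "distr M borel (step_integral B m s a) =
      distr (distr M (Pi\<^sub>M {..<m} (\<lambda>_. borel)) (\<lambda>\<omega>. \<lambda>k\<in>{..<m}. normal_increment s k \<omega>)) borel ?q"
    using q by (subst distr_distr) (auto simp: o_def intro!: measurable_restrict)
  then show ?thesis unfolding P .
qed

section \<open>Lipschitz test functions under mean-square approximation\<close>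

lemma (in prob_space) lipschitz_expectation:
  fixes \<phi> :: "('i \<Rightarrow> real) \<Rightarrow> real"
  assumes I: "finite I" and \<phi>[measurable]: "\<phi> \<in> borel_measurable (Pi\<^sub>M I (\<lambda>_. borel))"
    and lip: "\<And>x y. \<bar>\<phi> x - \<phi> y\<bar> \<le> K * (\<Sum>i\<in>I. \<bar>x i - y i\<bar>)" and K: "0 \<le> K"
    and X: "\<And>i. i \<in> I \<Longrightarrow> L2 M (X i)" and Y: "\<And>i. i \<in> I \<Longrightarrow> L2 M (Y i)"
  shows "integrable M (\<lambda>\<omega>. \<phi> (\<lambda>i\<in>I. X i \<omega>))"
    and "\<bar>(\<integral>\<omega>. \<phi> (\<lambda>i\<in>I. X i \<omega>) \<partial>M) - (\<integral>\<omega>. \<phi> (\<lambda>i\<in>I. Y i \<omega>) \<partial>M)\<bar> \<le> K * (\<Sum>i\<in>I. sqrt (\<integral>\<omega>. (X i \<omega> - Y i \<omega>)\<^sup>2 \<partial>M))"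
proof -
  have m: "(\<lambda>\<omega>. \<phi> (\<lambda>i\<in>I. X i \<omega>)) \<in> borel_measurable M" if "\<And>i. i \<in> I \<Longrightarrow> L2 M (X i)" for X
    using that by (intro measurable_compose[OF measurable_restrict \<phi>]) (auto simp: L2_def)
  have i: "integrable M (\<lambda>\<omega>. \<phi> (\<lambda>i\<in>I. X i \<omega>))" if L: "\<And>i. i \<in> I \<Longrightarrow> L2 M (X i)" for X
  proof (rule Bochner_Integration.integrable_bound[OF _ m[OF L]])
    show "integrable M (\<lambda>\<omega>. \<bar>\<phi> (\<lambda>i. 0)\<bar> + K * (\<Sum>i\<in>I. \<bar>X i \<omega>\<bar>))"
      using L by (intro Bochner_Integration.integrable_add integrable_const integrable_mult_right
        Bochner_Integration.integrable_sum integrable_abs abs_integral_le_L2(2))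
    have "\<bar>\<phi> (\<lambda>i\<in>I. X i \<omega>)\<bar> \<le> \<bar>\<phi> (\<lambda>i. 0)\<bar> + K * (\<Sum>i\<in>I. \<bar>X i \<omega>\<bar>)" for \<omega>
      using lip[of "\<lambda>i\<in>I. X i \<omega>" "\<lambda>i. 0"] by simp
    then show "AE \<omega> in M. norm (\<phi> (\<lambda>i\<in>I. X i \<omega>)) \<le> norm (\<bar>\<phi> (\<lambda>i. 0)\<bar> + K * (\<Sum>i\<in>I. \<bar>X i \<omega>\<bar>))"
      unfolding real_norm_def by (intro AE_I2 order_trans[OF _ abs_ge_self])
  qed
  show "integrable M (\<lambda>\<omega>. \<phi> (\<lambda>i\<in>I. X i \<omega>))" by (rule i[OF X])
  have D: "L2 M (\<lambda>\<omega>. X i \<omega> - Y i \<omega>)" if "i \<in> I" for i using that by (intro L2_diff X Y)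
  have "\<bar>(\<integral>\<omega>. \<phi> (\<lambda>i\<in>I. X i \<omega>) \<partial>M) - (\<integral>\<omega>. \<phi> (\<lambda>i\<in>I. Y i \<omega>) \<partial>M)\<bar> =
      \<bar>\<integral>\<omega>. \<phi> (\<lambda>i\<in>I. X i \<omega>) - \<phi> (\<lambda>i\<in>I. Y i \<omega>) \<partial>M\<bar>"
    using i[OF X] i[OF Y] by simp
  also have "\<dots> \<le> (\<integral>\<omega>. \<bar>\<phi> (\<lambda>i\<in>I. X i \<omega>) - \<phi> (\<lambda>i\<in>I. Y i \<omega>)\<bar> \<partial>M)" by (rule integral_abs_bound)
  also have "\<dots> \<le> (\<integral>\<omega>. K * (\<Sum>i\<in>I. \<bar>X i \<omega> - Y i \<omega>\<bar>) \<partial>M)"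
  proof (rule integral_mono)
    show "integrable M (\<lambda>\<omega>. \<bar>\<phi> (\<lambda>i\<in>I. X i \<omega>) - \<phi> (\<lambda>i\<in>I. Y i \<omega>)\<bar>)" using i[OF X] i[OF Y] by auto
    show "integrable M (\<lambda>\<omega>. K * (\<Sum>i\<in>I. \<bar>X i \<omega> - Y i \<omega>\<bar>))"
      using D by (intro integrable_mult_right Bochner_Integration.integrable_sum integrable_abs abs_integral_le_L2(2))
    show "\<bar>\<phi> (\<lambda>i\<in>I. X i \<omega>) - \<phi> (\<lambda>i\<in>I. Y i \<omega>)\<bar> \<le> K * (\<Sum>i\<in>I. \<bar>X i \<omega> - Y i \<omega>\<bar>)" for \<omega>
      using lip[of "\<lambda>i\<in>I. X i \<omega>" "\<lambda>i\<in>I. Y i \<omega>"] by simp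
  qed
  also have "\<dots> = K * (\<Sum>i\<in>I. \<integral>\<omega>. \<bar>X i \<omega> - Y i \<omega>\<bar> \<partial>M)"
    using D by (simp add: Bochner_Integration.integral_sum abs_integral_le_L2(2))
  also have "\<dots> \<le> K * (\<Sum>i\<in>I. sqrt (\<integral>\<omega>. (X i \<omega> - Y i \<omega>)\<^sup>2 \<partial>M))"
    using K D by (intro mult_left_mono sum_mono abs_integral_le_L2(1))
  finally show "\<bar>(\<integral>\<omega>. \<phi> (\<lambda>i\<in>I. X i \<omega>) \<partial>M) - (\<integral>\<omega>. \<phi> (\<lambda>i\<in>I. Y i \<omega>) \<partial>M)\<bar> \<le> K * (\<Sum>i\<in>I. sqrt (\<integral>\<omega>. (X i \<omega> - Y i \<omega>)\<^sup>2 \<partial>M))" .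
qed

lemma (in prob_space) lipschitz_expectation_tendsto:
  fixes \<phi> :: "('i \<Rightarrow> real) \<Rightarrow> real"
  assumes I: "finite I" and \<phi>: "\<phi> \<in> borel_measurable (Pi\<^sub>M I (\<lambda>_. borel))"
    and lip: "\<And>x y. \<bar>\<phi> x - \<phi> y\<bar> \<le> K * (\<Sum>i\<in>I. \<bar>x i - y i\<bar>)" and K: "0 \<le> K"
    and Y: "\<And>i. i \<in> I \<Longrightarrow> L2_tendsto M (\<lambda>r. Y r i) (X i)"
  shows "(\<lambda>r. \<integral>\<omega>. \<phi> (\<lambda>i\<in>I. Y r i \<omega>) \<partial>M) \<longlonglongrightarrow> (\<integral>\<omega>. \<phi> (\<lambda>i\<in>I. X i \<omega>) \<partial>M)"
proof -
  have L: "L2 M (Y r i)" "L2 M (X i)" if "i \<in> I" for r i using Y[OF that] by (auto simp: L2_tendsto_def)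
  have "(\<lambda>r. sqrt (\<integral>\<omega>. (Y r i \<omega> - X i \<omega>)\<^sup>2 \<partial>M)) \<longlonglongrightarrow> 0" if "i \<in> I" for i
    using Y[OF that] tendsto_real_sqrt[of _ 0] by (auto simp: L2_tendsto_def)
  then have "(\<lambda>r. K * (\<Sum>i\<in>I. sqrt (\<integral>\<omega>. (Y r i \<omega> - X i \<omega>)\<^sup>2 \<partial>M))) \<longlonglongrightarrow> 0"
    by (intro tendsto_mult_right_zero tendsto_null_sum)
  then have "(\<lambda>r. (\<integral>\<omega>. \<phi> (\<lambda>i\<in>I. Y r i \<omega>) \<partial>M) - (\<integral>\<omega>. \<phi> (\<lambda>i\<in>I. X i \<omega>) \<partial>M)) \<longlonglongrightarrow> 0"
    by (rule Lim_null_comparison[rotated], intro always_eventually allI, unfold real_norm_def,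
        intro lipschitz_expectation(2)[OF I \<phi> lip K] L)
  then show ?thesis by (simp add: LIM_zero_iff)
qed

context rosenblatt_family
begin

text \<open>Self-similarity holds for the law only, and it has to hold jointly over the rows.
  Original and stretched step integrals have equal laws row by row, so by independence the joint
  laws are equal product measures. Lipschitz test functions carry the equality through the
  mean-square limits.\<close>

lemma joint_law:
  fixes \<phi> :: "(nat \<Rightarrow> real) \<Rightarrow> real"
  assumes n: "1 \<le> n" and \<phi>: "\<phi> \<in> borel_measurable (Pi\<^sub>M {1..n} (\<lambda>_. borel))"
    and lip: "\<And>x y. \<bar>\<phi> x - \<phi> y\<bar> \<le> K * (\<Sum>i\<in>{1..n}. \<bar>x i - y i\<bar>)" and K: "0 \<le> K" and t: "0 < t"
  shows "(\<integral>\<omega>. \<phi> (\<lambda>i\<in>{1..n}. t powr (- H) * Z i t \<omega>) \<partial>M) = (\<integral>\<omega>. \<phi> (\<lambda>i\<in>{1..n}. Z i 1 \<omega>) \<partial>M)"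
proof -
  define P where "P i m s a \<longleftrightarrow> (\<forall>r. sym_step (m r) (s r) (a r)) \<and>
      L2_tendsto lborel (\<lambda>r. step_function (m r) (s r) (a r)) (inc_kernel 0 1) \<and>
      L2_tendsto M (\<lambda>r. step_integral (B i) (m r) (s r) (a r)) (Z i 1)" for i m s a
  have "\<exists>m s a. P i m s a" if i: "1 \<le> i" for i
  proof -
    interpret Ri: rosenblatt H M "B i" "Z i" by (rule R[OF i])
    have "wiener2 M (B i) (inc_kernel 0 1) (Z i 1)"
      using rosenblatt_kernel_AE[of 1] represents_inc_kernel(1)[of 0 1]
      by (intro wiener2_cong_AE[OF Ri.wiener2_Z]) (auto simp: represents_def L2_def)
    then show ?thesis by (simp add: wiener2_def P_def)
  qed
  \<comment> \<open>Keeping the index condition as an implication lets the choice range over all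
    \<open>i\<close>; nothing is claimed at 0.\<close>
  then have "\<forall>i. \<exists>m s a. 1 \<le> i \<longrightarrow> P i m s a" by blast
  from choice[OF this] obtain m where "\<forall>i. \<exists>s a. 1 \<le> i \<longrightarrow> P i (m i) s a" by blast
  from choice[OF this] obtain s where "\<forall>i. \<exists>a. 1 \<le> i \<longrightarrow> P i (m i) (s i) a" by blast
  from choice[OF this] obtain a where "\<forall>i. 1 \<le> i \<longrightarrow> P i (m i) (s i) (a i)" by blast
  then have a: "\<And>i r. 1 \<le> i \<Longrightarrow> sym_step (m i r) (s i r) (a i r)"
      "\<And>i. 1 \<le> i \<Longrightarrow> L2_tendsto lborel (\<lambda>r. step_function (m i r) (s i r) (a i r)) (inc_kernel 0 1)"
      "\<And>i. 1 \<le> i \<Longrightarrow> L2_tendsto M (\<lambda>r. step_integral (B i) (m i r) (s i r) (a i r)) (Z i 1)"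
    by (simp_all add: P_def)
  define U where "U r i = step_integral (B i) (m i r) (s i r) (a i r)" for r i
  define V where "V r i = step_integral (B i) (m i r) (\<lambda>k. t * s i r k) (\<lambda>k l. (1 / t) * a i r k l)" for r i
  have ss: "sym_step (m i r) (\<lambda>k. t * s i r k) (\<lambda>k l. (1 / t) * a i r k l)" if "1 \<le> i" for i r
    by (rule sym_step_scale[OF a(1)[OF that] t])
  have lim: "L2_tendsto M (\<lambda>r. U r i) (Z i 1)" "L2_tendsto M (\<lambda>r. V r i) (\<lambda>\<omega>. t powr (- H) * Z i t \<omega>)" if i: "1 \<le> i" for i
  proof -
    interpret Ri: rosenblatt H M "B i" "Z i" by (rule R[OF i])
    show "L2_tendsto M (\<lambda>r. U r i) (Z i 1)" unfolding U_def by (rule a(3)[OF i])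
    show "L2_tendsto M (\<lambda>r. V r i) (\<lambda>\<omega>. t powr (- H) * Z i t \<omega>)"
      unfolding V_def by (rule Ri.scaled_step_tendsto[OF a(1)[OF i] a(2)[OF i] t])
  qed
  have law: "distr M borel (U r i) = distr M borel (V r i)" if i: "1 \<le> i" for i r
  proof -
    interpret Ri: rosenblatt H M "B i" "Z i" by (rule R[OF i])
    \<comment> \<open>Each of the two roots of cell lengths gains \<open>sqrt t\<close>, which
      cancels the factor \<open>1 / t\<close> of the coefficients.\<close>
    have "scale_mat (\<lambda>k. t * s i r k) (\<lambda>k l. (1 / t) * a i r k l) k l = scale_mat (s i r) (a i r) k l" for k l
    proof -
      have "scale_mat (\<lambda>k. t * s i r k) (\<lambda>k l. (1 / t) * a i r k l) k l =
          (1 / t) * (sqrt t * sqrt t) * scale_mat (s i r) (a i r) k l"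
        by (simp add: scale_mat_def right_diff_distrib[symmetric] real_sqrt_mult)
      then show ?thesis using t by simp
    qed
    then show ?thesis
      unfolding U_def V_def Ri.quad_law[OF sym_step_grid[OF a(1)[OF i]]] Ri.quad_law[OF sym_step_grid[OF ss[OF i]]] by simp
  qed
  have joint: "(\<integral>\<omega>. \<phi> (\<lambda>i\<in>{1..n}. W i \<omega>) \<partial>M) = (\<integral>x. \<phi> x \<partial>(Pi\<^sub>M {1..n} (\<lambda>i. distr M borel (W i))))"
    if W: "\<And>i. 1 \<le> i \<Longrightarrow> \<exists>m s a. sym_step m s a \<and> W i = step_integral (B i) m s a" for W
  proof -
    obtain m s a where W': "\<And>i. 1 \<le> i \<Longrightarrow> sym_step (m i) (s i) (a i)"
      "\<And>i. 1 \<le> i \<Longrightarrow> W i = step_integral (B i) (m i) (s i) (a i)" 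
    proof -
      have "\<forall>i. \<exists>m s a. 1 \<le> i \<longrightarrow> sym_step m s a \<and> W i = step_integral (B i) m s a" using W by blast
      from choice[OF this] obtain m where "\<forall>i. \<exists>s a. 1 \<le> i \<longrightarrow> sym_step (m i) s a \<and> W i = step_integral (B i) (m i) s a" by blast
      from choice[OF this] obtain s where "\<forall>i. \<exists>a. 1 \<le> i \<longrightarrow> sym_step (m i) (s i) a \<and> W i = step_integral (B i) (m i) (s i) a" by blast
      from choice[OF this] obtain a where "\<forall>i. 1 \<le> i \<longrightarrow> sym_step (m i) (s i) (a i) \<and> W i = step_integral (B i) (m i) (s i) (a i)" by blast
      then show thesis by (intro that) auto
    qed
    have rv: "W i \<in> borel_measurable M" if "i \<in> {1..n}" for i
    proof -
      interpret Ri: rosenblatt H M "B i" "Z i" by (rule R) (use that in simp)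
      show ?thesis using Ri.step_integral_L2(1)[OF W'(1), of i] that W'(2)[of i] by (simp add: L2_def)
    qed
    have "indep_vars (\<lambda>_. borel) (\<lambda>i \<omega>. path_functional (m i) (s i) (a i) (\<lambda>t\<in>{0..}. B i t \<omega>)) {1..n}"
      using W'(1) by (intro indep_functionals path_functional_measurable sym_step_grid) auto
    then have "indep_vars (\<lambda>_. borel) W {1..n}"
      by (rule indep_vars_cong[THEN iffD1, rotated -1])
         (auto simp: W'(2) step_integral_path_functional[OF sym_step_grid[OF W'(1)]])
    then have P: "distr M (Pi\<^sub>M {1..n} (\<lambda>_. borel)) (\<lambda>\<omega>. \<lambda>i\<in>{1..n}. W i \<omega>) = Pi\<^sub>M {1..n} (\<lambda>i. distr M borel (W i))"
      using n rv by (subst (asm) indep_vars_iff_distr_eq_PiM') auto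
    have "(\<integral>x. \<phi> x \<partial>(distr M (Pi\<^sub>M {1..n} (\<lambda>_. borel)) (\<lambda>\<omega>. \<lambda>i\<in>{1..n}. W i \<omega>))) = (\<integral>\<omega>. \<phi> (\<lambda>i\<in>{1..n}. W i \<omega>) \<partial>M)"
      using rv by (intro integral_distr \<phi> measurable_restrict) auto
    then show ?thesis unfolding P by simp
  qed
  have "(\<integral>\<omega>. \<phi> (\<lambda>i\<in>{1..n}. U r i \<omega>) \<partial>M) = (\<integral>\<omega>. \<phi> (\<lambda>i\<in>{1..n}. V r i \<omega>) \<partial>M)" for r
  proof -
    have "(\<integral>\<omega>. \<phi> (\<lambda>i\<in>{1..n}. U r i \<omega>) \<partial>M) = (\<integral>x. \<phi> x \<partial>(Pi\<^sub>M {1..n} (\<lambda>i. distr M borel (U r i))))"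
      using a(1) unfolding U_def by (intro joint) blast
    also have "Pi\<^sub>M {1..n} (\<lambda>i. distr M borel (U r i)) = Pi\<^sub>M {1..n} (\<lambda>i. distr M borel (V r i))"
      by (intro PiM_cong refl law) auto
    also have "(\<integral>x. \<phi> x \<partial>\<dots>) = (\<integral>\<omega>. \<phi> (\<lambda>i\<in>{1..n}. V r i \<omega>) \<partial>M)"
      using ss unfolding V_def by (intro joint[symmetric]) blast
    finally show ?thesis .
  qed
  moreover have "(\<lambda>r. \<integral>\<omega>. \<phi> (\<lambda>i\<in>{1..n}. U r i \<omega>) \<partial>M) \<longlonglongrightarrow> (\<integral>\<omega>. \<phi> (\<lambda>i\<in>{1..n}. Z i 1 \<omega>) \<partial>M)"
    by (rule lipschitz_expectation_tendsto[OF _ \<phi> lip K]) (auto intro: lim)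
  moreover have "(\<lambda>r. \<integral>\<omega>. \<phi> (\<lambda>i\<in>{1..n}. V r i \<omega>) \<partial>M) \<longlonglongrightarrow> (\<integral>\<omega>. \<phi> (\<lambda>i\<in>{1..n}. t powr (- H) * Z i t \<omega>) \<partial>M)"
    by (rule lipschitz_expectation_tendsto[OF _ \<phi> lip K]) (auto intro: lim)
  ultimately show ?thesis by (simp add: LIMSEQ_unique)
qed

section \<open>Mean-square error of the matrix entries\<close>

definition entry :: "nat \<Rightarrow> nat \<Rightarrow> nat \<Rightarrow> 'a \<Rightarrow> real" where
  "entry d i k \<omega> = inverse (4 * c) * real d powr (1 - H) *
     ((1 / real d) * (\<Sum>j<d. X i j \<omega> * X k j \<omega>) - (if i = k then 1 else 0))"

text \<open>A copy of the limit that varies with \<open>d\<close> but lives close to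
  \<open>entry\<close> on the same probability space. It makes a mean-square comparison possible;
  its law is that of the true limit by self-similarity.\<close>

definition limit_entry :: "nat \<Rightarrow> nat \<Rightarrow> nat \<Rightarrow> 'a \<Rightarrow> real" where
  "limit_entry d i k \<omega> = (if i = k then real d powr (- H) * Z i (real d) \<omega> else 0)"

text \<open>The kernel over a degenerate interval has norm 0, so the isometry gives second moment
  0.\<close>

lemma Z_zero: assumes "1 \<le> i" shows "AE \<omega> in M. Z i 0 \<omega> = 0"
proof -
  interpret Ri: rosenblatt H M "B i" "Z i" by (rule R[OF assms])
  have "wiener2 M (B i) (inc_kernel 0 0) (Z i 0)"
    using rosenblatt_kernel_AE[of 0] represents_inc_kernel(1)[of 0 0]
    by (intro wiener2_cong_AE[OF Ri.wiener2_Z]) (auto simp: represents_def L2_def)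
  from Ri.wiener2_covariance[OF this this] have "(\<integral>\<omega>. (Z i 0 \<omega>)\<^sup>2 \<partial>M) = 0"
    using inc_kernel_norm[of 0 0] H by (simp add: power2_eq_square)
  then have "AE \<omega> in M. (Z i 0 \<omega>)\<^sup>2 = 0"
    using wiener2_L2(2)[OF Ri.wiener2_Z[of 0]] by (subst (asm) integral_nonneg_eq_0_iff_AE) (auto simp: L2_def)
  then show ?thesis by simp
qed

lemma entry_L2:
  assumes ik: "1 \<le> i" "1 \<le> k"
  shows "L2 M (entry d i k)" "L2 M (limit_entry d i k)"
proof -
  interpret Ri: rosenblatt H M "B i" "Z i" by (rule R[OF ik(1)])
  have "L2 M (\<lambda>\<omega>. X i j \<omega> * X k j \<omega>)" for j
  proof (cases "i = k")
    case True
    then show ?thesis using Ri.L2_X(2)[of j] by (simp only: power2_eq_square)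
  qed (rule X_product_indep(1)[OF ik])
  then show "L2 M (entry d i k)"
    unfolding entry_def[abs_def] by (intro L2_cmult L2_diff L2_sum Ri.L2_one)
  have "L2 M (\<lambda>\<omega>. real d powr (- H) * Z i (real d) \<omega>)"
    by (intro L2_cmult wiener2_L2(2)[OF Ri.wiener2_Z]) simp
  then show "L2 M (limit_entry d i k)"
    unfolding limit_entry_def[abs_def] using Ri.L2_one[of 0] by (cases "i = k") simp_all
qed

text \<open>The prefactor d^(-H) of the sums contributes d^(-2 H), and the double sums have order d
  times \<open>power_sum\<close>. The constants involve only \<open>b\<close> and \<open>c\<close>,
  so one \<open>K\<close> serves all rows, which later makes the bound uniform in
  \<open>n\<close>.\<close>

lemma entry_bound:
  "\<exists>K>0. \<forall>i\<ge>1. \<forall>k\<ge>1. \<forall>d\<ge>1. (\<integral>\<omega>. (entry d i k \<omega> - limit_entry d i k \<omega>)\<^sup>2 \<partial>M) \<le>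
     K * (real d powr (1 - 2 * H) * power_sum (4 * H - 4) d)"
proof -
  define K1 where "K1 = (inverse (4 * c))\<^sup>2 * (4 * 1 + 4 * 0 + 2 * (4 * b ^ 4))"
  define K2 where "K2 = 4 * (28 / (16 * c\<^sup>2) + 2) + 4 * (4 * b\<^sup>2) + 2 * (3 / 2 * (b ^ 4 / c\<^sup>2))"
  have K: "0 \<le> K1" "0 < K2" using c_pos b_pos by (auto simp: K1_def K2_def intro!: add_pos_pos add_nonneg_nonneg)
  have P: "0 \<le> real d powr (1 - 2 * H) * power_sum (4 * H - 4) d" for d
    by (simp add: power_sum_def sum_nonneg)
  have powr: "(real d powr (- H))\<^sup>2 * (real d * power_sum (4 * H - 4) d) = real d powr (1 - 2 * H) * power_sum (4 * H - 4) d" if "1 \<le> d" for d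
  proof -
    have "(real d powr (- H))\<^sup>2 * real d = real d powr (- H) * real d powr (- H) * real d powr 1" using that by (simp add: power2_eq_square)
    also have "\<dots> = real d powr (- H + - H + 1)" by (simp only: powr_add)
    finally show ?thesis by (simp add: mult.assoc[symmetric])
  qed
  have scale: "real d powr (1 - H) * (1 / real d) = real d powr (- H)" if "1 \<le> d" for d
  proof -
    have "real d powr (1 + - H) = real d powr 1 * real d powr (- H)" by (simp only: powr_add)
    then show ?thesis using that by simp
  qed
  have "(\<integral>\<omega>. (entry d i k \<omega> - limit_entry d i k \<omega>)\<^sup>2 \<partial>M) \<le> (K1 + K2) * (real d powr (1 - 2 * H) * power_sum (4 * H - 4) d)"
    if i: "1 \<le> i" "1 \<le> k" "1 \<le> d" for i k d
  proof (cases "i = k")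
    case False
    have "entry d i k \<omega> - limit_entry d i k \<omega> = inverse (4 * c) * real d powr (- H) * (\<Sum>j<d. X i j \<omega> * X k j \<omega>)" for \<omega>
      using False by (simp add: entry_def limit_entry_def scale[OF i(3), symmetric])
    then have "(entry d i k \<omega> - limit_entry d i k \<omega>)\<^sup>2 =
        ((inverse (4 * c))\<^sup>2 * (real d powr (- H))\<^sup>2) * (\<Sum>j<d. X i j \<omega> * X k j \<omega>)\<^sup>2" for \<omega>
      by (simp only: power_mult_distrib)
    then have "(\<integral>\<omega>. (entry d i k \<omega> - limit_entry d i k \<omega>)\<^sup>2 \<partial>M) =
        (inverse (4 * c))\<^sup>2 * (real d powr (- H))\<^sup>2 * (\<integral>\<omega>. (\<Sum>j<d. X i j \<omega> * X k j \<omega>)\<^sup>2 \<partial>M)"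
      by (simp only: integral_mult_right_zero)
    also have "\<dots> \<le> (inverse (4 * c))\<^sup>2 * (real d powr (- H))\<^sup>2 * ((4 * 1 + 4 * 0 + 2 * (4 * b ^ 4)) * (real d * power_sum (4 * H - 4) d))"
      by (intro mult_left_mono off_diagonal_bound i False) auto
    also have "\<dots> = K1 * (real d powr (1 - 2 * H) * power_sum (4 * H - 4) d)"
      unfolding powr[OF i(3), symmetric] K1_def by (simp only: mult_ac)
    also have "\<dots> \<le> (K1 + K2) * (real d powr (1 - 2 * H) * power_sum (4 * H - 4) d)"
      using K by (intro mult_right_mono P) auto
    finally show ?thesis .
  next
    case True
    interpret Ri: rosenblatt H M "B i" "Z i" by (rule R[OF i(1)])
    have eq: "entry d i i \<omega> - limit_entry d i i \<omega> = real d powr (- H) * (\<Sum>j<d. Ri.xi j \<omega>) - real d powr (- H) * Z i 0 \<omega>" for \<omega>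
    proof -
      have X: "(\<Sum>j<d. X i j \<omega>) = Z i (real d) \<omega> - Z i 0 \<omega>"
        using sum_lessThan_telescope[of "\<lambda>j. Z i (real j) \<omega>" d] by (simp add: Ri.X_def add.commute)
      have "(\<Sum>j<d. Ri.xi j \<omega>) = ((\<Sum>j<d. X i j \<omega> * X i j \<omega>) - real d) / (4 * c) - (\<Sum>j<d. X i j \<omega>)"
        by (simp add: Ri.xi_def sum_subtractf sum_divide_distrib[symmetric] power2_eq_square)
      moreover have "entry d i i \<omega> = real d powr (- H) * (((\<Sum>j<d. X i j \<omega> * X i j \<omega>) - real d) / (4 * c))"
      proof -
        have d: "real d \<noteq> 0" using i(3) by simp
        have p: "real d powr (1 - H) = real d powr (- H) * real d"
          using scale[OF i(3)] d by (simp add: field_simps)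
        have "p' * d' * (1 / d' * S - 1) / (4 * c) = p' * ((S - d') / (4 * c))" if "d' \<noteq> 0" for p' d' S :: real
        proof -
          have "d' * (1 / d' * S - 1) = S - d'" using that by (simp add: right_diff_distrib)
          then show ?thesis by (simp only: mult.assoc times_divide_eq_right)
        qed
        moreover have "inverse a * y * z = y * z / a" for a y z :: real by (simp add: divide_inverse)
        ultimately show ?thesis using d by (simp only: entry_def p simp_thms if_True)
      qed
      ultimately show ?thesis unfolding limit_entry_def X by (simp add: right_diff_distrib)
    qed
    have m: "L2 M (\<lambda>\<omega>. \<Sum>j<d. Ri.xi j \<omega>)" "L2 M (Z i 0)" by (auto intro: L2_sum Ri.L2_xi wiener2_L2(2) Ri.wiener2_Z)
    have "(\<integral>\<omega>. (entry d i k \<omega> - limit_entry d i k \<omega>)\<^sup>2 \<partial>M) = (\<integral>\<omega>. (real d powr (- H) * (\<Sum>j<d. Ri.xi j \<omega>))\<^sup>2 \<partial>M)"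
      unfolding True[symmetric] eq
    proof (rule integral_cong_AE)
      show "(\<lambda>\<omega>. (real d powr (- H) * (\<Sum>j<d. Ri.xi j \<omega>) - real d powr (- H) * Z i 0 \<omega>)\<^sup>2) \<in> borel_measurable M"
        "(\<lambda>\<omega>. (real d powr (- H) * (\<Sum>j<d. Ri.xi j \<omega>))\<^sup>2) \<in> borel_measurable M"
        by (intro borel_measurable_power borel_measurable_diff borel_measurable_times borel_measurable_const
            L2_measurable[OF m(1)] L2_measurable[OF m(2)])+
      show "AE \<omega> in M. (real d powr (- H) * (\<Sum>j<d. Ri.xi j \<omega>) - real d powr (- H) * Z i 0 \<omega>)\<^sup>2 =
          (real d powr (- H) * (\<Sum>j<d. Ri.xi j \<omega>))\<^sup>2"
        using Z_zero[OF i(1)] by (rule eventually_mono) simp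
    qed
    also have "\<dots> = (real d powr (- H))\<^sup>2 * (\<integral>\<omega>. (\<Sum>j<d. Ri.xi j \<omega>)\<^sup>2 \<partial>M)"
      by (simp add: power_mult_distrib)
    also have "\<dots> \<le> (real d powr (- H))\<^sup>2 * (K2 * (real d * power_sum (4 * H - 4) d))"
      unfolding K2_def by (intro mult_left_mono Ri.xi_sum_bound i) auto
    also have "\<dots> = K2 * (real d powr (1 - 2 * H) * power_sum (4 * H - 4) d)"
      unfolding powr[OF i(3), symmetric] by (simp only: mult_ac)
    also have "\<dots> \<le> (K1 + K2) * (real d powr (1 - 2 * H) * power_sum (4 * H - 4) d)"
      using K by (intro mult_right_mono P) auto
    finally show ?thesis .
  qed
  moreover have "0 < K1 + K2" using K by simp
  ultimately show ?thesis by blast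
qed

lemma entry_rate:
  "\<exists>C>0. \<forall>i\<ge>1. \<forall>k\<ge>1. \<forall>d\<ge>1. (H = 3/4 \<longrightarrow> d \<ge> 2) \<longrightarrow>
     (\<integral>\<omega>. (entry d i k \<omega> - limit_entry d i k \<omega>)\<^sup>2 \<partial>M) \<le> (C * wasserstein_rate H 1 d)\<^sup>2"
proof -
  obtain K where K: "K > 0" "\<And>i k d. 1 \<le> i \<Longrightarrow> 1 \<le> k \<Longrightarrow> 1 \<le> d \<Longrightarrow>
      (\<integral>\<omega>. (entry d i k \<omega> - limit_entry d i k \<omega>)\<^sup>2 \<partial>M) \<le> K * (real d powr (1 - 2 * H) * power_sum (4 * H - 4) d)"
    using entry_bound by blast
  obtain K' where K': "K' > 0" "\<And>d. 1 \<le> d \<Longrightarrow> (H = 3/4 \<longrightarrow> d \<ge> 2) \<Longrightarrow>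
      real d powr (1 - 2 * H) * power_sum (4 * H - 4) d \<le> K' * (wasserstein_rate H 1 d)\<^sup>2"
    using power_sum_rate by blast
  have "(\<integral>\<omega>. (entry d i k \<omega> - limit_entry d i k \<omega>)\<^sup>2 \<partial>M) \<le> (sqrt (K * K') * wasserstein_rate H 1 d)\<^sup>2"
    if "1 \<le> i" "1 \<le> k" "1 \<le> d" "H = 3/4 \<longrightarrow> d \<ge> 2" for i k d
  proof -
    have "(\<integral>\<omega>. (entry d i k \<omega> - limit_entry d i k \<omega>)\<^sup>2 \<partial>M) \<le> K * (K' * (wasserstein_rate H 1 d)\<^sup>2)"
      using K(1) by (intro order_trans[OF K(2)] mult_left_mono K'(2) that) auto
    also have "\<dots> = (sqrt (K * K') * wasserstein_rate H 1 d)\<^sup>2"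
      using K(1) K'(1) by (simp add: power_mult_distrib)
    finally show ?thesis .
  qed
  moreover have "0 < sqrt (K * K')" using K(1) K'(1) by simp
  ultimately show ?thesis by blast
qed

end

subsection \<open>Lipschitz functions of random matrices\<close>

lemma hs_norm_mat_diff:
  "hs_norm (Matrix.mat n n x - Matrix.mat n n y) = sqrt (\<Sum>i<n. \<Sum>j<n. (x (i, j) - y (i, j))\<^sup>2)"
  by (simp add: hs_norm_def)

text \<open>The supremum in \<open>lip_norm\<close> ranges over distinct matrices, so equal ones are
  treated apart. For distinct ones the norm of the difference is positive and the bound on the
  quotient can be multiplied out.\<close>

lemma lip_norm_le_1D:
  assumes g: "lip_norm n g \<le> 1"
  shows "\<bar>g (Matrix.mat n n x) - g (Matrix.mat n n y)\<bar> \<le> sqrt (\<Sum>i<n. \<Sum>j<n. (x (i, j) - y (i, j))\<^sup>2)"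
proof (cases "Matrix.mat n n x = Matrix.mat n n y")
  case True
  then show ?thesis by (simp add: sum_nonneg)
next
  case False
  define A where "A = Matrix.mat n n x"
  define B where "B = Matrix.mat n n y"
  have hs: "hs_norm (A - B) = sqrt (\<Sum>i<n. \<Sum>j<n. (x (i, j) - y (i, j))\<^sup>2)"
    unfolding A_def B_def by (rule hs_norm_mat_diff)
  have "\<exists>i<n. \<exists>j<n. x (i, j) \<noteq> y (i, j)"
  proof (rule ccontr)
    assume "\<not> ?thesis"
    then have "A = B" unfolding A_def B_def by (intro eq_matI) auto
    then show False using False by (simp add: A_def B_def)
  qed
  then obtain i j where ij: "i < n" "j < n" "x (i, j) \<noteq> y (i, j)" by blast
  have "0 < (x (i, j) - y (i, j))\<^sup>2" using ij by simp
  also have "\<dots> \<le> (\<Sum>j<n. (x (i, j) - y (i, j))\<^sup>2)"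
    using ij by (intro member_le_sum) auto
  also have "\<dots> \<le> (\<Sum>i<n. \<Sum>j<n. (x (i, j) - y (i, j))\<^sup>2)"
    using ij by (intro member_le_sum[where f = "\<lambda>i. \<Sum>j<n. (x (i, j) - y (i, j))\<^sup>2"]) (auto intro: sum_nonneg)
  finally have pos: "0 < hs_norm (A - B)" unfolding hs by simp
  have "ennreal (\<bar>g A - g B\<bar> / hs_norm (A - B)) \<le> lip_norm n g"
    unfolding lip_norm_def using False by (intro SUP_upper2[of "(A, B)"]) (auto simp: A_def B_def)
  from order_trans[OF this g] have "\<bar>g A - g B\<bar> / hs_norm (A - B) \<le> 1"
    by (simp only: ennreal_le_1)
  then have "\<bar>g A - g B\<bar> \<le> hs_norm (A - B)" using pos by simp
  then show ?thesis unfolding hs unfolding A_def B_def .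
qed

text \<open>Matrices are handled through their entry functions, which carry the product topology.
  There \<open>g\<close> is continuous because the distance involves finitely many
  coordinates.\<close>

lemma lip_norm_measurable:
  assumes g: "lip_norm n g \<le> 1"
  shows "(\<lambda>x :: nat \<times> nat \<Rightarrow> real. g (Matrix.mat n n x)) \<in> borel_measurable borel"
proof (rule borel_measurable_continuous_onI)
  show "continuous_on UNIV (\<lambda>x :: nat \<times> nat \<Rightarrow> real. g (Matrix.mat n n x))"
    unfolding continuous_on_def
  proof (intro ballI)
    fix x :: "nat \<times> nat \<Rightarrow> real"
    have "continuous_on UNIV (\<lambda>y :: nat \<times> nat \<Rightarrow> real. sqrt (\<Sum>i<n. \<Sum>j<n. (y (i, j) - x (i, j))\<^sup>2))"
      by (intro continuous_intros continuous_on_product_coordinates)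
    from this[unfolded continuous_on_def, rule_format, of x]
    have "((\<lambda>y :: nat \<times> nat \<Rightarrow> real. sqrt (\<Sum>i<n. \<Sum>j<n. (y (i, j) - x (i, j))\<^sup>2)) \<longlongrightarrow> 0) (at x within UNIV)"
      by simp
    then have "((\<lambda>y. g (Matrix.mat n n y) - g (Matrix.mat n n x)) \<longlongrightarrow> 0) (at x within UNIV)"
      by (rule Lim_null_comparison[rotated], intro always_eventually allI, unfold real_norm_def, intro lip_norm_le_1D[OF g])
    then show "((\<lambda>y. g (Matrix.mat n n y)) \<longlongrightarrow> g (Matrix.mat n n x)) (at x within UNIV)"
      by (simp add: LIM_zero_iff)
  qed
qed

text \<open>Setting the coordinates outside the matrix to 0 reduces measurability of a random entry
  function to that of the entries inside.\<close>

lemma mat_restrict: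
  "Matrix.mat n n x = Matrix.mat n n (\<lambda>p. if p \<in> {..<n} \<times> {..<n} then x p else 0)"
  by (intro eq_matI) auto

text \<open>The norm stays intact until Cauchy-Schwarz has been applied to it as a whole. The root
  is thus taken over the sum of all n^2 mean squares, which later yields the factor n rather than
  n^2.\<close>

lemma (in prob_space) lipschitz_matrix_expectation:
  assumes g: "lip_norm n g \<le> 1"
    and X: "\<And>i j. i < n \<Longrightarrow> j < n \<Longrightarrow> L2 M (\<lambda>\<omega>. X \<omega> (i, j))"
    and Y: "\<And>i j. i < n \<Longrightarrow> j < n \<Longrightarrow> L2 M (\<lambda>\<omega>. Y \<omega> (i, j))"
  shows "\<bar>(\<integral>\<omega>. g (Matrix.mat n n (X \<omega>)) \<partial>M) - (\<integral>\<omega>. g (Matrix.mat n n (Y \<omega>)) \<partial>M)\<bar> \<le>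
    sqrt (\<Sum>i<n. \<Sum>j<n. \<integral>\<omega>. (X \<omega> (i, j) - Y \<omega> (i, j))\<^sup>2 \<partial>M)"
proof -
  have m: "(\<lambda>\<omega>. g (Matrix.mat n n (X \<omega>))) \<in> borel_measurable M"
    if X: "\<And>i j. i < n \<Longrightarrow> j < n \<Longrightarrow> L2 M (\<lambda>\<omega>. X \<omega> (i, j))" for X
  proof -
    have "(\<lambda>\<omega> p. if p \<in> {..<n} \<times> {..<n} then X \<omega> p else 0) \<in> borel_measurable M"
    proof (rule measurable_coordinatewise_then_product)
      fix p
      show "(\<lambda>\<omega>. if p \<in> {..<n} \<times> {..<n} then X \<omega> p else 0) \<in> borel_measurable M"
        using X[of "fst p" "snd p"] by (cases "p \<in> {..<n} \<times> {..<n}") (auto simp: L2_def)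
    qed
    from measurable_compose[OF this lip_norm_measurable[OF g]] show ?thesis
      by (simp only: mat_restrict[symmetric])
  qed
  have LD: "L2 M (\<lambda>\<omega>. sqrt (\<Sum>i<n. \<Sum>j<n. (X \<omega> (i, j) - Y \<omega> (i, j))\<^sup>2))"
    "(\<integral>\<omega>. (sqrt (\<Sum>i<n. \<Sum>j<n. (X \<omega> (i, j) - Y \<omega> (i, j))\<^sup>2))\<^sup>2 \<partial>M) = (\<Sum>i<n. \<Sum>j<n. \<integral>\<omega>. (X \<omega> (i, j) - Y \<omega> (i, j))\<^sup>2 \<partial>M)"
    if X: "\<And>i j. i < n \<Longrightarrow> j < n \<Longrightarrow> L2 M (\<lambda>\<omega>. X \<omega> (i, j))"
      and Y: "\<And>i j. i < n \<Longrightarrow> j < n \<Longrightarrow> L2 M (\<lambda>\<omega>. Y \<omega> (i, j))" for X Y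
  proof -
    have D: "L2 M (\<lambda>\<omega>. X \<omega> (i, j) - Y \<omega> (i, j))" if "i < n" "j < n" for i j
      using that by (intro L2_diff X Y)
    have sq: "(sqrt (\<Sum>i<n. \<Sum>j<n. (X \<omega> (i, j) - Y \<omega> (i, j))\<^sup>2))\<^sup>2 = (\<Sum>i<n. \<Sum>j<n. (X \<omega> (i, j) - Y \<omega> (i, j))\<^sup>2)" for \<omega>
      by (intro real_sqrt_pow2 sum_nonneg) auto
    have i: "integrable M (\<lambda>\<omega>. \<Sum>i<n. \<Sum>j<n. (X \<omega> (i, j) - Y \<omega> (i, j))\<^sup>2)"
      by (intro Bochner_Integration.integrable_sum L2_integrable_square D) auto
    show "L2 M (\<lambda>\<omega>. sqrt (\<Sum>i<n. \<Sum>j<n. (X \<omega> (i, j) - Y \<omega> (i, j))\<^sup>2))"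
      unfolding L2_def sq using i by (auto intro: borel_measurable_integrable)
    have "(\<integral>\<omega>. (\<Sum>i<n. \<Sum>j<n. (X \<omega> (i, j) - Y \<omega> (i, j))\<^sup>2) \<partial>M) = (\<Sum>i<n. \<integral>\<omega>. (\<Sum>j<n. (X \<omega> (i, j) - Y \<omega> (i, j))\<^sup>2) \<partial>M)"
      by (intro Bochner_Integration.integral_sum Bochner_Integration.integrable_sum L2_integrable_square D) auto
    also have "\<dots> = (\<Sum>i<n. \<Sum>j<n. \<integral>\<omega>. (X \<omega> (i, j) - Y \<omega> (i, j))\<^sup>2 \<partial>M)"
      by (intro sum.cong refl Bochner_Integration.integral_sum L2_integrable_square D) auto
    finally show "(\<integral>\<omega>. (sqrt (\<Sum>i<n. \<Sum>j<n. (X \<omega> (i, j) - Y \<omega> (i, j))\<^sup>2))\<^sup>2 \<partial>M) = (\<Sum>i<n. \<Sum>j<n. \<integral>\<omega>. (X \<omega> (i, j) - Y \<omega> (i, j))\<^sup>2 \<partial>M)"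
      unfolding sq .
  qed
  have i: "integrable M (\<lambda>\<omega>. g (Matrix.mat n n (X \<omega>)))"
    if X: "\<And>i j. i < n \<Longrightarrow> j < n \<Longrightarrow> L2 M (\<lambda>\<omega>. X \<omega> (i, j))" for X
  proof (rule Bochner_Integration.integrable_bound[OF _ m[of X, OF X]])
    show "integrable M (\<lambda>\<omega>. \<bar>g (Matrix.mat n n (\<lambda>p. 0))\<bar> + sqrt (\<Sum>i<n. \<Sum>j<n. (X \<omega> (i, j) - 0)\<^sup>2))"
      using LD(1)[of X "\<lambda>\<omega> p. 0", OF X]
      by (intro Bochner_Integration.integrable_add integrable_const abs_integral_le_L2(2)) (auto simp: L2_def)
    have "\<bar>g (Matrix.mat n n (X \<omega>))\<bar> \<le> \<bar>g (Matrix.mat n n (\<lambda>p. 0))\<bar> + sqrt (\<Sum>i<n. \<Sum>j<n. (X \<omega> (i, j) - 0)\<^sup>2)" for \<omega>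
      using lip_norm_le_1D[OF g, of "X \<omega>" "\<lambda>p. 0"] by linarith
    then show "AE \<omega> in M. norm (g (Matrix.mat n n (X \<omega>))) \<le> norm (\<bar>g (Matrix.mat n n (\<lambda>p. 0))\<bar> + sqrt (\<Sum>i<n. \<Sum>j<n. (X \<omega> (i, j) - 0)\<^sup>2))"
      unfolding real_norm_def by (intro AE_I2 order_trans[OF _ abs_ge_self])
  qed
  have L: "L2 M (\<lambda>\<omega>. sqrt (\<Sum>i<n. \<Sum>j<n. (X \<omega> (i, j) - Y \<omega> (i, j))\<^sup>2))"
    by (rule LD(1)) (auto intro: X Y)
  have S: "(\<integral>\<omega>. (sqrt (\<Sum>i<n. \<Sum>j<n. (X \<omega> (i, j) - Y \<omega> (i, j))\<^sup>2))\<^sup>2 \<partial>M) = (\<Sum>i<n. \<Sum>j<n. \<integral>\<omega>. (X \<omega> (i, j) - Y \<omega> (i, j))\<^sup>2 \<partial>M)"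
    by (rule LD(2)) (auto intro: X Y)
  have "\<bar>(\<integral>\<omega>. g (Matrix.mat n n (X \<omega>)) \<partial>M) - (\<integral>\<omega>. g (Matrix.mat n n (Y \<omega>)) \<partial>M)\<bar> =
      \<bar>\<integral>\<omega>. g (Matrix.mat n n (X \<omega>)) - g (Matrix.mat n n (Y \<omega>)) \<partial>M\<bar>"
    using i[of X, OF X] i[of Y, OF Y] by simp
  also have "\<dots> \<le> (\<integral>\<omega>. \<bar>g (Matrix.mat n n (X \<omega>)) - g (Matrix.mat n n (Y \<omega>))\<bar> \<partial>M)" by (rule integral_abs_bound)
  also have "\<dots> \<le> (\<integral>\<omega>. \<bar>sqrt (\<Sum>i<n. \<Sum>j<n. (X \<omega> (i, j) - Y \<omega> (i, j))\<^sup>2)\<bar> \<partial>M)"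
    using i[of X, OF X] i[of Y, OF Y] lip_norm_le_1D[OF g] abs_integral_le_L2(2)[OF L]
    by (intro integral_mono) (auto intro: order_trans[OF _ abs_ge_self])
  also have "\<dots> \<le> sqrt (\<Sum>i<n. \<Sum>j<n. \<integral>\<omega>. (X \<omega> (i, j) - Y \<omega> (i, j))\<^sup>2 \<partial>M)"
    using abs_integral_le_L2(1)[OF L] unfolding S .
  finally show ?thesis .
qed

lemma cts_step_lipschitz:
  assumes "x < y"
  shows "\<bar>cts_step x y u - cts_step x y v\<bar> \<le> 1 / (y - x) * \<bar>u - v\<bar>"
proof -
  have *: "cts_step x y u = min 1 (max 0 ((y - u) / (y - x)))" for u
    using assms by (auto simp: cts_step_def field_simps min_def max_def)
  have "\<bar>min 1 (max 0 a) - min 1 (max 0 b)\<bar> \<le> \<bar>a - b\<bar>" for a b :: real by (auto simp: min_def max_def)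
  then have "\<bar>cts_step x y u - cts_step x y v\<bar> \<le> \<bar>(y - u) / (y - x) - (y - v) / (y - x)\<bar>" unfolding * .
  also have "(y - u) / (y - x) - (y - v) / (y - x) = (v - u) / (y - x)" by (simp flip: diff_divide_distrib)
  finally show ?thesis using assms by (simp add: abs_minus_commute)
qed

subsection \<open>Convergence of the renormalized Wishart matrix\<close>

context rosenblatt_family
begin

lemma renorm_wishart_matrix_eq:
  "renorm_wishart_matrix H Z n d \<omega> = Matrix.mat n n (\<lambda>(i, k). entry d (Suc i) (Suc k) \<omega>)"
proof (rule eq_matI)
  fix i k assume "i < dim_row (Matrix.mat n n (\<lambda>(i, k). entry d (Suc i) (Suc k) \<omega>))"
    "k < dim_col (Matrix.mat n n (\<lambda>(i, k). entry d (Suc i) (Suc k) \<omega>))"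
  then have ik: "i < n" "k < n" by auto
  have X: "Z (Suc i) (real (Suc j)) \<omega> - Z (Suc i) (real j) \<omega> = X (Suc i) j \<omega>" for i j
    using rosenblatt.X_def[OF R[of "Suc i"], of j \<omega>] by (simp add: add.commute)
  show "renorm_wishart_matrix H Z n d \<omega> $$ (i, k) = Matrix.mat n n (\<lambda>(i, k). entry d (Suc i) (Suc k) \<omega>) $$ (i, k)"
    using ik unfolding renorm_wishart_matrix_def wishart_matrix_def increment_matrix_def X
    by (simp add: scalar_prod_def entry_def renorm_const_def lessThan_atLeast0)
qed (auto simp: renorm_wishart_matrix_def wishart_matrix_def increment_matrix_def)

lemma rosenblatt_matrix_eq:
  "rosenblatt_matrix Z n \<omega> = Matrix.mat n n (\<lambda>(i, k). if i = k then Z (Suc i) 1 \<omega> else 0)"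
  unfolding rosenblatt_matrix_def mat_diag_def by (intro eq_matI) auto

lemma Z1_L2: "1 \<le> i \<Longrightarrow> L2 M (Z i 1)"
  using wiener2_L2(2)[OF rosenblatt.wiener2_Z[OF R[of i]], of 1] by simp

text \<open>Composed with the embedding of vectors as diagonal matrices, \<open>g\<close> is
  Lipschitz for the sum of absolute values, as the joint law statement demands.\<close>

lemma limit_matrix_expectation:
  assumes g: "lip_norm n g \<le> 1" and n: "1 \<le> n" and d: "1 \<le> d"
  shows "(\<integral>\<omega>. g (Matrix.mat n n (\<lambda>(i, k). limit_entry d (Suc i) (Suc k) \<omega>)) \<partial>M) = (\<integral>\<omega>. g (rosenblatt_matrix Z n \<omega>) \<partial>M)"
proof -
  define \<phi> where "\<phi> x = g (Matrix.mat n n (\<lambda>(i, k). if i = k then x (Suc i) else 0))" for x :: "nat \<Rightarrow> real"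
  have m: "\<phi> \<in> borel_measurable (Pi\<^sub>M {1..n} (\<lambda>_. borel))"
  proof -
    have "(\<lambda>x p. if p \<in> {..<n} \<times> {..<n} then (case p of (i, k) \<Rightarrow> if i = k then x (Suc i) else 0) else (0 :: real))
        \<in> borel_measurable (Pi\<^sub>M {1..n} (\<lambda>_. borel))"
    proof (rule measurable_coordinatewise_then_product)
      fix p :: "nat \<times> nat"
      show "(\<lambda>x. if p \<in> {..<n} \<times> {..<n} then (case p of (i, k) \<Rightarrow> if i = k then x (Suc i) else 0) else (0 :: real))
        \<in> borel_measurable (Pi\<^sub>M {1..n} (\<lambda>_. borel))"
      proof (cases "p \<in> {..<n} \<times> {..<n} \<and> fst p = snd p")
        case True
        then have "(\<lambda>x :: nat \<Rightarrow> real. x (Suc (fst p))) \<in> borel_measurable (Pi\<^sub>M {1..n} (\<lambda>_. borel))"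
          by (intro measurable_component_singleton) auto
        then show ?thesis using True by (auto simp: case_prod_beta)
      next
        case False
        then have "(\<lambda>x. if p \<in> {..<n} \<times> {..<n} then (case p of (i, k) \<Rightarrow> if i = k then x (Suc i) else 0) else (0 :: real)) = (\<lambda>x. 0)"
          by (auto simp: case_prod_beta fun_eq_iff)
        then show ?thesis by simp
      qed
    qed
    from measurable_compose[OF this lip_norm_measurable[OF g]] show ?thesis
      unfolding \<phi>_def[abs_def] by (simp only: mat_restrict[symmetric])
  qed
  have lip: "\<bar>\<phi> x - \<phi> y\<bar> \<le> 1 * (\<Sum>i\<in>{1..n}. \<bar>x i - y i\<bar>)" for x y
  proof -
    have "\<bar>\<phi> x - \<phi> y\<bar> \<le> sqrt (\<Sum>i<n. \<Sum>k<n. ((if i = k then x (Suc i) else 0) - (if i = k then y (Suc i) else 0))\<^sup>2)"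
      unfolding \<phi>_def using lip_norm_le_1D[OF g, of "\<lambda>(i, k). if i = k then x (Suc i) else 0" "\<lambda>(i, k). if i = k then y (Suc i) else 0"] by simp
    also have "(\<Sum>i<n. \<Sum>k<n. ((if i = k then x (Suc i) else 0) - (if i = k then y (Suc i) else 0))\<^sup>2) = (\<Sum>i<n. (x (Suc i) - y (Suc i))\<^sup>2)"
    proof (intro sum.cong refl)
      fix i assume "i \<in> {..<n}"
      have "(\<Sum>k<n. ((if i = k then x (Suc i) else 0) - (if i = k then y (Suc i) else 0))\<^sup>2) = (\<Sum>k<n. if i = k then (x (Suc i) - y (Suc i))\<^sup>2 else 0)"
        by (intro sum.cong) auto
      then show "(\<Sum>k<n. ((if i = k then x (Suc i) else 0) - (if i = k then y (Suc i) else 0))\<^sup>2) = (x (Suc i) - y (Suc i))\<^sup>2"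
        using \<open>i \<in> {..<n}\<close> by simp
    qed
    also have "sqrt (\<Sum>i<n. (x (Suc i) - y (Suc i))\<^sup>2) \<le> (\<Sum>i<n. \<bar>x (Suc i) - y (Suc i)\<bar>)"
      using L2_set_le_sum_abs[of "\<lambda>i. x (Suc i) - y (Suc i)" "{..<n}"] by (simp add: L2_set_def)
    also have "\<dots> = (\<Sum>i\<in>{1..n}. \<bar>x i - y i\<bar>)"
      using sum.atLeast1_atMost_eq[of "\<lambda>i. \<bar>x i - y i\<bar>" n] by simp
    finally show ?thesis by simp
  qed
  have "(\<integral>\<omega>. g (Matrix.mat n n (\<lambda>(i, k). limit_entry d (Suc i) (Suc k) \<omega>)) \<partial>M) =
      (\<integral>\<omega>. \<phi> (\<lambda>i\<in>{1..n}. real d powr (- H) * Z i (real d) \<omega>) \<partial>M)"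
    unfolding \<phi>_def by (intro Bochner_Integration.integral_cong refl arg_cong[where f = g] eq_matI) (auto simp: limit_entry_def)
  also have "\<dots> = (\<integral>\<omega>. \<phi> (\<lambda>i\<in>{1..n}. Z i 1 \<omega>) \<partial>M)"
    using d by (intro joint_law[OF n m lip]) auto
  also have "\<dots> = (\<integral>\<omega>. g (rosenblatt_matrix Z n \<omega>) \<partial>M)"
    unfolding \<phi>_def rosenblatt_matrix_eq by (intro Bochner_Integration.integral_cong refl arg_cong[where f = g] eq_matI) auto
  finally show ?thesis .
qed

text \<open>Replacing the limit matrix by its copy built from \<open>Z i (real d)\<close> changes no
  expectation. The rest is a comparison on one probability space, with n^2 equal bounds under the
  root.\<close>

lemma wasserstein_bound:
  "\<exists>C>0. \<forall>n\<ge>1. \<forall>d\<ge>1. (H = 3/4 \<longrightarrow> d \<ge> 2) \<longrightarrow>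
    wasserstein_dist n M (renorm_wishart_matrix H Z n d) M (rosenblatt_matrix Z n) \<le> ennreal (C * wasserstein_rate H n d)"
proof -
  obtain C where C: "C > 0" "\<And>i k d. 1 \<le> i \<Longrightarrow> 1 \<le> k \<Longrightarrow> 1 \<le> d \<Longrightarrow> (H = 3/4 \<longrightarrow> d \<ge> 2) \<Longrightarrow>
     (\<integral>\<omega>. (entry d i k \<omega> - limit_entry d i k \<omega>)\<^sup>2 \<partial>M) \<le> (C * wasserstein_rate H 1 d)\<^sup>2"
    using entry_rate by blast
  have "wasserstein_dist n M (renorm_wishart_matrix H Z n d) M (rosenblatt_matrix Z n) \<le> ennreal (C * wasserstein_rate H n d)"
    if nd: "1 \<le> n" "1 \<le> d" "H = 3/4 \<longrightarrow> d \<ge> 2" for n d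
    unfolding wasserstein_dist_def
  proof (rule SUP_least)
    fix g assume "g \<in> {g. lip_norm n g \<le> 1}"
    then have g: "lip_norm n g \<le> 1" by simp
    have rate: "0 \<le> wasserstein_rate H 1 d" "wasserstein_rate H n d = real n * wasserstein_rate H 1 d"
      using nd by (auto simp: wasserstein_rate_def)
    have "\<bar>(\<integral>\<omega>. g (renorm_wishart_matrix H Z n d \<omega>) \<partial>M) - (\<integral>\<omega>. g (rosenblatt_matrix Z n \<omega>) \<partial>M)\<bar> =
      \<bar>(\<integral>\<omega>. g (Matrix.mat n n (\<lambda>(i, k). entry d (Suc i) (Suc k) \<omega>)) \<partial>M) -
       (\<integral>\<omega>. g (Matrix.mat n n (\<lambda>(i, k). limit_entry d (Suc i) (Suc k) \<omega>)) \<partial>M)\<bar>"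
      by (simp only: renorm_wishart_matrix_eq limit_matrix_expectation[OF g nd(1,2)])
    also have "\<dots> \<le> sqrt (\<Sum>i<n. \<Sum>k<n. \<integral>\<omega>. ((case (i, k) of (i, k) \<Rightarrow> entry d (Suc i) (Suc k) \<omega>) -
        (case (i, k) of (i, k) \<Rightarrow> limit_entry d (Suc i) (Suc k) \<omega>))\<^sup>2 \<partial>M)"
      by (intro lipschitz_matrix_expectation g) (auto intro: entry_L2)
    also have "\<dots> \<le> sqrt (\<Sum>i<n. \<Sum>k<n. (C * wasserstein_rate H 1 d)\<^sup>2)"
      by (intro real_sqrt_le_mono sum_mono) (unfold prod.case, rule C(2), use nd in auto)
    also have "\<dots> = real n * (C * wasserstein_rate H 1 d)"
      using rate(1) C(1) by (simp add: real_sqrt_mult real_sqrt_abs mult.assoc[symmetric] power_mult_distrib)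
    finally show "ennreal \<bar>(\<integral>\<omega>. g (renorm_wishart_matrix H Z n d \<omega>) \<partial>M) - (\<integral>\<omega>. g (rosenblatt_matrix Z n \<omega>) \<partial>M)\<bar>
      \<le> ennreal (C * wasserstein_rate H n d)"
      unfolding rate(2) by (intro ennreal_leI) (simp add: mult_ac)
  qed
  then show ?thesis using C(1) by blast
qed

text \<open>Continuous step functions determine weak convergence and are Lipschitz, so the
  mean-square estimate for a single entry suffices.\<close>

lemma entry_weak_conv:
  assumes n: "i < n" "k < n"
  shows "weak_conv_m (\<lambda>d. distr M borel (\<lambda>\<omega>. renorm_wishart_matrix H Z n d \<omega> $$ (i, k)))
    (distr M borel (\<lambda>\<omega>. rosenblatt_matrix Z n \<omega> $$ (i, k)))"
proof -
  have eq: "(\<lambda>\<omega>. renorm_wishart_matrix H Z n d \<omega> $$ (i, k)) = entry d (Suc i) (Suc k)"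
    "(\<lambda>\<omega>. rosenblatt_matrix Z n \<omega> $$ (i, k)) = (\<lambda>\<omega>. if i = k then Z (Suc i) 1 \<omega> else 0)" for d
    using n by (auto simp: renorm_wishart_matrix_eq rosenblatt_matrix_eq)
  have L: "L2 M (entry d (Suc i) (Suc k))" "L2 M (limit_entry d (Suc i) (Suc k))" for d
    by (auto intro: entry_L2)
  have Lr: "L2 M (\<lambda>\<omega>. if i = k then Z (Suc i) 1 \<omega> else 0)"
    using Z1_L2[of "Suc i"] by (cases "i = k") (auto simp: L2_def)
  have rd: "real_distribution (distr M borel Y)" if "L2 M Y" for Y
    using that by (intro real_distribution_distr) (simp add: L2_def)
  show ?thesis unfolding eq
  proof (rule integral_cts_step_conv_imp_weak_conv[OF rd[OF L(1)] rd[OF Lr]])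
    fix x y :: real assume xy: "x < y"
    have cm: "cts_step x y \<in> borel_measurable borel"
      unfolding cts_step_def[abs_def] by measurable
    have int: "(\<integral>u. cts_step x y u \<partial>(distr M borel Y)) = (\<integral>\<omega>. cts_step x y (Y \<omega>) \<partial>M)" if "L2 M Y" for Y
      using that by (intro integral_distr cm) (simp add: L2_def)
    \<comment> \<open>Viewed as a function of a family of reals, the test function fits both lemmas:
      the equality in law uses the index set \<open>{1..Suc i}\<close>, the comparison of entries
      the singleton \<open>{Suc i}\<close>.\<close>
    define \<psi> where "\<psi> v = cts_step x y (v (Suc i))" for v :: "nat \<Rightarrow> real"
    have \<psi>m: "\<psi> \<in> borel_measurable (Pi\<^sub>M I (\<lambda>_. borel))" if "Suc i \<in> I" for I
      unfolding \<psi>_def by (rule measurable_compose[OF measurable_component_singleton[OF that] cm])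
    have \<psi>l: "\<bar>\<psi> v - \<psi> w\<bar> \<le> 1 / (y - x) * (\<Sum>j\<in>I. \<bar>v j - w j\<bar>)" if "Suc i \<in> I" "finite I" for v w I
    proof -
      have "\<bar>\<psi> v - \<psi> w\<bar> \<le> 1 / (y - x) * \<bar>v (Suc i) - w (Suc i)\<bar>" unfolding \<psi>_def by (rule cts_step_lipschitz[OF xy])
      also have "\<dots> \<le> 1 / (y - x) * (\<Sum>j\<in>I. \<bar>v j - w j\<bar>)"
        using xy that member_le_sum[of "Suc i" I "\<lambda>j. \<bar>v j - w j\<bar>"] by (intro mult_left_mono) auto
      finally show ?thesis .
    qed
    have K: "0 \<le> 1 / (y - x)" using xy by simp
    have law: "(\<integral>\<omega>. cts_step x y (limit_entry d (Suc i) (Suc k) \<omega>) \<partial>M) = (\<integral>\<omega>. cts_step x y (if i = k then Z (Suc i) 1 \<omega> else 0) \<partial>M)" if d: "1 \<le> d" for d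
    proof (cases "i = k")
      case True
      have "(\<integral>\<omega>. \<psi> (\<lambda>j\<in>{1..Suc i}. real d powr (- H) * Z j (real d) \<omega>) \<partial>M) = (\<integral>\<omega>. \<psi> (\<lambda>j\<in>{1..Suc i}. Z j 1 \<omega>) \<partial>M)"
        using d by (intro joint_law[OF _ \<psi>m \<psi>l K]) auto
      then show ?thesis using True by (simp add: \<psi>_def limit_entry_def)
    qed (simp add: limit_entry_def)
    obtain C where C: "C > 0" "\<And>i k d. 1 \<le> i \<Longrightarrow> 1 \<le> k \<Longrightarrow> 1 \<le> d \<Longrightarrow> (H = 3/4 \<longrightarrow> d \<ge> 2) \<Longrightarrow>
       (\<integral>\<omega>. (entry d i k \<omega> - limit_entry d i k \<omega>)\<^sup>2 \<partial>M) \<le> (C * wasserstein_rate H 1 d)\<^sup>2"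
      using entry_rate by blast
    \<comment> \<open>Starting at \<open>d = 2\<close> satisfies the side condition of the rate for
      every \<open>H\<close>; a limit does not see the omitted index.\<close>
    have bound: "\<bar>(\<integral>\<omega>. cts_step x y (entry d (Suc i) (Suc k) \<omega>) \<partial>M) - (\<integral>\<omega>. cts_step x y (if i = k then Z (Suc i) 1 \<omega> else 0) \<partial>M)\<bar>
        \<le> 1 / (y - x) * (C * wasserstein_rate H 1 d)" if d: "2 \<le> d" for d
    proof -
      have r: "0 \<le> wasserstein_rate H 1 d" using d by (auto simp: wasserstein_rate_def)
      have "\<bar>(\<integral>\<omega>. \<psi> (\<lambda>j\<in>{Suc i}. entry d (Suc i) (Suc k) \<omega>) \<partial>M) - (\<integral>\<omega>. \<psi> (\<lambda>j\<in>{Suc i}. limit_entry d (Suc i) (Suc k) \<omega>) \<partial>M)\<bar>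
        \<le> 1 / (y - x) * (\<Sum>j\<in>{Suc i}. sqrt (\<integral>\<omega>. (entry d (Suc i) (Suc k) \<omega> - limit_entry d (Suc i) (Suc k) \<omega>)\<^sup>2 \<partial>M))"
        using L by (intro lipschitz_expectation(2)[OF _ \<psi>m \<psi>l K]) auto
      also have "\<dots> \<le> 1 / (y - x) * (C * wasserstein_rate H 1 d)"
        using K C(1) r real_sqrt_le_mono[OF C(2)[of "Suc i" "Suc k" d]] d by (intro mult_left_mono) (auto simp: real_sqrt_abs)
      finally show ?thesis using law[of d] d by (simp add: \<psi>_def)
    qed
    have "(\<lambda>d. 1 / (y - x) * (C * wasserstein_rate H 1 d)) \<longlonglongrightarrow> 0"
      by (intro tendsto_mult_right_zero wasserstein_rate_tendsto_0)
    then have "(\<lambda>d. (\<integral>\<omega>. cts_step x y (entry d (Suc i) (Suc k) \<omega>) \<partial>M) - (\<integral>\<omega>. cts_step x y (if i = k then Z (Suc i) 1 \<omega> else 0) \<partial>M)) \<longlonglongrightarrow> 0"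
    proof (rule Lim_null_comparison[rotated])
      show "\<forall>\<^sub>F d in sequentially. norm ((\<integral>\<omega>. cts_step x y (entry d (Suc i) (Suc k) \<omega>) \<partial>M) - (\<integral>\<omega>. cts_step x y (if i = k then Z (Suc i) 1 \<omega> else 0) \<partial>M))
          \<le> 1 / (y - x) * (C * wasserstein_rate H 1 d)"
        using eventually_ge_at_top[of "2::nat"] by (rule eventually_mono) (unfold real_norm_def, rule bound)
    qed
    then show "(\<lambda>d. integral\<^sup>L (distr M borel (entry d (Suc i) (Suc k))) (cts_step x y)) \<longlonglongrightarrow>
        integral\<^sup>L (distr M borel (\<lambda>\<omega>. if i = k then Z (Suc i) 1 \<omega> else 0)) (cts_step x y)"
      unfolding int[OF L(1)] int[OF Lr] by (simp add: LIM_zero_iff)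
  qed
qed

end

theorem theorem2:
  fixes M :: "'a measure"
    and B Z :: "nat \<Rightarrow> real \<Rightarrow> 'a \<Rightarrow> real"
    and H :: real
  assumes "1/2 < H" and "H < 1"
    and "prob_space M"
    and "\<And>i. i \<ge> 1 \<Longrightarrow> standard_brownian_motion M (B i)"
    and "indep_processes M {1..} B"
    and "\<And>i. i \<ge> 1 \<Longrightarrow> rosenblatt_process M (B i) H (Z i)"
  shows "(\<forall>n\<ge>1. \<forall>i<n. \<forall>j<n.
            weak_conv_m (\<lambda>d. distr M borel (\<lambda>\<omega>. renorm_wishart_matrix H Z n d \<omega> $$ (i, j)))
                        (distr M borel (\<lambda>\<omega>. rosenblatt_matrix Z n \<omega> $$ (i, j)))) \<and>
         (\<exists>C>0. \<forall>n\<ge>1. \<forall>d\<ge>1. (H = 3/4 \<longrightarrow> d \<ge> 2) \<longrightarrow>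
            wasserstein_dist n M (renorm_wishart_matrix H Z n d) M (rosenblatt_matrix Z n)
              \<le> ennreal (C * wasserstein_rate H n d))"
proof -
  interpret prob_space M by (rule assms)
  interpret rosenblatt_family H M B Z
    by unfold_locales (use assms in auto)
  show ?thesis using entry_weak_conv wasserstein_bound by blast
qed

end
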